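(* The Dominating Set problem can be solved in time $O^*(3^{dk+o(dk)})$ on undirected graphs of degeneracy $d$.
   Context: Dominating Set: given an undirected graph $G=(V,E)$ and an integer $k$, decide whether there is $S\subseteq V$ with $|S|\le k$ such that every vertex of $G$ is in $S$ or adjacent to a vertex of $S$. The degeneracy of $G$ is the least $d$ such that every subgraph of $G$ has a vertex of degree at most $d$. $O^*(\cdot)$ suppresses factors polynomial in the input size. *)

theory Defs
  imports Complex_Main "HOL-Library.Landau_Symbols" "HOL-Library.Log_Nat"
    "HOL-Computational_Algebra.Polynomial"
begin

subsection \<open>Graphs, degeneracy, dominating sets\<close>

definition simple_graph :: "'a set \<Rightarrow> 'a set set \<Rightarrow> bool" where
  "simple_graph V E \<longleftrightarrow> finite V \<and> (\<forall>e\<in>E. e \<subseteq> V \<and> card e = 2)"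

definition subgraph :: "'a set \<Rightarrow> 'a set set \<Rightarrow> 'a set \<Rightarrow> 'a set set \<Rightarrow> bool" where
  "subgraph V' E' V E \<longleftrightarrow> simple_graph V' E' \<and> V' \<subseteq> V \<and> E' \<subseteq> E"

definition vertex_degree :: "'a set set \<Rightarrow> 'a \<Rightarrow> nat" where
  "vertex_degree E v = card {e \<in> E. v \<in> e}"

text \<open>The empty subgraph has no vertex at all and is therefore excluded.\<close>

definition degeneracy :: "'a set \<Rightarrow> 'a set set \<Rightarrow> nat" where
  "degeneracy V E = (LEAST d. \<forall>V' E'. subgraph V' E' V E \<and> V' \<noteq> {} \<longrightarrow>
     (\<exists>v\<in>V'. vertex_degree E' v \<le> d))"

definition dominating_set :: "'a set \<Rightarrow> 'a set set \<Rightarrow> 'a set \<Rightarrow> bool" where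
  "dominating_set V E S \<longleftrightarrow> S \<subseteq> V \<and> (\<forall>v\<in>V. v \<in> S \<or> (\<exists>u\<in>S. {u, v} \<in> E))"

definition Dominating_Set :: "'a set \<Rightarrow> 'a set set \<Rightarrow> nat \<Rightarrow> bool" where
  "Dominating_Set V E k \<longleftrightarrow> (\<exists>S. dominating_set V E S \<and> card S \<le> k)"

subsection \<open>Random access machine with logarithmic cost\<close>

text \<open>
  Programs of a random access machine, with structured control flow instead of jumps. A program
  mentions finitely many registers; a separate memory is accessed indirectly through registers.
  Registers and memory cells hold arbitrary natural numbers. Every step is charged, besides
  one unit, the binary length of all register and memory contents it reads, including those used
  as addresses. (Register indices and constants are part of the fixed program.)
\<close>

datatype ram =
    Skip
  | Const nat nat        \<comment> \<open>\<open>r\<^sub>i := c\<close>\<close>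
  | Add nat nat nat      \<comment> \<open>\<open>r\<^sub>i := r\<^sub>j + r\<^sub>l\<close>\<close>
  | Sub nat nat nat      \<comment> \<open>\<open>r\<^sub>i := r\<^sub>j - r\<^sub>l\<close>, truncated at 0\<close>
  | Load nat nat         \<comment> \<open>\<open>r\<^sub>i := mem[r\<^sub>j]\<close>\<close>
  | Store nat nat        \<comment> \<open>\<open>mem[r\<^sub>i] := r\<^sub>j\<close>\<close>
  | Seq ram ram
  | If nat ram ram       \<comment> \<open>first branch iff \<open>r\<^sub>i \<noteq> 0\<close>\<close>
  | While nat ram        \<comment> \<open>loop while \<open>r\<^sub>i \<noteq> 0\<close>\<close>

abbreviation len :: "nat \<Rightarrow> nat" where
  "len x \<equiv> floorlog 2 x"

type_synonym config = "(nat \<Rightarrow> nat) \<times> (nat \<Rightarrow> nat)"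

text \<open>\<open>exec P s t s'\<close>: started in \<open>s = (registers, memory)\<close>, program \<open>P\<close> halts in \<open>s'\<close> after
  time \<open>t\<close>.\<close>

inductive exec :: "ram \<Rightarrow> config \<Rightarrow> nat \<Rightarrow> config \<Rightarrow> bool" where
  Skip: "exec Skip s 1 s"
| Const: "exec (Const i c) (r, m) 1 (r(i := c), m)"
| Add: "exec (Add i j l) (r, m) (1 + len (r j) + len (r l)) (r(i := r j + r l), m)"
| Sub: "exec (Sub i j l) (r, m) (1 + len (r j) + len (r l)) (r(i := r j - r l), m)"
| Load: "exec (Load i j) (r, m) (1 + len (r j) + len (m (r j))) (r(i := m (r j)), m)"
| Store: "exec (Store i j) (r, m) (1 + len (r i) + len (r j)) (r, m(r i := r j))"
| Seq: "exec P s t s' \<Longrightarrow> exec Q s' t' s'' \<Longrightarrow> exec (Seq P Q) s (t + t') s''"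
| IfTrue: "r i \<noteq> 0 \<Longrightarrow> exec P (r, m) t s' \<Longrightarrow> exec (If i P Q) (r, m) (1 + len (r i) + t) s'"
| IfFalse: "r i = 0 \<Longrightarrow> exec Q (r, m) t s' \<Longrightarrow> exec (If i P Q) (r, m) (1 + len (r i) + t) s'"
| WhileFalse: "r i = 0 \<Longrightarrow> exec (While i P) (r, m) (1 + len (r i)) (r, m)"
| WhileTrue: "r i \<noteq> 0 \<Longrightarrow> exec P (r, m) t s' \<Longrightarrow> exec (While i P) s' t' s'' \<Longrightarrow>
    exec (While i P) (r, m) (1 + len (r i) + t + t') s''"

inductive_cases exec_elims:
  "exec Skip s t s'" "exec (Const i c) s t s'" "exec (Add i j l) s t s'"
  "exec (Sub i j l) s t s'" "exec (Load i j) s t s'" "exec (Store i j) s t s'"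
  "exec (Seq P Q) s t s'" "exec (If i P Q) s t s'"

lemma exec_deterministic:
  "exec P s t s' \<Longrightarrow> exec P s u s'' \<Longrightarrow> t = u \<and> s' = s''"
proof (induction arbitrary: u s'' rule: exec.induct)
  case Seq
  from Seq.prems show ?case by (elim exec_elims) (use Seq.IH in blast)
next
  case IfTrue
  from IfTrue.prems show ?case by (elim exec_elims) (use IfTrue.hyps IfTrue.IH in fastforce)+
next
  case IfFalse
  from IfFalse.prems show ?case by (elim exec_elims) (use IfFalse.hyps IfFalse.IH in fastforce)+
next
  case WhileFalse
  from WhileFalse.prems show ?case by (cases rule: exec.cases) (use WhileFalse.hyps in simp_all)
next
  case (WhileTrue r i P m t s' t' s1)
  have *: "\<And>a s2. exec P (r, m) a s2 \<Longrightarrow> t = a \<and> s' = s2"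
    and **: "\<And>b s2. exec (While i P) s' b s2 \<Longrightarrow> t' = b \<and> s1 = s2"
    using WhileTrue.IH by blast+
  from WhileTrue.prems show ?case
  proof (cases rule: exec.cases)
    case WhileFalse
    then show ?thesis using WhileTrue.hyps by simp
  next
    case (WhileTrue a s2 b)
    then show ?thesis using *[of a s2] **[of b s''] by simp
  qed
qed (elim exec_elims; simp)+

definition initial :: "nat list \<Rightarrow> config" where
  "initial xs = ((\<lambda>_. 0), (\<lambda>a. if a < length xs then xs ! a else 0))"

text \<open>The answer is read off register 0.\<close>

definition decides_in_time :: "ram \<Rightarrow> nat list \<Rightarrow> bool \<Rightarrow> real \<Rightarrow> bool" where
  "decides_in_time P xs answer T \<longleftrightarrow>
     (\<exists>t s. exec P (initial xs) t s \<and> real t \<le> T \<and> (fst s 0 \<noteq> 0 \<longleftrightarrow> answer))"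

definition input_size :: "nat list \<Rightarrow> nat" where
  "input_size xs = (\<Sum>x\<leftarrow>xs. 1 + len x)"

text \<open>An instance on vertex set \<open>{0, \<dots>, n - 1}\<close>: \<open>k\<close>, \<open>n\<close> and the adjacency matrix by rows.\<close>

definition encode_instance :: "nat \<Rightarrow> nat set set \<Rightarrow> nat \<Rightarrow> nat list" where
  "encode_instance n E k =
     k # n # concat (map (\<lambda>i. map (\<lambda>j. if {i, j} \<in> E then 1 else 0) [0..<n]) [0..<n])"

text \<open>\<open>P\<close> solves Dominating Set in time \<open>O\<^sup>*(f d k)\<close> on graphs of degeneracy \<open>d\<close>.\<close>

definition solves_Dominating_Set_in_O_star :: "ram \<Rightarrow> (nat \<Rightarrow> nat \<Rightarrow> real) \<Rightarrow> bool" where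
  "solves_Dominating_Set_in_O_star P f \<longleftrightarrow>
     (\<exists>p :: real poly. \<forall>n E k d. simple_graph {..<n} E \<and> degeneracy {..<n} E = d \<longrightarrow>
        decides_in_time P (encode_instance n E k) (Dominating_Set {..<n} E k)
          (poly p (real (input_size (encode_instance n E k))) * f d k))"

end

theory Submission
  imports Defs "HOL-Combinatorics.Transposition"
begin

text \<open>
  Order the vertices by repeatedly removing one of minimum degree, so that every vertex has at most \<open>d\<close> later
  neighbours. Process the vertices in this order and look at the first undominated vertex \<open>v\<close>. Either some
  vertex of the solution among \<open>v\<close> and its later neighbours is picked, or \<open>v\<close> is marked: it must then be
  dominated by an earlier neighbour. Picks made later come after all marked vertices, so the marked ones are
  left to the \<open>k\<close> solution vertices not yet picked, and there are at most \<open>d * k\<close> of them. If \<open>v\<close> has exactly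
  one later neighbour \<open>u\<close>, picking \<open>u\<close> is as good as picking \<open>v\<close>, hence there are at most \<open>3 ^ (d - 1)\<close>
  candidates for \<open>d \<ge> 1\<close>. At a leaf the \<open>k\<close>-tuples of vertices covering the marked set are counted by
  inclusion-exclusion, and the choice of the subset is merged into the branching: marking becomes two branches
  that lower the budget \<open>b = d * k - #marked\<close> by one, each pick lowers it by \<open>d\<close>, and
  \<open>2 * 3 ^ (b - 1) + 3 ^ (d - 1) * 3 ^ (b - d) = 3 ^ b\<close>. So there are at most \<open>(n + 1) * 3 ^ (d * k)\<close> states,
  and the error term in the exponent is zero.
\<close>

subsection \<open>Sums over subsets and lists\<close>

lemma sum_Pow_insert:
  fixes f :: "'a set \<Rightarrow> 'b::comm_monoid_add"
  assumes "finite M" "x \<notin> M"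
  shows "sum f (Pow (insert x M)) = (\<Sum>A\<in>Pow M. f A + f (insert x A))"
proof -
  have "inj_on (insert x) (Pow M)" "Pow M \<inter> insert x ` Pow M = {}"
    using assms(2) by (auto simp: inj_on_def)
  then show ?thesis
    using assms(1) by (simp add: Pow_insert sum.union_disjoint sum.reindex sum.distrib)
qed

lemma sum_list_pos_iff:
  fixes f :: "'a \<Rightarrow> nat"
  shows "0 < (\<Sum>x\<leftarrow>xs. f x) \<longleftrightarrow> (\<exists>x\<in>set xs. 0 < f x)"
  by (induction xs) auto

lemma inclusion_exclusion_complement:
  assumes "finite U" "finite M" "\<And>x. x \<in> M \<Longrightarrow> X x \<subseteq> U"
  shows "(\<Sum>A\<in>Pow M. (-1) ^ card A * int (card (U \<inter> \<Inter> (X ` A)))) = int (card (U - \<Union> (X ` M)))"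
proof -
  let ?term = "\<lambda>A. (-1) ^ card A * int (card (U \<inter> \<Inter> (X ` A)))"
  interpret Incl_Excl finite "int \<circ> card"
    by unfold_locales (auto simp: card_Un_disjnt)
  have finite_X: "finite (X x)" if "x \<in> M" for x
    using assms that finite_subset by blast
  have "int (card (\<Union> (X ` M))) =
      (\<Sum>A | A \<subseteq> M \<and> A \<noteq> {}. (-1) ^ (card A + 1) * int (card (\<Inter> (X ` A))))"
    using restricted_indexed[OF assms(2) finite_X] by simp
  also have "\<dots> = (\<Sum>A\<in>Pow M - {{}}. - ?term A)"
  proof (rule sum.cong)
    fix A assume "A \<in> Pow M - {{}}"
    then have "U \<inter> \<Inter> (X ` A) = \<Inter> (X ` A)" using assms(3) by blast
    then show "(-1) ^ (card A + 1) * int (card (\<Inter> (X ` A))) = - ?term A" by simp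
  qed auto
  finally have union: "int (card (\<Union> (X ` M))) = - sum ?term (Pow M - {{}})"
    by (simp add: sum_negf)
  have "\<Union> (X ` M) \<subseteq> U" using assms(3) by blast
  then have "int (card (U - \<Union> (X ` M))) = int (card U) - int (card (\<Union> (X ` M)))"
    using assms(1) by (simp add: card_Diff_subset finite_subset card_mono of_nat_diff)
  also have "\<dots> = sum ?term (Pow M)"
    using assms(2) by (simp add: union sum.remove[of "Pow M" "{}"])
  finally show ?thesis by simp
qed

subsection \<open>Branching over an ordered graph\<close>

text \<open>
  A state \<open>(v, k, b, D, A)\<close>: vertices below \<open>v\<close> are processed, \<open>k\<close> picks are left, \<open>D\<close> is dominated
  by the picks made, \<open>A\<close> is the part of the marked vertices chosen in the inclusion-exclusion sum, and
  \<open>b\<close> is \<open>d * k\<close> minus the number of marked vertices. Each future pick dominates at most \<open>d\<close> marked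
  vertices, so branches in which \<open>b\<close> would become negative are cut.
\<close>

type_synonym state = "nat \<times> nat \<times> nat \<times> nat set \<times> nat set"

definition dominates :: "('a \<Rightarrow> 'b \<Rightarrow> bool) \<Rightarrow> 'a set \<Rightarrow> 'b set \<Rightarrow> bool" where
  "dominates a T X \<longleftrightarrow> (\<forall>x\<in>X. \<exists>u\<in>T. a u x)"

definition degree_from :: "(nat \<Rightarrow> nat \<Rightarrow> bool) \<Rightarrow> nat \<Rightarrow> nat \<Rightarrow> nat \<Rightarrow> nat" where
  "degree_from a n p v = card {u \<in> {p..<n}. a v u}"

locale ordered_graph =
  fixes n d :: nat and a :: "nat \<Rightarrow> nat \<Rightarrow> bool"
  assumes adj_sym: "a u v \<Longrightarrow> a v u"
    and adj_refl: "a v v"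
    and degree_from_Suc_le: "v < n \<Longrightarrow> degree_from a n (Suc v) v \<le> d"
begin

definition later :: "nat \<Rightarrow> nat set" where
  "later v = {u \<in> {Suc v..<n}. a v u}"

text \<open>If \<open>v\<close> has a single later neighbour \<open>u\<close>, picking \<open>u\<close> is at least as good as picking \<open>v\<close>.\<close>

definition first_candidate :: "nat \<Rightarrow> nat" where
  "first_candidate v = (if card (later v) = 1 then Suc v else v)"

definition candidates :: "nat \<Rightarrow> nat list" where
  "candidates v = filter (a v) [first_candidate v..<n]"

definition pick :: "state \<Rightarrow> nat \<Rightarrow> state" where
  "pick = (\<lambda>(v, k, b, D, A) u. (Suc v, k - 1, b - d, D \<union> {x. a u x}, A))"

fun mark_children :: "state \<Rightarrow> state list" where
  "mark_children (v, k, b, D, A) =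
    (if 0 < b then [(Suc v, k, b - 1, D, A), (Suc v, k, b - 1, D, insert v A)] else [])"

fun pick_children :: "state \<Rightarrow> state list" where
  "pick_children (v, k, b, D, A) =
    (if 0 < k \<and> d \<le> b then map (pick (v, k, b, D, A)) (candidates v) else [])"

fun children :: "state \<Rightarrow> state list" where
  "children (v, k, b, D, A) =
    (if v \<in> D then [(Suc v, k, b, D, A)]
     else mark_children (v, k, b, D, A) @ pick_children (v, k, b, D, A))"

definition avoiders :: "nat set \<Rightarrow> nat set" where
  "avoiders A = {w. w < n \<and> (\<forall>x\<in>A. \<not> a w x)}"

fun signed_count :: "nat \<Rightarrow> state \<Rightarrow> int" where
  "signed_count 0 (v, k, b, D, A) = (-1) ^ card A * int (card (avoiders A) ^ k)"
| "signed_count (Suc f) s = (\<Sum>c\<leftarrow>children s. signed_count f c)"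

definition covers :: "nat \<Rightarrow> nat set \<Rightarrow> nat list set" where
  "covers k M = {xs. set xs \<subseteq> {..<n} \<and> length xs = k \<and> dominates a (set xs) M}"

text \<open>The last component \<open>M\<close> is the whole set of marked vertices here, not a part of it.\<close>

fun cover_count :: "nat \<Rightarrow> state \<Rightarrow> nat" where
  "cover_count 0 (v, k, b, D, M) = card (covers k M)"
| "cover_count (Suc f) (v, k, b, D, M) =
    (if v \<in> D then cover_count f (Suc v, k, b, D, M)
     else (if 0 < b then cover_count f (Suc v, k, b - 1, D, insert v M) else 0)
       + (if 0 < k \<and> d \<le> b then \<Sum>u\<leftarrow>candidates v. cover_count f (pick (v, k, b, D, M) u) else 0))"

lemma dominates_subset: "dominates a T X \<Longrightarrow> Y \<subseteq> X \<Longrightarrow> dominates a T Y"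
  by (auto simp: dominates_def)

lemma mem_candidates_iff: "u \<in> set (candidates v) \<longleftrightarrow> first_candidate v \<le> u \<and> u < n \<and> a v u"
  by (auto simp: candidates_def)

lemma finite_later [simp]: "finite (later v)"
  by (simp add: later_def)

lemma card_later_eq: "card (later v) = degree_from a n (Suc v) v"
  by (simp add: later_def degree_from_def)

lemma card_later_le: "v < n \<Longrightarrow> card (later v) \<le> d"
  unfolding card_later_eq by (rule degree_from_Suc_le)

lemma finite_covers [simp]: "finite (covers k M)"
  by (rule finite_subset[OF _ finite_lists_length_eq[of "{..<n}" k]]) (auto simp: covers_def)

lemma sum_avoiders_eq_card_covers:
  assumes "finite M"
  shows "(\<Sum>A\<in>Pow M. (-1) ^ card A * int (card (avoiders A) ^ k)) = int (card (covers k M))"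
proof -
  define U where "U = {xs. set xs \<subseteq> {..<n} \<and> length xs = k}"
  define X where "X x = {xs \<in> U. \<forall>u\<in>set xs. \<not> a u x}" for x
  have "card (avoiders A) ^ k = card (U \<inter> \<Inter> (X ` A))" for A
  proof -
    have "U \<inter> \<Inter> (X ` A) = {xs. set xs \<subseteq> avoiders A \<and> length xs = k}"
      by (auto simp: U_def X_def avoiders_def)
    then show ?thesis by (simp add: card_lists_length_eq avoiders_def)
  qed
  moreover have "covers k M = U - \<Union> (X ` M)"
    by (auto simp: covers_def U_def X_def dominates_def)
  moreover have "finite U" by (simp add: U_def finite_lists_length_eq)
  ultimately show ?thesis
    using inclusion_exclusion_complement[of U M X] assms by (auto simp: X_def)
qed

lemma sum_signed_count:
  assumes "M \<subseteq> {..<v}"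
  shows "(\<Sum>A\<in>Pow M. signed_count f (v, k, b, D, A)) = int (cover_count f (v, k, b, D, M))"
  using assms
proof (induction f arbitrary: v k b D M)
  case 0
  then have "finite M" by (rule finite_subset) simp
  then show ?case using sum_avoiders_eq_card_covers by simp
next
  case (Suc f)
  have marks: "finite M" "v \<notin> M" "M \<subseteq> {..<Suc v}" "insert v M \<subseteq> {..<Suc v}"
    using Suc.prems by (auto intro: finite_subset)
  note unmarked = Suc.IH[OF marks(3)] and marked = Suc.IH[OF marks(4)]
  show ?case
  proof (cases "v \<in> D")
    case True
    then show ?thesis by (simp add: unmarked)
  next
    case False
    have mark: "(\<Sum>A\<in>Pow M. signed_count f (Suc v, k, b - 1, D, A)
          + signed_count f (Suc v, k, b - 1, D, insert v A))
        = int (cover_count f (Suc v, k, b - 1, D, insert v M))"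
      unfolding marked[symmetric] using marks by (simp add: sum_Pow_insert)
    have pick: "(\<Sum>A\<in>Pow M. \<Sum>u\<leftarrow>us. signed_count f (pick (v, k, b, D, A) u))
        = int (\<Sum>u\<leftarrow>us. cover_count f (pick (v, k, b, D, M) u))" for us
      by (induction us) (simp_all add: sum.distrib, simp add: pick_def unmarked)
    have "(\<Sum>A\<in>Pow M. signed_count (Suc f) (v, k, b, D, A))
      = (\<Sum>A\<in>Pow M. (if 0 < b then signed_count f (Suc v, k, b - 1, D, A)
            + signed_count f (Suc v, k, b - 1, D, insert v A) else 0)
          + (if 0 < k \<and> d \<le> b
             then \<Sum>u\<leftarrow>candidates v. signed_count f (pick (v, k, b, D, A) u) else 0))"
      using False by (intro sum.cong) (auto simp: comp_def)
    also have "\<dots> = int (cover_count (Suc f) (v, k, b, D, M))"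
      using False mark pick[of "candidates v"] by (auto simp: sum.distrib)
    finally show ?thesis .
  qed
qed

lemma covers_nonempty_iff:
  assumes "0 < n"
  shows "covers k M \<noteq> {} \<longleftrightarrow> (\<exists>T\<subseteq>{..<n}. card T \<le> k \<and> dominates a T M)"
proof
  assume "covers k M \<noteq> {}"
  then show "\<exists>T\<subseteq>{..<n}. card T \<le> k \<and> dominates a T M"
    unfolding covers_def using card_length by blast
next
  assume "\<exists>T\<subseteq>{..<n}. card T \<le> k \<and> dominates a T M"
  then obtain T where small_cover: "T \<subseteq> {..<n}" "card T \<le> k" "dominates a T M" by blast
  then have "finite T" using finite_subset by blast
  then obtain xs where listing: "set xs = T" "length xs = card T"
    using finite_distinct_list distinct_card by metis
  have "xs @ replicate (k - card T) 0 \<in> covers k M"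
    using small_cover listing assms by (auto simp: covers_def dominates_def)
  then show "covers k M \<noteq> {}" by blast
qed

lemma cover_count_sound:
  assumes "0 < cover_count f (v, k, b, D, M)" "v + f = n" "0 < n"
  shows "\<exists>T \<subseteq> {..<n}. card T \<le> k \<and> dominates a T (M \<union> ({v..<n} - D))"
  using assms(1,2)
proof (induction f arbitrary: v k b D M)
  case 0
  then have "covers k M \<noteq> {}" by auto
  then show ?case using 0 covers_nonempty_iff[OF assms(3)] by simp
next
  case (Suc f)
  have split: "{v..<n} = insert v {Suc v..<n}" and next_position: "Suc v + f = n" using Suc.prems(2) by auto
  consider (skip) "v \<in> D" "0 < cover_count f (Suc v, k, b, D, M)"
    | (mark) "0 < cover_count f (Suc v, k, b - 1, D, insert v M)"
    | (pick) u where "0 < k" "u \<in> set (candidates v)"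
        "0 < cover_count f (Suc v, k - 1, b - d, D \<union> {x. a u x}, M)"
    using Suc.prems(1) unfolding cover_count.simps
    by (auto split: if_splits simp: pick_def sum_list_pos_iff)
  then show ?case
  proof cases
    case skip
    then show ?thesis using Suc.IH[OF skip(2) next_position] by (auto simp: split)
  next
    case mark
    have "M \<union> ({v..<n} - D) \<subseteq> insert v M \<union> ({Suc v..<n} - D)" by (auto simp: split)
    then show ?thesis using Suc.IH[OF mark next_position] dominates_subset by blast
  next
    case (pick u)
    from Suc.IH[OF pick(3) next_position] obtain T where rest: "T \<subseteq> {..<n}" "card T \<le> k - 1"
      and rest_dominates: "dominates a T (M \<union> ({Suc v..<n} - (D \<union> {x. a u x})))" by blast
    have picked: "u < n" "a u v" using pick(2) adj_sym by (auto simp: mem_candidates_iff)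
    have "dominates a (insert u T) (M \<union> ({v..<n} - D))"
      using rest_dominates picked(2) unfolding dominates_def split by blast
    moreover have "card (insert u T) \<le> k" using pick(1) rest(2) by (rule card_insert_le_m1)
    ultimately show ?thesis using rest picked by (intro exI[of _ "insert u T"]) auto
  qed
qed

text \<open>
  A completion picks the remaining vertices of a solution: it dominates the marked vertices from
  earlier positions, as otherwise a candidate would have been picked instead of marking.
\<close>

definition completion :: "nat \<Rightarrow> nat \<Rightarrow> nat set \<Rightarrow> nat set \<Rightarrow> nat set \<Rightarrow> bool" where
  "completion v k D M T \<longleftrightarrow> T \<subseteq> {..<n} \<and> card T \<le> k \<and> M \<subseteq> {..<v} \<and>
     (\<forall>x\<in>M. \<exists>u\<in>T. u < x \<and> a u x) \<and> dominates a T ({v..<n} - D)"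

lemma card_marked_le:
  assumes "completion v k D M T" "v \<le> n"
  shows "card M \<le> d * k"
proof -
  have solution: "T \<subseteq> {..<n}" "finite T" "card T \<le> k"
    using assms(1) by (auto simp: completion_def intro: finite_subset)
  have "M \<subseteq> (\<Union>u\<in>T. later u)"
    using assms unfolding completion_def later_def by fastforce
  then have "card M \<le> card (\<Union>u\<in>T. later u)"
    using solution(2) by (intro card_mono) auto
  also have "\<dots> \<le> (\<Sum>u\<in>T. card (later u))" using solution(2) by (rule card_UN_le)
  also have "\<dots> \<le> (\<Sum>u\<in>T. d)" using solution(1) by (intro sum_mono card_later_le) auto
  also have "\<dots> \<le> d * k" using solution(3) by simp
  finally show ?thesis .
qed

lemma completion_Suc: "completion v k D M T \<Longrightarrow> completion (Suc v) k D M T"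
  by (auto simp: completion_def dominates_def)

lemma completion_cases:
  assumes "completion v k D M T" "v < n"
  obtains (skip) "v \<in> D" | (mark) t where "v \<notin> D" "t \<in> T" "a t v" "t < v"
    | (pick) t where "v \<notin> D" "t \<in> T" "a t v" "v \<le> t" "t < n"
proof (cases "v \<in> D")
  case False
  then obtain t where "t \<in> T" "a t v" "t < n"
    using assms unfolding completion_def dominates_def by fastforce
  then show ?thesis using False mark pick by (cases "t < v") auto
qed (rule skip)

lemma completion_mark:
  assumes "completion v k D M T" "u \<in> T" "u < v" "a u v"
  shows "completion (Suc v) k D (insert v M) T"
  using assms by (auto simp: completion_def dominates_def)

lemma completion_pick:
  assumes "completion v k D M T" "t \<in> T" "v \<le> t"
    and "\<And>x. v < x \<Longrightarrow> x < n \<Longrightarrow> a t x \<Longrightarrow> a u x"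
  shows "0 < k" "completion (Suc v) (k - 1) (D \<union> {x. a u x}) M (T - {t})"
proof -
  have "finite T" using assms(1) by (auto simp: completion_def intro: finite_subset)
  then have "card T = Suc (card (T - {t}))" using assms(2) by (rule card.remove)
  moreover have "\<exists>u\<in>T - {t}. u < x \<and> a u x" if "x \<in> M" for x
  proof -
    have "x < v" "\<exists>u\<in>T. u < x \<and> a u x" using assms(1) that by (auto simp: completion_def)
    then show ?thesis using assms(3) by fastforce
  qed
  moreover have "dominates a (T - {t}) ({Suc v..<n} - (D \<union> {x. a u x}))"
    unfolding dominates_def
  proof
    fix x assume undominated: "x \<in> {Suc v..<n} - (D \<union> {x. a u x})"
    then have "x \<in> {v..<n} - D" by auto
    then obtain w where "w \<in> T" "a w x"
      using assms(1) unfolding completion_def dominates_def by blast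
    moreover have "w \<noteq> t" using undominated \<open>a w x\<close> assms(4)[of x] by auto
    ultimately show "\<exists>w\<in>T - {t}. a w x" by blast
  qed
  ultimately show "0 < k" "completion (Suc v) (k - 1) (D \<union> {x. a u x}) M (T - {t})"
    using assms(1) by (auto simp: completion_def)
qed

lemma candidate_exchange:
  assumes "v \<le> t" "t < n" "a t v"
  obtains u where "u \<in> set (candidates v)" "\<And>x. v < x \<Longrightarrow> x < n \<Longrightarrow> a t x \<Longrightarrow> a u x"
proof (cases "first_candidate v \<le> t")
  case True
  then show ?thesis using assms that[of t] adj_sym by (auto simp: mem_candidates_iff)
next
  case False
  then have t_eq: "t = v" and "card (later v) = 1"
    using assms(1) by (auto simp: first_candidate_def split: if_splits)
  then obtain u where later_eq: "later v = {u}" by (auto simp: card_1_singleton_iff)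
  have "u \<in> later v" using later_eq by simp
  then have "u \<in> set (candidates v)"
    using later_eq by (simp add: mem_candidates_iff first_candidate_def later_def)
  moreover have "a u x" if "v < x" "x < n" "a t x" for x
  proof -
    have "x \<in> later v" using that t_eq by (auto simp: later_def)
    then show ?thesis using later_eq adj_refl by simp
  qed
  ultimately show ?thesis using that by blast
qed

lemma completion_mark_budget:
  assumes "completion (Suc v) k D (insert v M) T" "v < n" "finite M" "v \<notin> M" "b + card M = d * k"
  shows "0 < b" "b - 1 + card (insert v M) = d * k"
proof -
  have "Suc (card M) \<le> d * k" using card_marked_le[OF assms(1)] assms(2-4) by simp
  then show "0 < b" "b - 1 + card (insert v M) = d * k" using assms(3-5) by auto
qed

lemma completion_pick_budget:
  assumes "completion (Suc v) (k - 1) D M T" "v < n" "0 < k" "b + card M = d * k"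
  shows "d \<le> b" "b - d + card M = d * (k - 1)"
proof -
  have "card M \<le> d * (k - 1)" using card_marked_le[OF assms(1)] assms(2) by simp
  moreover have "d * k = d * (k - 1) + d" using assms(3) by (cases k) auto
  ultimately show "d \<le> b" "b - d + card M = d * (k - 1)" using assms(4) by auto
qed

lemma cover_count_complete:
  assumes "completion v k D M T" "v + f = n" "b + card M = d * k" "0 < n"
  shows "0 < cover_count f (v, k, b, D, M)"
  using assms(1-3)
proof (induction f arbitrary: v k b D M T)
  case 0
  then have "T \<subseteq> {..<n} \<and> card T \<le> k \<and> dominates a T M"
    by (auto simp: completion_def dominates_def)
  then have "covers k M \<noteq> {}" using covers_nonempty_iff[OF assms(4)] by blast
  then show ?case by (simp add: card_gt_0_iff)
next
  case (Suc f)
  note completion = Suc.prems(1) and budget = Suc.prems(3)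
  have position: "v < n" "Suc v + f = n" using Suc.prems(2) by auto
  have marks: "finite M" "v \<notin> M" using completion by (auto simp: completion_def intro: finite_subset)
  from completion position(1) show ?case
  proof (cases rule: completion_cases)
    case skip
    then show ?thesis using Suc.IH[OF completion_Suc[OF completion] position(2) budget] by simp
  next
    case (mark t)
    note marked = completion_mark[OF completion mark(2,4,3)]
    note marked_budget = completion_mark_budget[OF marked position(1) marks budget]
    show ?thesis using Suc.IH[OF marked position(2) marked_budget(2)] mark(1) marked_budget(1) by simp
  next
    case (pick t)
    obtain u where candidate: "u \<in> set (candidates v)"
      and better: "\<And>x. v < x \<Longrightarrow> x < n \<Longrightarrow> a t x \<Longrightarrow> a u x"
      using pick(3-5) by (metis candidate_exchange)
    note picked = completion_pick[OF completion pick(2,4) better]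
    note picked_budget = completion_pick_budget[OF picked(2) position(1) picked(1) budget]
    have "0 < cover_count f (pick (v, k, b, D, M) u)"
      using Suc.IH[OF picked(2) position(2) picked_budget(2)] by (simp add: pick_def)
    then show ?thesis using pick(1) picked(1) picked_budget(1) candidate by (auto simp: sum_list_pos_iff)
  qed
qed

theorem signed_count_pos_iff:
  assumes "0 < n"
  shows "0 < signed_count n (0, k, d * k, {}, {}) \<longleftrightarrow>
    (\<exists>T \<subseteq> {..<n}. card T \<le> k \<and> dominates a T {..<n})"
proof -
  have "signed_count n (0, k, d * k, {}, {}) = int (cover_count n (0, k, d * k, {}, {}))"
    using sum_signed_count[of "{}" 0 n k "d * k" "{}"] by simp
  moreover have "(\<exists>T \<subseteq> {..<n}. card T \<le> k \<and> dominates a T {..<n}) \<longleftrightarrow>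
      0 < cover_count n (0, k, d * k, {}, {})"
    using cover_count_sound[of n 0 k "d * k" "{}" "{}"] assms
      cover_count_complete[of 0 k "{}" "{}" _ n "d * k"]
    by (auto simp: completion_def lessThan_atLeast0)
  ultimately show ?thesis by simp
qed

definition weight :: "state \<Rightarrow> nat" where
  "weight = (\<lambda>(v, k, b, D, A). (n + 1 - v) * 3 ^ b)"

lemma length_candidates: "length (candidates v) = card (set (candidates v))"
  by (rule distinct_card[symmetric]) (simp add: candidates_def)

lemma length_candidates_le:
  assumes "v < n"
  shows "3 * length (candidates v) \<le> 3 ^ max 1 d"
proof (cases "card (later v) \<le> 1")
  case True
  have "set (candidates v) = (if card (later v) = 1 then later v else {v})"
    using True assms adj_refl
    by (auto simp: mem_candidates_iff first_candidate_def later_def Suc_le_eq le_less)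
  then have "length (candidates v) = 1" by (simp add: length_candidates)
  moreover have "(3::nat) ^ 1 \<le> 3 ^ max 1 d" by (rule power_increasing) auto
  ultimately show ?thesis by simp
next
  case False
  have three_times_Suc_le: "3 * Suc e \<le> 3 ^ e" if "2 \<le> e" for e :: nat
    using that by (induction e rule: dec_induct) auto
  have degree_bounds: "2 \<le> d" "Suc (card (later v)) \<le> Suc d" using card_later_le[OF assms] False by auto
  have "set (candidates v) = insert v (later v)" "v \<notin> later v"
    using False assms adj_refl by (auto simp: mem_candidates_iff first_candidate_def later_def)
  then have "length (candidates v) = Suc (card (later v))" by (simp add: length_candidates)
  then show ?thesis using three_times_Suc_le[OF degree_bounds(1)] degree_bounds by (simp add: max_def)
qed

lemma sum_weight_picks_le:
  assumes "v < n"
  shows "3 * (\<Sum>u\<leftarrow>candidates v. weight (pick (v, k, b, D, A) u)) \<le> (n - v) * 3 ^ (b - d + max 1 d)"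
proof -
  have "(\<Sum>u\<leftarrow>us. weight (pick (v, k, b, D, A) u)) = length us * ((n - v) * 3 ^ (b - d))" for us
    by (induction us) (auto simp: pick_def weight_def)
  then have "3 * (\<Sum>u\<leftarrow>candidates v. weight (pick (v, k, b, D, A) u))
      = 3 * length (candidates v) * ((n - v) * 3 ^ (b - d))" by simp
  also have "\<dots> \<le> 3 ^ max 1 d * ((n - v) * 3 ^ (b - d))"
    using length_candidates_le[OF assms] by (rule mult_le_mono1)
  also have "\<dots> = (n - v) * 3 ^ (b - d + max 1 d)" by (simp only: power_add ac_simps)
  finally show ?thesis .
qed

lemma sum_weight_children_less:
  assumes "v < n" "d = 0 \<Longrightarrow> b = 0"
  shows "(\<Sum>c\<leftarrow>children (v, k, b, D, A). weight c) < weight (v, k, b, D, A)"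
proof -
  let ?picks = "\<Sum>u\<leftarrow>candidates v. weight (pick (v, k, b, D, A) u)"
  have weight_Suc: "weight (Suc v, k', b', D', A') = (n - v) * 3 ^ b'" for k' b' D' A'
    by (simp add: weight_def)
  have children: "(\<Sum>c\<leftarrow>children (v, k, b, D, A). weight c) =
      (if v \<in> D then (n - v) * 3 ^ b
       else (if 0 < b then 2 * ((n - v) * 3 ^ (b - 1)) else 0) + (if 0 < k \<and> d \<le> b then ?picks else 0))"
    by (auto simp: weight_Suc comp_def)
  have "(\<Sum>c\<leftarrow>children (v, k, b, D, A). weight c) \<le> (n - v) * 3 ^ b"
  proof (cases b)
    case 0
    have "d = 0 \<Longrightarrow> ?picks \<le> n - v" using sum_weight_picks_le[OF assms(1), of k b D A] 0 by simp
    then show ?thesis unfolding children using 0 by simp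
  next
    case (Suc b')
    then have "b - d + max 1 d = Suc b'" if "d \<le> b" using assms(2) that by (cases d) auto
    then have "?picks \<le> (n - v) * 3 ^ b'" if "d \<le> b"
      using sum_weight_picks_le[OF assms(1), of k b D A] that by simp
    then show ?thesis unfolding children using Suc by auto
  qed
  also have "\<dots> < weight (v, k, b, D, A)" using assms(1) by (simp add: weight_def)
  finally show ?thesis .
qed

definition successors :: "state \<Rightarrow> state list" where
  "successors q = (if fst q < n then children q else [])"

definition leaf_value :: "state \<Rightarrow> int" where
  "leaf_value q = (if fst q < n then 0 else signed_count 0 q)"

definition state_value :: "state \<Rightarrow> int" where
  "state_value q = signed_count (n - fst q) q"

lemma fst_children: "c \<in> set (children q) \<Longrightarrow> fst c = Suc (fst q)"
  by (cases q) (auto simp: pick_def split: if_splits)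

lemma state_value_eq: "state_value q = leaf_value q + (\<Sum>c\<leftarrow>successors q. state_value c)"
proof (cases "fst q < n")
  case True
  then have "state_value q = (\<Sum>c\<leftarrow>children q. signed_count (n - Suc (fst q)) c)"
    by (simp add: state_value_def flip: Suc_diff_Suc)
  also have "\<dots> = (\<Sum>c\<leftarrow>children q. state_value c)"
    by (rule arg_cong[where f=sum_list], rule map_cong) (simp_all add: state_value_def fst_children)
  finally show ?thesis using True by (simp add: leaf_value_def successors_def)
qed (simp add: state_value_def leaf_value_def successors_def)

definition admissible :: "nat \<Rightarrow> state \<Rightarrow> bool" where
  "admissible K = (\<lambda>(v, k, b, D, A). v \<le> n \<and> k \<le> K \<and> (d = 0 \<longrightarrow> b = 0))"

lemma admissible_successors: "admissible K q \<Longrightarrow> c \<in> set (successors q) \<Longrightarrow> admissible K c"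
  by (cases q) (auto simp: admissible_def successors_def pick_def split: if_splits)

lemma weight_pos: "admissible K q \<Longrightarrow> 0 < weight q"
  by (cases q) (auto simp: admissible_def weight_def)

lemma length_le_sum_weight:
  "\<forall>q\<in>set qs. admissible K q \<Longrightarrow> length qs \<le> (\<Sum>q\<leftarrow>qs. weight q)"
proof (induction qs)
  case (Cons q qs)
  then show ?case using weight_pos[of K q] by simp
qed simp

lemma sum_weight_successors_less:
  assumes "admissible K q"
  shows "(\<Sum>c\<leftarrow>successors q. weight c) < weight q"
proof -
  obtain v k b D A where q_eq: "q = (v, k, b, D, A)" by (cases q)
  show ?thesis
    using sum_weight_children_less[of v b k D A] weight_pos[OF assms] assms
    by (simp add: successors_def q_eq admissible_def del: children.simps)
qed

end

subsection \<open>Verification conditions for the random access machine\<close>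

text \<open>
  \<open>u\<close> counts steps. All registers and memory cells stay below \<open>2 ^ L\<close>, so one step costs at most
  \<open>2 * L + 1\<close>.
\<close>

definition bounded :: "nat \<Rightarrow> config \<Rightarrow> bool" where
  "bounded L s \<longleftrightarrow> (\<forall>i. fst s i < 2 ^ L) \<and> (\<forall>i. snd s i < 2 ^ L)"

definition wp :: "nat \<Rightarrow> ram \<Rightarrow> (nat \<Rightarrow> config \<Rightarrow> bool) \<Rightarrow> config \<Rightarrow> bool" where
  "wp L P Q s \<longleftrightarrow> (bounded L s \<longrightarrow>
    (\<exists>t s' u. exec P s t s' \<and> t \<le> u * (2 * L + 1) \<and> bounded L s' \<and> Q u s'))"

lemma wpI:
  assumes "bounded L s \<Longrightarrow> exec P s t s' \<and> t \<le> u * (2 * L + 1) \<and> bounded L s'" "Q u s'"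
  shows "wp L P Q s"
  using assms unfolding wp_def by blast

lemma wpE:
  assumes "wp L P Q s" "bounded L s"
  obtains t s' u where "exec P s t s'" "t \<le> u * (2 * L + 1)" "bounded L s'" "Q u s'"
  using assms unfolding wp_def by blast

lemma wp_mono:
  assumes "wp L P Q s" "\<And>u s'. Q u s' \<Longrightarrow> Q' u s'"
  shows "wp L P Q' s"
  using assms unfolding wp_def by blast

lemma len_le: "x < 2 ^ L \<Longrightarrow> len x \<le> L"
  by (rule floorlog_leI) auto

lemma bounded_len_le: "bounded L (r, m) \<Longrightarrow> len (r i) \<le> L"
  by (rule len_le) (simp add: bounded_def)

lemma wp_Skip: "Q 1 s \<Longrightarrow> wp L Skip Q s"
  by (rule wpI[where t=1 and u=1]) (auto intro: exec.intros[simplified])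

lemma wp_Const: "c < 2 ^ L \<Longrightarrow> Q 1 (r(i := c), m) \<Longrightarrow> wp L (Const i c) Q (r, m)"
  by (rule wpI[where t=1 and u=1]) (auto intro: exec.intros[simplified] simp: bounded_def)

lemma wp_Add: "r j + r l < 2 ^ L \<Longrightarrow> Q 1 (r(i := r j + r l), m) \<Longrightarrow> wp L (Add i j l) Q (r, m)"
  by (rule wpI[where t="1 + len (r j) + len (r l)" and u=1])
    (auto intro: exec.intros[simplified] simp: bounded_def mult_2 intro!: add_mono len_le)

lemma wp_Sub: "Q 1 (r(i := r j - r l), m) \<Longrightarrow> wp L (Sub i j l) Q (r, m)"
  by (rule wpI[where t="1 + len (r j) + len (r l)" and u=1])
    (auto intro: exec.intros[simplified] simp: bounded_def mult_2 less_imp_diff_less intro!: add_mono len_le)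

lemma wp_Load: "Q 1 (r(i := m (r j)), m) \<Longrightarrow> wp L (Load i j) Q (r, m)"
  by (rule wpI[where t="1 + len (r j) + len (m (r j))" and u=1])
    (auto intro: exec.intros[simplified] simp: bounded_def mult_2 intro!: add_mono len_le)

lemma wp_Store: "Q 1 (r, m(r i := r j)) \<Longrightarrow> wp L (Store i j) Q (r, m)"
  by (rule wpI[where t="1 + len (r i) + len (r j)" and u=1])
    (auto intro: exec.intros[simplified] simp: bounded_def mult_2 intro!: add_mono len_le)

lemma wp_Seq:
  assumes "wp L P1 (\<lambda>u. wp L P2 (\<lambda>u'. Q (u + u'))) s"
  shows "wp L (Seq P1 P2) Q s"
  unfolding wp_def
proof
  assume "bounded L s"
  from assms this obtain t s' u where first: "exec P1 s t s'" "t \<le> u * (2 * L + 1)" "bounded L s'"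
    "wp L P2 (\<lambda>u'. Q (u + u')) s'" by (rule wpE)
  from first(4,3) obtain t' s'' u' where second: "exec P2 s' t' s''" "t' \<le> u' * (2 * L + 1)"
    "bounded L s''" "Q (u + u') s''" by (rule wpE)
  have "t + t' \<le> (u + u') * (2 * L + 1)" using first(2) second(2) by (simp add: algebra_simps)
  then show "\<exists>t s' u. exec (Seq P1 P2) s t s' \<and> t \<le> u * (2 * L + 1) \<and> bounded L s' \<and> Q u s'"
    using exec.Seq[OF first(1) second(1)] second(3,4) by blast
qed

lemma wp_If:
  assumes "r i \<noteq> 0 \<Longrightarrow> wp L P1 (\<lambda>u. Q (Suc u)) (r, m)"
    and "r i = 0 \<Longrightarrow> wp L P2 (\<lambda>u. Q (Suc u)) (r, m)"
  shows "wp L (If i P1 P2) Q (r, m)"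
  unfolding wp_def
proof
  assume bounded: "bounded L (r, m)"
  obtain P where branch_wp: "wp L P (\<lambda>u. Q (Suc u)) (r, m)"
    and branch: "\<And>t s. exec P (r, m) t s \<Longrightarrow> exec (If i P1 P2) (r, m) (1 + len (r i) + t) s"
    using assms exec.IfTrue[of r i P1 m _ _ P2] exec.IfFalse[of r i P2 m _ _ P1] by metis
  from branch_wp bounded obtain t s' u where run: "exec P (r, m) t s'" "t \<le> u * (2 * L + 1)"
    "bounded L s'" "Q (Suc u) s'" by (rule wpE)
  have "1 + len (r i) + t \<le> Suc u * (2 * L + 1)" using run(2) bounded_len_le[OF bounded, of i] by simp
  then show "\<exists>t s' u. exec (If i P1 P2) (r, m) t s' \<and> t \<le> u * (2 * L + 1) \<and> bounded L s' \<and> Q u s'"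
    using branch[OF run(1)] run(3,4) by blast
qed

lemma wp_While_False:
  assumes "r i = 0" "Q 1 (r, m)"
  shows "wp L (While i P) Q (r, m)"
  by (rule wpI[where t="1 + len (r i)" and u=1])
    (use assms exec.WhileFalse[of r i P m] in \<open>simp_all add: bounded_def floorlog_def\<close>)

lemma wp_While_True:
  assumes "r i \<noteq> 0" "wp L P (\<lambda>u. wp L (While i P) (\<lambda>u'. Q (Suc (u + u')))) (r, m)"
  shows "wp L (While i P) Q (r, m)"
  unfolding wp_def
proof
  assume bounded: "bounded L (r, m)"
  from assms(2) this obtain t s' u where body: "exec P (r, m) t s'" "t \<le> u * (2 * L + 1)"
    "bounded L s'" "wp L (While i P) (\<lambda>u'. Q (Suc (u + u'))) s'" by (rule wpE)
  from body(4,3) obtain t' s'' u' where rest: "exec (While i P) s' t' s''" "t' \<le> u' * (2 * L + 1)"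
    "bounded L s''" "Q (Suc (u + u')) s''" by (rule wpE)
  have "1 + len (r i) + t + t' \<le> Suc (u + u') * (2 * L + 1)"
    using body(2) rest(2) bounded_len_le[OF bounded, of i] by (simp add: algebra_simps)
  then show "\<exists>t s' u. exec (While i P) (r, m) t s' \<and> t \<le> u * (2 * L + 1) \<and> bounded L s' \<and> Q u s'"
    using exec.WhileTrue[OF assms(1) body(1) rest(1)] rest(3,4) by blast
qed

fun vc :: "nat \<Rightarrow> ram \<Rightarrow> (nat \<Rightarrow> config \<Rightarrow> bool) \<Rightarrow> config \<Rightarrow> bool" where
  "vc L Skip Q s = Q 1 s"
| "vc L (Const i c) Q (r, m) = (c < 2 ^ L \<and> Q 1 (r(i := c), m))"
| "vc L (Add i j l) Q (r, m) = (r j + r l < 2 ^ L \<and> Q 1 (r(i := r j + r l), m))"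
| "vc L (Sub i j l) Q (r, m) = Q 1 (r(i := r j - r l), m)"
| "vc L (Load i j) Q (r, m) = Q 1 (r(i := m (r j)), m)"
| "vc L (Store i j) Q (r, m) = Q 1 (r, m(r i := r j))"
| "vc L (Seq P1 P2) Q s = vc L P1 (\<lambda>u. vc L P2 (\<lambda>u'. Q (u + u'))) s"
| "vc L (If i P1 P2) Q (r, m) =
    (if r i \<noteq> 0 then vc L P1 (\<lambda>u. Q (Suc u)) (r, m) else vc L P2 (\<lambda>u. Q (Suc u)) (r, m))"
| "vc L (While i P) Q s = wp L (While i P) Q s"

lemma vc_mono: "vc L P Q s \<Longrightarrow> (\<And>u s'. Q u s' \<Longrightarrow> Q' u s') \<Longrightarrow> vc L P Q' s"
proof (induction P arbitrary: Q Q' s)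
  case (Seq P1 P2)
  have "vc L P1 (\<lambda>u. vc L P2 (\<lambda>u'. Q (u + u'))) s" using Seq.prems(1) by simp
  then have "vc L P1 (\<lambda>u. vc L P2 (\<lambda>u'. Q' (u + u'))) s"
    by (rule Seq.IH(1)) (erule Seq.IH(2), rule Seq.prems(2))
  then show ?case by simp
next
  case (If i P1 P2)
  show ?case using If.prems by (cases s) (auto intro: If.IH)
next
  case (While i P)
  then show ?case by (auto intro: wp_mono)
qed auto

theorem vc_sound: "vc L P Q s \<Longrightarrow> wp L P Q s"
proof (induction P arbitrary: Q s)
  case (Seq P1 P2)
  show ?case using Seq.prems by (auto intro!: wp_Seq intro: wp_mono Seq.IH)
next
  case (If i P1 P2)
  show ?case using If.prems by (cases s) (auto intro!: wp_If intro: If.IH split: if_splits)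
qed (auto intro: wp_Skip wp_Const wp_Add wp_Sub wp_Load wp_Store)

fun writes :: "ram \<Rightarrow> nat set" where
  "writes Skip = {}"
| "writes (Const i c) = {i}"
| "writes (Add i j l) = {i}"
| "writes (Sub i j l) = {i}"
| "writes (Load i j) = {i}"
| "writes (Store i j) = {}"
| "writes (Seq P1 P2) = writes P1 \<union> writes P2"
| "writes (If i P1 P2) = writes P1 \<union> writes P2"
| "writes (While i P) = writes P"

definition unchanged :: "nat set \<Rightarrow> (nat \<Rightarrow> nat) \<Rightarrow> (nat \<Rightarrow> nat) \<Rightarrow> bool" where
  "unchanged X r r' \<longleftrightarrow> (\<forall>i. i \<notin> X \<longrightarrow> r' i = r i)"

lemma unchanged_refl [simp]: "unchanged X r r"
  by (simp add: unchanged_def)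

lemma unchanged_trans: "unchanged X r r' \<Longrightarrow> unchanged X r' r'' \<Longrightarrow> unchanged X r r''"
  by (simp add: unchanged_def)

lemma unchanged_mono: "unchanged X r r' \<Longrightarrow> X \<subseteq> Y \<Longrightarrow> unchanged Y r r'"
  by (auto simp: unchanged_def)

lemma exec_unchanged: "exec P s t s' \<Longrightarrow> unchanged (writes P) (fst s) (fst s')"
proof (induction rule: exec.induct)
  case (WhileTrue r i P m t s' t' s'')
  then show ?case using unchanged_trans[of "writes P" r "fst s'"] by simp
qed (auto simp: unchanged_def)

lemma wp_unchanged:
  assumes "wp L P (\<lambda>u s'. unchanged (writes P) (fst s) (fst s') \<longrightarrow> Q u s') s"
  shows "wp L P Q s"
  unfolding wp_def
proof
  assume "bounded L s"
  with assms obtain t s' u where run: "exec P s t s'" "t \<le> u * (2 * L + 1)" "bounded L s'"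
    and post: "unchanged (writes P) (fst s) (fst s') \<longrightarrow> Q u s'" by (rule wpE)
  have "Q u s'" using post exec_unchanged[OF run(1)] by (rule mp)
  then show "\<exists>t s' u. exec P s t s' \<and> t \<le> u * (2 * L + 1) \<and> bounded L s' \<and> Q u s'"
    using run by blast
qed

lemma vc_unchanged:
  assumes "vc L P (\<lambda>u s'. unchanged X (fst s) (fst s') \<longrightarrow> Q u s') s" "writes P \<subseteq> X"
  shows "vc L P Q s"
  using assms
proof (induction P arbitrary: Q s)
  case (Seq P1 P2)
  have "vc L P1 (\<lambda>u. vc L P2 (\<lambda>u' s''. unchanged X (fst s) (fst s'') \<longrightarrow> Q (u + u') s'')) s"
    using Seq.prems(1) by simp
  then have "vc L P1 (\<lambda>u s'. unchanged X (fst s) (fst s') \<longrightarrow> vc L P2 (\<lambda>u'. Q (u + u')) s') s"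
  proof (rule vc_mono, intro impI)
    fix u s'
    assume second: "vc L P2 (\<lambda>u' s''. unchanged X (fst s) (fst s'') \<longrightarrow> Q (u + u') s'') s'"
      and first: "unchanged X (fst s) (fst s')"
    show "vc L P2 (\<lambda>u'. Q (u + u')) s'"
    proof (rule Seq.IH(2))
      show "vc L P2 (\<lambda>u' s''. unchanged X (fst s') (fst s'') \<longrightarrow> Q (u + u') s'') s'"
        using second by (rule vc_mono) (use unchanged_trans[OF first] in blast)
    qed (use Seq.prems(2) in simp)
  qed
  then have "vc L P1 (\<lambda>u. vc L P2 (\<lambda>u'. Q (u + u'))) s"
    by (rule Seq.IH(1)) (use Seq.prems(2) in simp)
  then show ?case by simp
next
  case (If i P1 P2)
  obtain r m where s_eq: "s = (r, m)" by (cases s)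
  have "vc L P1 (\<lambda>u. Q (Suc u)) s" if "r i \<noteq> 0"
    by (rule If.IH(1)) (use If.prems that in \<open>simp_all add: s_eq\<close>)
  moreover have "vc L P2 (\<lambda>u. Q (Suc u)) s" if "r i = 0"
    by (rule If.IH(2)) (use If.prems that in \<open>simp_all add: s_eq\<close>)
  ultimately show ?case by (simp add: s_eq)
next
  case (While i P)
  then have "wp L (While i P) (\<lambda>u s'. unchanged X (fst s) (fst s') \<longrightarrow> Q u s') s" by simp
  then have "wp L (While i P) (\<lambda>u s'. unchanged (writes (While i P)) (fst s) (fst s') \<longrightarrow> Q u s') s"
    by (rule wp_mono) (blast intro: unchanged_mono[OF _ While.prems(2)])
  then show ?case unfolding vc.simps by (rule wp_unchanged)
qed (auto simp: unchanged_def)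

lemma vc_consequence:
  assumes "vc L P (\<lambda>u (r', m'). R u r' m') (r, m)"
    and "\<And>u r' m'. R u r' m' \<Longrightarrow> unchanged (writes P) r r' \<Longrightarrow> Q u (r', m')"
  shows "vc L P Q (r, m)"
  by (rule vc_unchanged[OF vc_mono[OF assms(1)] order.refl]) (auto intro: assms(2))

primrec seqs :: "ram list \<Rightarrow> ram" where
  "seqs [] = Skip"
| "seqs (P # Ps) = Seq P (seqs Ps)"

lemma vc_seqs_simps [simp]:
  "vc L (seqs []) Q s = Q 1 s"
  "vc L (seqs (P # Ps)) Q s = vc L P (\<lambda>u. vc L (seqs Ps) (\<lambda>u'. Q (u + u'))) s"
  by simp_all

lemma writes_seqs [simp]: "writes (seqs Ps) = (\<Union>P\<in>set Ps. writes P)"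
  by (induction Ps) auto

declare seqs.simps [simp del]

lemma vc_seqs:
  assumes "vc L P (\<lambda>u (r', m'). R u r' m') (r, m)"
    and "\<And>u r' m'. R u r' m' \<Longrightarrow> unchanged (writes P) r r' \<Longrightarrow>
      vc L (seqs Ps) (\<lambda>u'. Q (u + u')) (r', m')"
  shows "vc L (seqs (P # Ps)) Q (r, m)"
proof -
  have "vc L P (\<lambda>u. vc L (seqs Ps) (\<lambda>u'. Q (u + u'))) (r, m)"
    by (rule vc_consequence[OF assms(1)]) (rule assms(2))
  then show ?thesis by simp
qed

text \<open>The index \<open>g\<close> is a ghost variable, from which the running time of the loop is read off.\<close>

lemma vc_While:
  fixes f :: "'g \<Rightarrow> nat"
  assumes "I g r m"
    and body: "\<And>g r m. I g r m \<Longrightarrow> r i \<noteq> 0 \<Longrightarrow>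
      vc L P (\<lambda>u (r', m'). u \<le> \<tau> \<and> (\<exists>g'. f g' < f g \<and> I g' r' m')) (r, m)"
  shows "vc L (While i P) (\<lambda>u (r', m'). u \<le> f g * (\<tau> + 1) + 1 \<and> r' i = 0 \<and> (\<exists>g'. I g' r' m')) (r, m)"
  using assms(1)
proof (induction "f g" arbitrary: g r m rule: less_induct)
  case less
  show ?case
  proof (cases "r i = 0")
    case True
    then show ?thesis using less.prems by (auto intro: wp_While_False)
  next
    case False
    let ?post = "\<lambda>k u (r', m'). u \<le> k * (\<tau> + 1) + 1 \<and> r' i = 0 \<and> (\<exists>g'. I g' r' m')"
    have "wp L (While i P) (\<lambda>u'. ?post (f g) (Suc (u + u'))) (r', m')"
      if body_time: "u \<le> \<tau>" and smaller: "f g' < f g" "I g' r' m'" for u g' r' m'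
    proof -
      have "Suc (f g') * (\<tau> + 1) \<le> f g * (\<tau> + 1)" using smaller(1) by (intro mult_le_mono1) simp
      then have "Suc (u + u') \<le> f g * (\<tau> + 1) + 1" if "u' \<le> f g' * (\<tau> + 1) + 1" for u'
        using body_time that by simp
      moreover have "wp L (While i P) (?post (f g')) (r', m')" using less.hyps[OF smaller] by simp
      ultimately show ?thesis by (elim wp_mono) auto
    qed
    then have "wp L P (\<lambda>u. wp L (While i P) (\<lambda>u'. ?post (f g) (Suc (u + u')))) (r, m)"
      by (intro wp_mono[OF vc_sound[OF body[OF less.prems False]]]) auto
    then show ?thesis using False by (simp add: wp_While_True)
  qed
qed

text \<open>Register \<open>Suc i\<close> is used for the test and the increment.\<close>

definition For :: "nat \<Rightarrow> nat \<Rightarrow> ram \<Rightarrow> ram" where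
  "For i l P = Seq (Sub (Suc i) l i)
     (While (Suc i) (seqs [P, Const (Suc i) 1, Add i i (Suc i), Sub (Suc i) l i]))"

lemma writes_For [simp]: "writes (For i l P) = {i, Suc i} \<union> writes P"
  by (auto simp: For_def)

lemma vc_For:
  assumes "I (r i) r m" "r i \<le> r l" "r l < 2 ^ L"
    and regs: "i \<notin> writes P" "l \<notin> {i, Suc i} \<union> writes P"
    and indep: "\<And>j r m x y. I j r m \<Longrightarrow> I j (r(i := x, Suc i := y)) m"
    and body: "\<And>j r' m'. r i \<le> j \<Longrightarrow> j < r l \<Longrightarrow> r' i = j \<Longrightarrow> I j r' m' \<Longrightarrow>
      unchanged ({i, Suc i} \<union> writes P) r r' \<Longrightarrow>
      vc L P (\<lambda>u (r'', m''). u \<le> \<tau> \<and> I (Suc j) r'' m'') (r', m')"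
  shows "vc L (For i l P) (\<lambda>u (r', m'). u \<le> (r l - r i) * (\<tau> + 5) + 2 \<and> I (r l) r' m') (r, m)"
proof -
  define J where "J j r' m' \<longleftrightarrow> r i \<le> j \<and> j \<le> r l \<and> r' i = j \<and> r' (Suc i) = r l - j \<and>
    unchanged ({i, Suc i} \<union> writes P) r r' \<and> I j r' m'" for j r' m'
  have step: "vc L (seqs [P, Const (Suc i) 1, Add i i (Suc i), Sub (Suc i) l i])
      (\<lambda>u (r'', m''). u \<le> \<tau> + 4 \<and> (\<exists>j'. r l - j' < r l - j \<and> J j' r'' m'')) (r', m')"
    if "J j r' m'" "r' (Suc i) \<noteq> 0" for j r' m'
  proof -
    have in_loop: "r i \<le> j" "j < r l" "r' i = j" "I j r' m'"
      and kept: "unchanged ({i, Suc i} \<union> writes P) r r'"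
      using that by (auto simp: J_def)
    have advance: "J (Suc j) (r''(i := Suc j, Suc i := r l - Suc j)) m''"
      if "I (Suc j) r'' m''" "unchanged (writes P) r' r''" for r'' m''
      using that in_loop kept indep by (auto simp: J_def unchanged_def)
    show ?thesis
    proof (rule vc_seqs[OF body[OF in_loop kept]])
      fix u r'' m''
      assume post: "u \<le> \<tau> \<and> I (Suc j) r'' m''" and keep: "unchanged (writes P) r' r''"
      have "r'' i = j" "r'' l = r l" using keep kept in_loop(3) regs by (auto simp: unchanged_def)
      moreover have "r''(Suc i := Suc 0, i := Suc j, Suc i := r l - Suc j)
          = r''(i := Suc j, Suc i := r l - Suc j)" by (simp add: fun_eq_iff)
      ultimately show "vc L (seqs [Const (Suc i) 1, Add i i (Suc i), Sub (Suc i) l i])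
          (\<lambda>u' (r'', m''). u + u' \<le> \<tau> + 4 \<and> (\<exists>j'. r l - j' < r l - j \<and> J j' r'' m'')) (r'', m'')"
        using post advance[of r'' m''] keep in_loop(2) assms(3) regs by (auto intro!: exI[of _ "Suc j"])
    qed
  qed
  have "J (r i) (r(Suc i := r l - r i)) m"
    using assms(1,2) indep[OF assms(1), of "r i"] by (simp add: J_def unchanged_def)
  from vc_While[where I=J and f="\<lambda>j. r l - j", OF this step]
  have "vc L (While (Suc i) (seqs [P, Const (Suc i) 1, Add i i (Suc i), Sub (Suc i) l i]))
    (\<lambda>u (r', m'). Suc u \<le> (r l - r i) * (\<tau> + 5) + 2 \<and> I (r l) r' m') (r(Suc i := r l - r i), m)"
    by (rule vc_mono) (auto simp: J_def algebra_simps)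
  then show ?thesis by (simp add: For_def)
qed

lemma vc_For_accumulate:
  assumes "r c = F (r i)" "r i \<le> r l" "r l < 2 ^ L"
    and "i \<notin> writes P" "l \<notin> {i, Suc i} \<union> writes P" "c \<notin> {i, Suc i}"
    and body: "\<And>j r'. r i \<le> j \<Longrightarrow> j < r l \<Longrightarrow> r' i = j \<Longrightarrow> r' c = F j \<Longrightarrow>
      unchanged ({i, Suc i} \<union> writes P) r r' \<Longrightarrow>
      vc L P (\<lambda>u (r'', m''). u \<le> \<tau> \<and> m'' = m \<and> r'' c = F (Suc j)) (r', m)"
  shows "vc L (For i l P) (\<lambda>u (r', m'). u \<le> (r l - r i) * (\<tau> + 5) + 2 \<and> m' = m \<and> r' c = F (r l)) (r, m)"
proof (rule vc_For[where I="\<lambda>j r' m'. m' = m \<and> r' c = F j"])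
  fix j r' m'
  assume "r i \<le> j" "j < r l" "r' i = j" "m' = m \<and> r' c = F j" "unchanged ({i, Suc i} \<union> writes P) r r'"
  then show "vc L P (\<lambda>u (r'', m''). u \<le> \<tau> \<and> m'' = m \<and> r'' c = F (Suc j)) (r', m')"
    using body by simp
qed (use assms(1-6) in auto)

lemma vc_For_count:
  assumes "r c = 0" "r i \<le> r l" "r l < 2 ^ L"
    and "i \<notin> writes P" "l \<notin> {i, Suc i} \<union> writes P" "c \<notin> {i, Suc i}"
    and body: "\<And>j r'. r i \<le> j \<Longrightarrow> j < r l \<Longrightarrow> r' i = j \<Longrightarrow> r' c < r l \<Longrightarrow>
      unchanged ({i, Suc i} \<union> writes P) r r' \<Longrightarrow>
      vc L P (\<lambda>u (r'', m''). u \<le> \<tau> \<and> m'' = m \<and> r'' c = r' c + of_bool (B j)) (r', m)"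
  shows "vc L (For i l P) (\<lambda>u (r', m'). u \<le> (r l - r i) * (\<tau> + 5) + 2 \<and> m' = m \<and>
    r' c = card {x \<in> {r i..<r l}. B x}) (r, m)"
proof (rule vc_For_accumulate[where F="\<lambda>j. card {x \<in> {r i..<j}. B x}"])
  fix j r'
  assume loop: "r i \<le> j" "j < r l" "r' i = j" "r' c = card {x \<in> {r i..<j}. B x}"
    "unchanged ({i, Suc i} \<union> writes P) r r'"
  have "card {x \<in> {r i..<j}. B x} \<le> card {r i..<j}" by (rule card_mono) auto
  then have "r' c < r l" using loop(1,2,4) by simp
  moreover have "{x \<in> {r i..<Suc j}. B x} = {x \<in> {r i..<j}. B x} \<union> (if B j then {j} else {})"
    using loop(1) by (auto simp: less_Suc_eq)
  then have "card {x \<in> {r i..<Suc j}. B x} = r' c + of_bool (B j)" by (simp add: loop(4))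
  ultimately show "vc L P (\<lambda>u (r'', m''). u \<le> \<tau> \<and> m'' = m \<and>
      r'' c = card {x \<in> {r i..<Suc j}. B x}) (r', m)"
    using body[OF loop(1-3) _ loop(5)] by simp
qed (use assms(1-6) in auto)

subsection \<open>Registers and derived instructions\<close>

text \<open>
  \<open>rows_reg\<close> and \<open>order_reg\<close> point to tables that hold, for each position of the degeneracy order, the
  address of the matrix row of the vertex at that position and the vertex itself. The queue of states
  extends from \<open>head_reg\<close> to \<open>tail_reg\<close> in blocks of \<open>block_reg\<close> cells; its length in cells is
  \<open>queue_reg\<close>. The sum over the leaves is the difference of \<open>plus_reg\<close> and \<open>minus_reg\<close>.
\<close>

abbreviation (input) "answer_reg \<equiv> 0 :: nat"
abbreviation (input) "n_reg \<equiv> 2 :: nat"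
abbreviation (input) "k_reg \<equiv> 3 :: nat"
abbreviation (input) "rows_reg \<equiv> 4 :: nat"
abbreviation (input) "order_reg \<equiv> 5 :: nat"
abbreviation (input) "degree_reg \<equiv> 6 :: nat"
abbreviation (input) "block_reg \<equiv> 7 :: nat"
abbreviation (input) "head_reg \<equiv> 8 :: nat"
abbreviation (input) "tail_reg \<equiv> 9 :: nat"
abbreviation (input) "plus_reg \<equiv> 10 :: nat"
abbreviation (input) "minus_reg \<equiv> 11 :: nat"
abbreviation (input) "vertex_reg \<equiv> 12 :: nat"
abbreviation (input) "picks_reg \<equiv> 13 :: nat"
abbreviation (input) "budget_reg \<equiv> 14 :: nat"
abbreviation (input) "child_vertex_reg \<equiv> 15 :: nat"
abbreviation (input) "child_picks_reg \<equiv> 16 :: nat"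
abbreviation (input) "child_budget_reg \<equiv> 17 :: nat"
abbreviation (input) "outer_reg \<equiv> 18 :: nat"
abbreviation (input) "middle_reg \<equiv> 20 :: nat"
abbreviation (input) "inner_reg \<equiv> 22 :: nat"
abbreviation (input) "tmp_reg \<equiv> 24 :: nat"
abbreviation (input) "addr_reg \<equiv> 25 :: nat"
abbreviation (input) "cell_reg \<equiv> 26 :: nat"
abbreviation (input) "edge_reg \<equiv> 27 :: nat"
abbreviation (input) "count_reg \<equiv> 28 :: nat"
abbreviation (input) "conflict_reg \<equiv> 29 :: nat"
abbreviation (input) "sign_reg \<equiv> 30 :: nat"
abbreviation (input) "product_reg \<equiv> 31 :: nat"
abbreviation (input) "power_reg \<equiv> 32 :: nat"
abbreviation (input) "min_reg \<equiv> 33 :: nat"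
abbreviation (input) "argmin_reg \<equiv> 34 :: nat"
abbreviation (input) "queue_reg \<equiv> 35 :: nat"

declare One_nat_def [simp del]

text \<open>Moving by subtraction of zero needs no bound on the sum.\<close>

definition Move :: "nat \<Rightarrow> nat \<Rightarrow> ram" where
  "Move i j = Seq (Const tmp_reg 0) (Sub i j tmp_reg)"

definition Add_Const :: "nat \<Rightarrow> nat \<Rightarrow> nat \<Rightarrow> ram" where
  "Add_Const i j c = Seq (Const tmp_reg c) (Add i j tmp_reg)"

definition Sub_Const :: "nat \<Rightarrow> nat \<Rightarrow> nat \<Rightarrow> ram" where
  "Sub_Const i j c = Seq (Const tmp_reg c) (Sub i j tmp_reg)"

definition Fetch :: "nat \<Rightarrow> nat \<Rightarrow> nat \<Rightarrow> ram" where
  "Fetch i b j = Seq (Add tmp_reg b j) (Load i tmp_reg)"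

definition Put :: "nat \<Rightarrow> nat \<Rightarrow> nat \<Rightarrow> ram" where
  "Put b j i = Seq (Add tmp_reg b j) (Store tmp_reg i)"

lemma writes_derived [simp]:
  "writes (Move i j) = {tmp_reg, i}" "writes (Add_Const i j c) = {tmp_reg, i}"
  "writes (Sub_Const i j c) = {tmp_reg, i}" "writes (Fetch i b j) = {tmp_reg, i}"
  "writes (Put b j i) = {tmp_reg}"
  by (auto simp: Move_def Add_Const_def Sub_Const_def Fetch_def Put_def)

lemma vc_derived [simp]:
  "j \<noteq> tmp_reg \<Longrightarrow> vc L (Move i j) Q (r, m) = Q 2 (r(tmp_reg := 0, i := r j), m)"
  "j \<noteq> tmp_reg \<Longrightarrow> vc L (Add_Const i j c) Q (r, m) =
    (r j + c < 2 ^ L \<and> Q 2 (r(tmp_reg := c, i := r j + c), m))"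
  "j \<noteq> tmp_reg \<Longrightarrow> vc L (Sub_Const i j c) Q (r, m) =
    (c < 2 ^ L \<and> Q 2 (r(tmp_reg := c, i := r j - c), m))"
  "vc L (Fetch i b j) Q (r, m) =
    (r b + r j < 2 ^ L \<and> Q 2 (r(tmp_reg := r b + r j, i := m (r b + r j)), m))"
  "i \<noteq> tmp_reg \<Longrightarrow> vc L (Put b j i) Q (r, m) =
    (r b + r j < 2 ^ L \<and> Q 2 (r(tmp_reg := r b + r j), m(r b + r j := r i)))"
  by (auto simp: Move_def Add_Const_def Sub_Const_def Fetch_def Put_def numeral_2_eq_2)

subsection \<open>The program\<close>

definition Multiply :: "nat \<Rightarrow> nat \<Rightarrow> nat \<Rightarrow> ram" where
  "Multiply i j l = seqs [Const i 0, Const inner_reg 0, For inner_reg l (Add i i j)]"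

definition Power :: ram where
  "Power = seqs [Const power_reg 1, Const outer_reg 0, For outer_reg picks_reg
     (seqs [Multiply product_reg power_reg count_reg, Move power_reg product_reg])]"

definition Edge :: "nat \<Rightarrow> nat \<Rightarrow> ram" where
  "Edge p q = seqs [Fetch addr_reg rows_reg p, Fetch cell_reg order_reg q,
     Add addr_reg addr_reg cell_reg, Load edge_reg addr_reg]"

definition Count_Adjacent :: "nat \<Rightarrow> nat \<Rightarrow> ram" where
  "Count_Adjacent q p = seqs [Const count_reg 0, Move inner_reg p,
     For inner_reg n_reg (seqs [Edge q inner_reg, Add count_reg count_reg edge_reg])]"

definition Set_Row :: ram where
  "Set_Row = seqs [Put rows_reg middle_reg addr_reg, Put order_reg middle_reg middle_reg,
     Const cell_reg 1, Put addr_reg middle_reg cell_reg, Add addr_reg addr_reg n_reg]"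

definition Build_Tables :: ram where
  "Build_Tables = seqs [Multiply rows_reg n_reg n_reg, Add_Const rows_reg rows_reg 2,
     Add order_reg rows_reg n_reg, Const addr_reg 2, Const middle_reg 0, For middle_reg n_reg Set_Row]"

definition Try_Min :: ram where
  "Try_Min = seqs [Count_Adjacent middle_reg outer_reg, Sub cell_reg min_reg count_reg,
     If cell_reg (seqs [Move min_reg count_reg, Move argmin_reg middle_reg]) Skip]"

definition Select_Min :: ram where
  "Select_Min = seqs [Add_Const min_reg n_reg 1, Move middle_reg outer_reg, For middle_reg n_reg Try_Min]"

definition Swap :: "nat \<Rightarrow> nat \<Rightarrow> nat \<Rightarrow> ram" where
  "Swap b i j = seqs [Fetch cell_reg b i, Fetch edge_reg b j, Put b i edge_reg, Put b j cell_reg]"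

definition Select :: ram where
  "Select = seqs [Select_Min, Swap rows_reg outer_reg argmin_reg, Swap order_reg outer_reg argmin_reg,
     Sub_Const min_reg min_reg 1, Sub cell_reg min_reg degree_reg, Add degree_reg degree_reg cell_reg]"

definition Find_Order :: ram where
  "Find_Order = seqs [Const degree_reg 0, Const outer_reg 0, For outer_reg n_reg Select]"

definition Copy_State :: ram where
  "Copy_State = seqs [Const middle_reg 0,
     For middle_reg n_reg (seqs [Fetch cell_reg head_reg middle_reg, Put tail_reg middle_reg cell_reg]),
     Add addr_reg tail_reg n_reg, Store addr_reg child_vertex_reg,
     Add_Const addr_reg addr_reg 1, Store addr_reg child_picks_reg,
     Add_Const addr_reg addr_reg 1, Store addr_reg child_budget_reg]"

definition Push_With :: "ram \<Rightarrow> ram" where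
  "Push_With P = seqs [Copy_State, P, Add tail_reg tail_reg block_reg]"

definition Push :: ram where
  "Push = Push_With Skip"

definition Push_Marked :: ram where
  "Push_Marked = Push_With (seqs [Const cell_reg 2, Put tail_reg vertex_reg cell_reg])"

definition Dominate :: ram where
  "Dominate = seqs [Move inner_reg child_vertex_reg,
     For inner_reg n_reg (seqs [Edge outer_reg inner_reg, If edge_reg (Put tail_reg inner_reg edge_reg) Skip])]"

definition Push_Pick :: ram where
  "Push_Pick = Push_With Dominate"

definition Count_Conflicts :: ram where
  "Count_Conflicts = seqs [Const conflict_reg 0, Const middle_reg 0, For middle_reg n_reg
     (seqs [Fetch cell_reg head_reg middle_reg, Sub_Const cell_reg cell_reg 1,
        If cell_reg (seqs [Edge outer_reg middle_reg, Add conflict_reg conflict_reg edge_reg]) Skip])]"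

definition Count_Avoiders :: ram where
  "Count_Avoiders = seqs [Const count_reg 0, Const outer_reg 0, For outer_reg n_reg
     (seqs [Count_Conflicts, If conflict_reg Skip (Add_Const count_reg count_reg 1)])]"

definition Sign :: ram where
  "Sign = seqs [Const sign_reg 0, Const middle_reg 0, For middle_reg n_reg
     (seqs [Fetch cell_reg head_reg middle_reg, Sub_Const cell_reg cell_reg 1,
        If cell_reg (seqs [Const cell_reg 1, Sub sign_reg cell_reg sign_reg]) Skip])]"

definition Leaf :: ram where
  "Leaf = seqs [Count_Avoiders, Sign, Power,
     If sign_reg (Add minus_reg minus_reg power_reg) (Add plus_reg plus_reg power_reg)]"

definition Push_Marks :: ram where
  "Push_Marks = If budget_reg (seqs [Move child_picks_reg picks_reg, Sub_Const child_budget_reg budget_reg 1,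
     Push, Push_Marked]) Skip"

definition Find_First_Candidate :: ram where
  "Find_First_Candidate = seqs [Count_Adjacent vertex_reg child_vertex_reg, Move outer_reg vertex_reg,
     If count_reg (seqs [Sub_Const cell_reg count_reg 1,
       If cell_reg Skip (Move outer_reg child_vertex_reg)]) Skip]"

definition Try_Pick :: ram where
  "Try_Pick = seqs [Edge vertex_reg outer_reg, If edge_reg Push_Pick Skip]"

definition Push_Picks :: ram where
  "Push_Picks = seqs [Sub_Const child_picks_reg picks_reg 1, Sub child_budget_reg budget_reg degree_reg,
     Find_First_Candidate, For outer_reg n_reg Try_Pick]"

definition Maybe_Push_Picks :: ram where
  "Maybe_Push_Picks = If picks_reg
     (seqs [Sub cell_reg degree_reg budget_reg, If cell_reg Skip Push_Picks]) Skip"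

definition Expand :: ram where
  "Expand = seqs [Add_Const child_vertex_reg vertex_reg 1, Fetch cell_reg head_reg vertex_reg,
     If cell_reg (seqs [Move child_picks_reg picks_reg, Move child_budget_reg budget_reg, Push])
       (seqs [Push_Marks, Maybe_Push_Picks])]"

definition Load_State :: ram where
  "Load_State = seqs [Fetch vertex_reg head_reg n_reg, Add addr_reg head_reg n_reg,
     Add_Const addr_reg addr_reg 1, Load picks_reg addr_reg,
     Add_Const addr_reg addr_reg 1, Load budget_reg addr_reg]"

definition Visit :: ram where
  "Visit = seqs [Sub cell_reg n_reg vertex_reg, If cell_reg Expand Leaf]"

definition Step :: ram where
  "Step = seqs [Load_State, Visit, Add head_reg head_reg block_reg, Sub queue_reg tail_reg head_reg]"

definition Init_Queue :: ram where
  "Init_Queue = seqs [Multiply cell_reg degree_reg k_reg, Add_Const block_reg n_reg 3,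
     Add head_reg order_reg n_reg, Add addr_reg head_reg n_reg,
     Add_Const addr_reg addr_reg 1, Store addr_reg k_reg,
     Add_Const addr_reg addr_reg 1, Store addr_reg cell_reg,
     Add tail_reg head_reg block_reg, Move queue_reg block_reg, Const plus_reg 0, Const minus_reg 0]"

definition Solve :: ram where
  "Solve = seqs [Build_Tables, Find_Order, Init_Queue, While queue_reg Step, Sub answer_reg plus_reg minus_reg]"

definition Decide_Dominating_Set :: ram where
  "Decide_Dominating_Set = seqs [Const cell_reg 0, Load k_reg cell_reg, Const cell_reg 1, Load n_reg cell_reg,
     Sub cell_reg n_reg k_reg, If cell_reg Solve (Const answer_reg 1)]"

lemmas program_defs =
  Multiply_def Power_def Edge_def Count_Adjacent_def Set_Row_def Build_Tables_def Try_Min_def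
  Select_Min_def Swap_def Select_def Find_Order_def Copy_State_def Push_With_def Push_def
  Push_Marked_def Dominate_def Push_Pick_def Count_Conflicts_def Count_Avoiders_def Sign_def Leaf_def
  Push_Marks_def Find_First_Candidate_def Try_Pick_def Push_Picks_def Maybe_Push_Picks_def Expand_def
  Load_State_def Visit_def Step_def Solve_def

lemmas writes_programs [simp] = program_defs[THEN arg_cong[where f=writes]]

lemma vc_Multiply:
  assumes "r j * r l < 2 ^ L" "r l < 2 ^ L"
    and "i \<notin> {inner_reg, Suc inner_reg, j, l}" "j \<notin> {inner_reg, Suc inner_reg}" "l \<notin> {inner_reg, Suc inner_reg}"
  shows "vc L (Multiply i j l) (\<lambda>u (r', m'). u \<le> 10 * (r l + 1) \<and> m' = m \<and> r' i = r j * r l) (r, m)"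
  unfolding Multiply_def
proof (simp, rule vc_consequence[OF vc_For_accumulate[where c=i and F="\<lambda>x. r j * x" and \<tau>=1]])
  fix x r'
  assume in_loop: "x < (r(i := 0, inner_reg := 0)) l" and "r' i = r j * x"
    "unchanged ({inner_reg, Suc inner_reg} \<union> writes (Add i i j)) (r(i := 0, inner_reg := 0)) r'"
  moreover have "r j * Suc x \<le> r j * r l"
    using in_loop assms(3,5) by (intro mult_le_mono2) (simp split: if_splits)
  ultimately show "vc L (Add i i j) (\<lambda>u (r'', m'). u \<le> 1 \<and> m' = m \<and> r'' i = r j * Suc x) (r', m)"
    using assms by (auto simp: unchanged_def)
qed (use assms in auto)

subsection \<open>The graph in memory\<close>

locale memory_layout =
  fixes n :: nat and a :: "nat \<Rightarrow> nat \<Rightarrow> bool" and L rows order heap :: nat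
  assumes rows_le: "rows + n \<le> heap" and order_le: "order + n \<le> heap"
    and le_heap: "n + 3 \<le> heap" and heap_less: "heap < 2 ^ L"
begin

lemma const_less [simp]: "1 < (2::nat) ^ L" "(2::nat) < 2 ^ L" "(3::nat) < 2 ^ L" "n < 2 ^ L" "n + 1 < 2 ^ L"
  using heap_less le_heap by auto

definition adjacency :: "(nat \<Rightarrow> nat) \<Rightarrow> bool" where
  "adjacency m \<longleftrightarrow> (\<forall>p<n. \<forall>q<n. m (rows + p) + m (order + q) < heap \<and>
     m (m (rows + p) + m (order + q)) = of_bool (a p q))"

definition holds_graph :: "(nat \<Rightarrow> nat) \<Rightarrow> (nat \<Rightarrow> nat) \<Rightarrow> bool" where
  "holds_graph r m \<longleftrightarrow> r n_reg = n \<and> r rows_reg = rows \<and> r order_reg = order \<and> adjacency m"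

lemma adjacency_cong:
  assumes "adjacency m" "\<And>x. x < heap \<Longrightarrow> m' x = m x"
  shows "adjacency m'"
proof -
  have "m' (rows + p) = m (rows + p)" "m' (order + p) = m (order + p)" if "p < n" for p
    using that assms(2) rows_le order_le by auto
  then show ?thesis using assms unfolding adjacency_def by simp
qed

lemma holds_graph_upd [simp]:
  "i \<notin> {n_reg, rows_reg, order_reg} \<Longrightarrow> holds_graph (r(i := x)) m \<longleftrightarrow> holds_graph r m"
  by (auto simp: holds_graph_def)

lemma holds_graph_cong:
  assumes "holds_graph r m" "unchanged X r r'" "X \<inter> {n_reg, rows_reg, order_reg} = {}"
    and "\<And>x. x < heap \<Longrightarrow> m' x = m x"
  shows "holds_graph r' m'"
  using assms(1-3) adjacency_cong[OF _ assms(4)] by (auto simp: holds_graph_def unchanged_def)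

lemma vc_Edge [simp]:
  assumes "holds_graph r m" "r p < n" "r q < n" "q \<notin> {tmp_reg, addr_reg}"
  shows "vc L (Edge p q) Q (r, m) =
    Q 7 (r(tmp_reg := order + r q, addr_reg := m (rows + r p) + m (order + r q),
      cell_reg := m (order + r q), edge_reg := of_bool (a (r p) (r q))), m)"
proof -
  have "rows + r p < 2 ^ L" "order + r q < 2 ^ L" "m (rows + r p) + m (order + r q) < 2 ^ L"
    "m (m (rows + r p) + m (order + r q)) = of_bool (a (r p) (r q))"
    using assms rows_le order_le heap_less unfolding holds_graph_def adjacency_def
    by (auto intro: order.strict_trans)
  then show ?thesis
    using assms by (simp add: Edge_def holds_graph_def fun_upd_twist numeral_eq_Suc)
qed

lemma vc_Count_Adjacent:
  assumes graph: "holds_graph r m" and "r q < n" "r p \<le> n"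
    and regs: "q < inner_reg" "p < inner_reg"
  shows "vc L (Count_Adjacent q p) (\<lambda>u (r', m'). u \<le> 20 * (n + 1) \<and> m' = m \<and>
    r' count_reg = degree_from a n (r p) (r q)) (r, m)"
  unfolding Count_Adjacent_def
proof (use regs in simp, rule vc_consequence[OF vc_For_count[where c=count_reg and B="a (r q)" and \<tau>=9]])
  let ?r = "r(count_reg := 0, tmp_reg := 0, inner_reg := r p)"
  fix j r'
  assume in_loop: "j < ?r n_reg" "r' inner_reg = j" "r' count_reg < ?r n_reg"
    and same: "unchanged ({inner_reg, Suc inner_reg} \<union>
      writes (seqs [Edge q inner_reg, Add count_reg count_reg edge_reg])) ?r r'"
  have "holds_graph r' m" using graph same by (simp add: holds_graph_def unchanged_def)
  moreover have "r n_reg = n" using graph by (simp add: holds_graph_def)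
  moreover have "r' q = r q" using same regs by (simp add: unchanged_def)
  ultimately show "vc L (seqs [Edge q inner_reg, Add count_reg count_reg edge_reg])
      (\<lambda>u (r'', m'). u \<le> 9 \<and> m' = m \<and> r'' count_reg = r' count_reg + of_bool (a (r q) j)) (r', m)"
    using in_loop assms(2) const_less(4) by (simp del: const_less(4))
qed (use assms in \<open>auto simp: holds_graph_def degree_from_def\<close>)

end

subsection \<open>States in memory\<close>

locale machine = ordered_graph n d a + memory_layout n a L rows order heap
  for n d a L rows order heap
begin

text \<open>
  The cell of a vertex at or after \<open>v\<close> records domination by 0 or 1; the cell of a vertex before \<open>v\<close> is 2
  exactly if the vertex is in \<open>A\<close>, whereas 0 and 1 carry no information there.
\<close>

fun stored :: "(nat \<Rightarrow> nat) \<Rightarrow> nat \<Rightarrow> state \<Rightarrow> bool" where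
  "stored m h (v, k, b, D, A) \<longleftrightarrow> v \<le> n \<and> A \<subseteq> {..<v} \<and>
    (\<forall>x<v. m (h + x) \<le> 2 \<and> (m (h + x) = 2 \<longleftrightarrow> x \<in> A)) \<and>
    (\<forall>x\<in>{v..<n}. m (h + x) = of_bool (x \<in> D)) \<and>
    m (h + n) = v \<and> m (h + n + 1) = k \<and> m (h + n + 2) = b"

lemma stored_cong:
  assumes "stored m h s" "\<And>x. h \<le> x \<Longrightarrow> x < h + (n + 3) \<Longrightarrow> m' x = m x"
  shows "stored m' h s"
proof -
  have same: "m' (h + x) = m (h + x)" if "x < n + 3" for x using that assms(2) by simp
  have header: "m' (h + n + 1) = m (h + n + 1)" "m' (h + n + 2) = m (h + n + 2)"
    using same[of "n + 1"] same[of "n + 2"] by (simp_all add: add.assoc)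
  obtain v k b D A where s_eq: "s = (v, k, b, D, A)" by (cases s)
  then have "v \<le> n" using assms(1) by simp
  then have "m' (h + x) = m (h + x)" if "x < n \<or> x < v" for x using same that by auto
  then show ?thesis using assms(1) same[of n] header unfolding s_eq by simp
qed

lemma stored_shift:
  assumes "stored m h (v, k, b, D, A)" "v < n" "\<And>x. x < n \<Longrightarrow> m' (t + x) = m (h + x)"
    and "m' (t + n) = Suc v" "m' (t + n + 1) = k'" "m' (t + n + 2) = b'"
  shows "stored m' t (Suc v, k', b', D, A)"
proof -
  have "\<forall>x<v. m' (t + x) \<le> 2 \<and> (m' (t + x) = 2 \<longleftrightarrow> x \<in> A)"
    and "\<forall>x\<in>{v..<n}. m' (t + x) = of_bool (x \<in> D)" and "A \<subseteq> {..<v}"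
    using assms(1-3) by simp_all
  then show ?thesis using assms(2,4-6) by (auto simp: less_Suc_eq)
qed

lemma stored_mark:
  assumes "stored m h (Suc v, k, b, D, A)"
  shows "stored (m(h + v := 2)) h (Suc v, k, b, D, insert v A)"
  using assms by auto

lemma stored_dominate:
  assumes "stored m h (v, k, b, D, A)" "v \<le> x" "x < n"
  shows "stored (m(h + x := 1)) h (v, k, b, insert x D, A)"
  using assms by auto

lemma stored_dominated_cong:
  assumes "stored m h (v, k, b, D, A)" "\<And>x. v \<le> x \<Longrightarrow> x < n \<Longrightarrow> x \<in> D \<longleftrightarrow> x \<in> D'"
  shows "stored m h (v, k, b, D', A)"
  using assms by simp

lemma stored_entries:
  assumes "stored m h (v, k, b, D, A)"
  shows "v \<le> n" "m (h + n) = v" "m (h + n + 1) = k" "m (h + n + 2) = b"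
    "v < n \<Longrightarrow> m (h + v) = of_bool (v \<in> D)"
  using assms by simp_all

declare stored.simps [simp del]

lemma vc_Copy_State:
  assumes regs: "r n_reg = n" "r child_vertex_reg = Suc v"
    and room: "r head_reg + (n + 3) \<le> r tail_reg" "r tail_reg + (n + 3) < 2 ^ L"
    and state: "stored m (r head_reg) (v, k, b, D, A)" "v < n"
  shows "vc L Copy_State (\<lambda>u (r', m'). u \<le> 20 * (n + 1) \<and> (\<forall>x<r tail_reg. m' x = m x) \<and>
    stored m' (r tail_reg) (Suc v, r child_picks_reg, r child_budget_reg, D, A)) (r, m)"
proof -
  let ?copy = "seqs [Fetch cell_reg head_reg middle_reg, Put tail_reg middle_reg cell_reg]"
  let ?t = "r tail_reg + n"
  have header: "stored (m'(?t := Suc v, ?t + 1 := k', ?t + 1 + 1 := b')) (r tail_reg) (Suc v, k', b', D, A)"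
    if "\<forall>x<n. m' (r tail_reg + x) = m (r head_reg + x)" for m' k' b'
    by (rule stored_shift[OF state]) (use that in auto)
  show ?thesis
    unfolding Copy_State_def
  proof (simp, rule vc_consequence[OF vc_For[where \<tau>=5 and I="\<lambda>j r' m'.
        (\<forall>x<r tail_reg. m' x = m x) \<and> (\<forall>x<j. m' (r tail_reg + x) = m (r head_reg + x))"]])
    fix j r' m'
    assume "j < (r(middle_reg := 0)) n_reg" "r' middle_reg = j"
      "(\<forall>x<r tail_reg. m' x = m x) \<and> (\<forall>x<j. m' (r tail_reg + x) = m (r head_reg + x))"
      "unchanged ({middle_reg, Suc middle_reg} \<union> writes ?copy) (r(middle_reg := 0)) r'"
    then show "vc L ?copy (\<lambda>u (r'', m''). u \<le> 5 \<and> (\<forall>x<r tail_reg. m'' x = m x) \<and>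
        (\<forall>x<Suc j. m'' (r tail_reg + x) = m (r head_reg + x))) (r', m')"
      using regs(1) room by (simp add: unchanged_def less_Suc_eq)
  qed (use regs room in \<open>simp_all add: unchanged_def header\<close>)
qed

definition queue :: "(nat \<Rightarrow> nat) \<Rightarrow> (nat \<Rightarrow> nat) \<Rightarrow> state list \<Rightarrow> bool" where
  "queue r m qs \<longleftrightarrow> holds_graph r m \<and> r degree_reg = d \<and> r block_reg = n + 3 \<and>
     heap \<le> r head_reg \<and> r tail_reg = r head_reg + length qs * (n + 3) \<and>
     (\<forall>i<length qs. stored m (r head_reg + i * (n + 3)) (qs ! i))"

lemma queue_unchanged:
  assumes "queue r m qs" "unchanged X r r'"
    and "X \<inter> {n_reg, rows_reg, order_reg, degree_reg, block_reg, head_reg, tail_reg} = {}"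
  shows "queue r' m qs"
  using assms by (auto simp: queue_def holds_graph_def unchanged_def)

lemma queue_upd [simp]:
  "i \<notin> {n_reg, rows_reg, order_reg, degree_reg, block_reg, head_reg, tail_reg} \<Longrightarrow>
    queue (r(i := x)) m qs \<longleftrightarrow> queue r m qs"
  by (auto simp: queue_def)

lemma queue_ConsD:
  assumes "queue r m (q # qs)"
  shows "holds_graph r m" "r n_reg = n" "r degree_reg = d" "r block_reg = n + 3" "heap \<le> r head_reg"
    "r head_reg + (n + 3) \<le> r tail_reg" "stored m (r head_reg) q"
    "r tail_reg = r head_reg + (length qs + 1) * (n + 3)"
  using assms by (auto simp: queue_def holds_graph_def algebra_simps)

definition fits :: "(nat \<Rightarrow> nat) \<Rightarrow> nat \<Rightarrow> bool" where
  "fits r l \<longleftrightarrow> r head_reg + l * (n + 3) < 2 ^ L"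

lemma fits_le:
  assumes "fits r l" "l' \<le> l" "r' head_reg = r head_reg"
  shows "fits r' l'"
proof -
  have "l' * (n + 3) \<le> l * (n + 3)" using assms(2) by (rule mult_le_mono1)
  then show ?thesis using assms(1,3) unfolding fits_def by linarith
qed

lemma queue_fits: "queue r m (q # qs) \<Longrightarrow> fits r (length qs + 2) \<Longrightarrow> r tail_reg + (n + 3) < 2 ^ L"
  by (simp add: queue_def fits_def algebra_simps)

lemma queue_append:
  assumes queue: "queue r m qs" and same: "unchanged X r r'"
    and regs: "X \<inter> {n_reg, rows_reg, order_reg, degree_reg, block_reg, head_reg} = {}"
    and tail: "r' tail_reg = r tail_reg + (n + 3)"
    and memory: "\<And>x. x < r tail_reg \<Longrightarrow> m' x = m x" "stored m' (r tail_reg) c"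
  shows "queue r' m' (qs @ [c])"
proof -
  have registers: "holds_graph r m" "r degree_reg = d" "r block_reg = n + 3" "heap \<le> r head_reg"
    "r tail_reg = r head_reg + length qs * (n + 3)"
    using queue by (simp_all add: queue_def)
  have old_states: "stored m' (r head_reg + i * (n + 3)) (qs ! i)" if "i < length qs" for i
  proof (rule stored_cong)
    show "stored m (r head_reg + i * (n + 3)) (qs ! i)" using queue that by (simp add: queue_def)
    fix x assume "x < r head_reg + i * (n + 3) + (n + 3)"
    moreover have "Suc i * (n + 3) \<le> length qs * (n + 3)" using that by (intro mult_le_mono1) simp
    ultimately have "x < r tail_reg" using registers(5) by simp
    then show "m' x = m x" by (rule memory(1))
  qed
  have "stored m' (r head_reg + i * (n + 3)) ((qs @ [c]) ! i)" if "i < length (qs @ [c])" for i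
    using that old_states[of i] memory(2) registers(5) by (cases "i = length qs") (simp_all add: nth_append)
  moreover have "holds_graph r' m'"
    by (rule holds_graph_cong[OF registers(1) same _ memory(1)]) (use regs registers(4,5) in auto)
  moreover have "r' degree_reg = d" "r' block_reg = n + 3" "r' head_reg = r head_reg"
    using registers(2,3) same regs by (auto simp: unchanged_def)
  ultimately show ?thesis using registers(4,5) tail by (simp add: queue_def)
qed

lemma vc_Push_With:
  assumes queue: "queue r m (q # qs)" and components: "q = (v, k, b, D, A)" "v < n"
    and regs: "r child_vertex_reg = Suc v" and fits: "fits r (length qs + 2)"
    and program: "writes P \<inter> {n_reg, rows_reg, order_reg, degree_reg, block_reg, head_reg, tail_reg} = {}"
      "\<And>r' m'. unchanged (writes Copy_State) r r' \<Longrightarrow> holds_graph r' m' \<Longrightarrow>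
        stored m' (r tail_reg) (Suc v, r child_picks_reg, r child_budget_reg, D, A) \<Longrightarrow>
        vc L P (\<lambda>u (r'', m''). u \<le> \<tau> \<and> (\<forall>x<r tail_reg. m'' x = m' x) \<and> stored m'' (r tail_reg) c) (r', m')"
  shows "vc L (Push_With P) (\<lambda>u (r', m'). u \<le> 20 * (n + 1) + \<tau> + 2 \<and> queue r' m' (q # qs @ [c])) (r, m)"
    (is "vc L _ ?post (r, m)")
proof -
  have room: "r tail_reg + (n + 3) < 2 ^ L" using queue fits by (rule queue_fits)
  show ?thesis
    unfolding Push_With_def
  proof (rule vc_seqs[OF vc_Copy_State])
    show "stored m (r head_reg) (v, k, b, D, A)" using queue_ConsD(7)[OF queue] components by simp
  next
    fix u r1 m1
    assume copy: "u \<le> 20 * (n + 1) \<and> (\<forall>x<r tail_reg. m1 x = m x) \<and>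
        stored m1 (r tail_reg) (Suc v, r child_picks_reg, r child_budget_reg, D, A)"
      and same: "unchanged (writes Copy_State) r r1"
    have graph: "holds_graph r1 m1"
      using queue_ConsD(1,5,6)[OF queue] same copy by (elim holds_graph_cong) auto
    show "vc L (seqs [P, Add tail_reg tail_reg block_reg]) (\<lambda>u'. ?post (u + u')) (r1, m1)"
    proof (rule vc_seqs[OF program(2)[OF same graph]])
      fix u' r2 m2
      assume P_post: "u' \<le> \<tau> \<and> (\<forall>x<r tail_reg. m2 x = m1 x) \<and> stored m2 (r tail_reg) c"
        and "unchanged (writes P) r1 r2"
      with same have kept: "unchanged (writes Copy_State \<union> writes P) r r2" by (simp add: unchanged_def)
      then have registers: "r2 tail_reg = r tail_reg" "r2 block_reg = n + 3"
        using program(1) queue_ConsD(4)[OF queue] by (auto simp: unchanged_def)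
      have "queue (r2(tail_reg := r tail_reg + (n + 3))) m2 ((q # qs) @ [c])"
      proof (rule queue_append[OF queue])
        show "unchanged (insert tail_reg (writes Copy_State \<union> writes P)) r
            (r2(tail_reg := r tail_reg + (n + 3)))"
          using kept by (simp add: unchanged_def)
      qed (use program P_post copy in auto)
      then show "vc L (seqs [Add tail_reg tail_reg block_reg]) (\<lambda>u''. ?post (u + (u' + u''))) (r2, m2)"
        using registers room copy P_post by simp
    qed (use copy in simp)
  qed (use queue_ConsD(2,6)[OF queue] components regs room in auto)
qed

lemma vc_Push:
  assumes "queue r m (q # qs)" "q = (v, k, b, D, A)" "v < n" "r child_vertex_reg = Suc v"
    and "fits r (length qs + 2)"
  shows "vc L Push (\<lambda>u (r', m'). u \<le> 30 * (n + 1) \<and>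
    queue r' m' (q # qs @ [(Suc v, r child_picks_reg, r child_budget_reg, D, A)])) (r, m)"
  unfolding Push_def
  by (rule vc_mono[OF vc_Push_With[OF assms, where \<tau>=1]]) auto

lemma vc_Push_Marked:
  assumes queue: "queue r m (q # qs)" and "q = (v, k, b, D, A)" "v < n" "r child_vertex_reg = Suc v"
    and fits: "fits r (length qs + 2)" and vertex: "r vertex_reg = v"
  shows "vc L Push_Marked (\<lambda>u (r', m'). u \<le> 30 * (n + 1) \<and>
    queue r' m' (q # qs @ [(Suc v, r child_picks_reg, r child_budget_reg, D, insert v A)])) (r, m)"
  unfolding Push_Marked_def
proof (rule vc_mono[OF vc_Push_With[OF assms(1-5), where \<tau>=4]])
  fix r' m'
  assume "unchanged (writes Copy_State) r r'"
    "stored m' (r tail_reg) (Suc v, r child_picks_reg, r child_budget_reg, D, A)"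
  then show "vc L (seqs [Const cell_reg 2, Put tail_reg vertex_reg cell_reg]) (\<lambda>u (r'', m''). u \<le> 4 \<and>
      (\<forall>x<r tail_reg. m'' x = m' x) \<and>
      stored m'' (r tail_reg) (Suc v, r child_picks_reg, r child_budget_reg, D, insert v A)) (r', m')"
    using stored_mark queue_fits[OF queue fits] vertex \<open>v < n\<close> by (simp add: unchanged_def)
qed auto

definition dominated_upto :: "nat \<Rightarrow> nat \<Rightarrow> nat \<Rightarrow> nat set" where
  "dominated_upto v w j = {x \<in> {v..<j}. a w x}"

lemma stored_dominated_upto_Suc:
  assumes "stored m h (v, k, b, D \<union> dominated_upto v w j, A)" "v \<le> j" "j < n"
  shows "stored (if a w j then m(h + j := 1) else m) h (v, k, b, D \<union> dominated_upto v w (Suc j), A)"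
proof (cases "a w j")
  case True
  then have "D \<union> dominated_upto v w (Suc j) = insert j (D \<union> dominated_upto v w j)"
    using assms(2) by (auto simp: dominated_upto_def less_Suc_eq)
  then show ?thesis using True stored_dominate[OF assms] by simp
next
  case False
  then have "dominated_upto v w (Suc j) = dominated_upto v w j"
    by (auto simp: dominated_upto_def less_Suc_eq)
  then show ?thesis using False assms(1) by simp
qed

lemma vc_Dominate:
  assumes graph: "holds_graph r m" and regs: "r outer_reg = w" "w < n" "r child_vertex_reg = v"
    and room: "heap \<le> r tail_reg" "r tail_reg + n < 2 ^ L"
    and state: "stored m (r tail_reg) (v, k, b, D, A)"
  shows "vc L Dominate (\<lambda>u (r', m'). u \<le> 20 * (n + 1) \<and> (\<forall>x<r tail_reg. m' x = m x) \<and>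
    stored m' (r tail_reg) (v, k, b, D \<union> {x. a w x}, A)) (r, m)"
proof -
  let ?body = "seqs [Edge outer_reg inner_reg, If edge_reg (Put tail_reg inner_reg edge_reg) Skip]"
  let ?r = "r(tmp_reg := 0, inner_reg := v)"
  let ?I = "\<lambda>j m'. (\<forall>x<r tail_reg. m' x = m x) \<and>
    stored m' (r tail_reg) (v, k, b, D \<union> dominated_upto v w j, A)"
  have "v \<le> n" using state by (rule stored_entries)
  have final: "stored m' (r tail_reg) (v, k, b, D \<union> {x. a w x}, A)"
    if "stored m' (r tail_reg) (v, k, b, D \<union> dominated_upto v w n, A)" for m'
    using that by (rule stored_dominated_cong) (auto simp: dominated_upto_def)
  show ?thesis
    unfolding Dominate_def
  proof (use regs in simp, rule vc_consequence[OF vc_For[where \<tau>=12 and I="\<lambda>j _. ?I j"]])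
    show "?I (?r inner_reg) m" using state by (simp add: dominated_upto_def)
  next
    fix j r' m'
    assume in_loop: "?r inner_reg \<le> j" "j < ?r n_reg" "r' inner_reg = j" and stored: "?I j m'"
      and same: "unchanged ({inner_reg, Suc inner_reg} \<union> writes ?body) ?r r'"
    have "unchanged ({inner_reg, Suc inner_reg} \<union> writes ?body) r r'"
      using same by (simp add: unchanged_def)
    then have "holds_graph r' m'"
      using graph stored room(1) by (elim holds_graph_cong) auto
    moreover have "r' outer_reg = w" "r' tail_reg = r tail_reg" "v \<le> j" "j < n"
      using same regs in_loop graph by (simp_all add: unchanged_def holds_graph_def)
    ultimately show "vc L ?body (\<lambda>u (r'', m''). u \<le> 12 \<and> ?I (Suc j) m'') (r', m')"
      using in_loop(3) stored regs room stored_dominated_upto_Suc[of m' "r tail_reg" v k b D w j A]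
      by (cases "a w j") simp_all
  qed (use graph \<open>v \<le> n\<close> final in \<open>auto simp: holds_graph_def\<close>)
qed

lemma vc_Push_Pick:
  assumes queue: "queue r m (q # qs)" and "q = (v, k, b, D, A)" "v < n" "r child_vertex_reg = Suc v"
    and fits: "fits r (length qs + 2)" and outer: "r outer_reg = w" "w < n"
  shows "vc L Push_Pick (\<lambda>u (r', m'). u \<le> 50 * (n + 1) \<and>
    queue r' m' (q # qs @ [(Suc v, r child_picks_reg, r child_budget_reg, D \<union> {x. a w x}, A)])) (r, m)"
  unfolding Push_Pick_def
proof (rule vc_mono[OF vc_Push_With[OF assms(1-5), where \<tau>="20 * (n + 1)"]])
  fix r' m'
  assume same: "unchanged (writes Copy_State) r r'" and "holds_graph r' m'"
    and "stored m' (r tail_reg) (Suc v, r child_picks_reg, r child_budget_reg, D, A)"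
  moreover have "r' tail_reg = r tail_reg" "r' outer_reg = w" "r' child_vertex_reg = Suc v"
    using same outer assms(4) by (simp_all add: unchanged_def)
  ultimately show "vc L Dominate (\<lambda>u (r'', m''). u \<le> 20 * (n + 1) \<and> (\<forall>x<r tail_reg. m'' x = m' x) \<and>
      stored m'' (r tail_reg) (Suc v, r child_picks_reg, r child_budget_reg, D \<union> {x. a w x}, A)) (r', m')"
    using vc_Dominate[of r' m' w "Suc v"] outer(2) queue_fits[OF queue fits] queue_ConsD(5,6)[OF queue] by simp
qed auto

end

subsection \<open>Evaluating a leaf\<close>

lemma vc_Power:
  assumes base: "r count_reg = c" and exponent: "r picks_reg = k" "k < 2 ^ L"
    and room: "(c + 1) ^ (k + 1) < 2 ^ L"
  shows "vc L Power (\<lambda>u (r', m'). u \<le> k * (10 * (c + 1) + 10) + 5 \<and> m' = m \<and> r' power_reg = c ^ k) (r, m)"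
proof -
  let ?body = "seqs [Multiply product_reg power_reg count_reg, Move power_reg product_reg]"
  let ?r = "r(power_reg := 1, outer_reg := 0)"
  have small: "(c + 1) ^ Suc j < 2 ^ L" if "j \<le> k" for j
  proof -
    have "(c + 1) ^ Suc j \<le> (c + 1) ^ (k + 1)" using that by (intro power_increasing) auto
    then show ?thesis using room by (rule order.strict_trans1)
  qed
  have "c < 2 ^ L" "1 < (2::nat) ^ L" using small[of 0] by (auto simp: gr0_conv_Suc)
  have step: "vc L ?body (\<lambda>u (r'', m'). u \<le> 10 * (c + 1) + 3 \<and> m' = m \<and> r'' power_reg = c ^ Suc j) (r', m)"
    if "j < k" "r' power_reg = c ^ j" "r' count_reg = c" for j r'
  proof (rule vc_seqs[OF vc_Multiply])
    have "c ^ j * c \<le> (c + 1) ^ Suc j" by (simp add: power_mono mult.commute[of _ c] add_increasing2 mult_mono)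
    then show "r' power_reg * r' count_reg < 2 ^ L" using small[of j] that by simp
  qed (use that \<open>c < 2 ^ L\<close> in auto)
  show ?thesis
    unfolding Power_def
  proof (use \<open>1 < (2::nat) ^ L\<close> in simp, rule vc_consequence[OF vc_For_accumulate[where c=power_reg and
        F="\<lambda>j. c ^ j" and \<tau>="10 * (c + 1) + 3"]])
    fix j r'
    assume "j < ?r picks_reg" "r' power_reg = c ^ j"
      "unchanged ({outer_reg, Suc outer_reg} \<union> writes ?body) ?r r'"
    then show "vc L ?body (\<lambda>u (r'', m'). u \<le> 10 * (c + 1) + 3 \<and> m' = m \<and> r'' power_reg = c ^ Suc j) (r', m)"
      using base exponent by (intro step) (auto simp: unchanged_def)
  qed (use exponent in \<open>auto simp: algebra_simps\<close>)
qed

context machine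
begin

lemma stored_leaf:
  assumes "stored m h (n, k, b, D, A)"
  shows "A \<subseteq> {..<n}" "x < n \<Longrightarrow> m (h + x) - 1 = 0 \<longleftrightarrow> x \<notin> A"
proof -
  have marks: "m (h + x) \<le> 2 \<and> (m (h + x) = 2 \<longleftrightarrow> x \<in> A)" if "x < n" for x
    using assms that by (simp add: stored.simps)
  show "A \<subseteq> {..<n}" using assms by (simp add: stored.simps)
  show "m (h + x) - 1 = 0 \<longleftrightarrow> x \<notin> A" if "x < n" using marks[OF that] by auto
qed

lemma vc_Count_Conflicts:
  assumes graph: "holds_graph r m" and state: "stored m (r head_reg) (n, k, b, D, A)"
    and regs: "r outer_reg = w" "w < n" and room: "r head_reg + n < 2 ^ L"
  shows "vc L Count_Conflicts (\<lambda>u (r', m'). u \<le> 30 * (n + 1) \<and> m' = m \<and>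
    r' conflict_reg = card {x \<in> A. a w x}) (r, m)"
proof -
  let ?body = "seqs [Fetch cell_reg head_reg middle_reg, Sub_Const cell_reg cell_reg 1,
    If cell_reg (seqs [Edge outer_reg middle_reg, Add conflict_reg conflict_reg edge_reg]) Skip]"
  let ?r = "r(conflict_reg := 0, middle_reg := 0)"
  have size: "r n_reg = n" using graph by (simp add: holds_graph_def)
  have marked: "{x \<in> {0..<n}. x \<in> A \<and> a w x} = {x \<in> A. a w x}" using stored_leaf(1)[OF state] by auto
  show ?thesis
    unfolding Count_Conflicts_def
  proof (simp, rule vc_consequence[OF vc_For_count[where c=conflict_reg and B="\<lambda>x. x \<in> A \<and> a w x" and \<tau>=20]])
    fix j r'
    assume in_loop: "j < ?r n_reg" "r' middle_reg = j" "r' conflict_reg < ?r n_reg"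
      and same: "unchanged ({middle_reg, Suc middle_reg} \<union> writes ?body) ?r r'"
    have "holds_graph r' m" "r' head_reg = r head_reg" "r' outer_reg = w"
      using graph same regs by (simp_all add: holds_graph_def unchanged_def)
    then show "vc L ?body (\<lambda>u (r'', m'). u \<le> 20 \<and> m' = m \<and>
        r'' conflict_reg = r' conflict_reg + of_bool (j \<in> A \<and> a w j)) (r', m)"
      using in_loop size regs room stored_leaf(2)[OF state, of j] heap_less const_less(4)
      by (simp del: const_less(4))
  qed (use size marked in simp_all)
qed

lemma vc_Count_Avoiders:
  assumes graph: "holds_graph r m" and state: "stored m (r head_reg) (n, k, b, D, A)"
    and room: "r head_reg + n < 2 ^ L"
  shows "vc L Count_Avoiders (\<lambda>u (r', m'). u \<le> 50 * (n + 1) ^ 2 \<and> m' = m \<and>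
    r' count_reg = card (avoiders A)) (r, m)"
proof -
  let ?body = "seqs [Count_Conflicts, If conflict_reg Skip (Add_Const count_reg count_reg 1)]"
  let ?r = "r(count_reg := 0, outer_reg := 0)"
  have size: "r n_reg = n" using graph by (simp add: holds_graph_def)
  have avoiders: "w \<in> avoiders A \<longleftrightarrow> card {x \<in> A. a w x} = 0" if "w < n" for w
    using that finite_subset[OF stored_leaf(1)[OF state]] by (auto simp: avoiders_def)
  have all_avoiders: "{w \<in> {0..<n}. w \<in> avoiders A} = avoiders A" by (auto simp: avoiders_def)
  show ?thesis
    unfolding Count_Avoiders_def
  proof (simp, rule vc_consequence[OF vc_For_count[where c=count_reg and B="\<lambda>w. w \<in> avoiders A"
        and \<tau>="30 * (n + 1) + 10"]])
    fix j r'
    assume in_loop: "j < ?r n_reg" "r' outer_reg = j" "r' count_reg < ?r n_reg"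
      and same: "unchanged ({outer_reg, Suc outer_reg} \<union> writes ?body) ?r r'"
    have "holds_graph r' m" "r' head_reg = r head_reg"
      using graph same by (simp_all add: holds_graph_def unchanged_def)
    then have conflicts: "vc L Count_Conflicts (\<lambda>u (r'', m'). u \<le> 30 * (n + 1) \<and> m' = m \<and>
        r'' conflict_reg = card {x \<in> A. a j x}) (r', m)"
      using in_loop size state room by (intro vc_Count_Conflicts) auto
    show "vc L ?body (\<lambda>u (r'', m'). u \<le> 30 * (n + 1) + 10 \<and> m' = m \<and>
        r'' count_reg = r' count_reg + of_bool (j \<in> avoiders A)) (r', m)"
      by (rule vc_seqs[OF conflicts])
        (use in_loop size avoiders[of j] const_less(4) in \<open>simp add: unchanged_def del: const_less(4)\<close>)
  qed (use size all_avoiders in \<open>auto simp: power2_eq_square algebra_simps\<close>)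
qed

lemma vc_Sign:
  assumes regs: "r n_reg = n" and room: "r head_reg + n < 2 ^ L"
    and state: "stored m (r head_reg) (n, k, b, D, A)"
  shows "vc L Sign (\<lambda>u (r', m'). u \<le> 20 * (n + 1) \<and> m' = m \<and> r' sign_reg = card A mod 2) (r, m)"
proof -
  let ?body = "seqs [Fetch cell_reg head_reg middle_reg, Sub_Const cell_reg cell_reg 1,
    If cell_reg (seqs [Const cell_reg 1, Sub sign_reg cell_reg sign_reg]) Skip]"
  let ?r = "r(sign_reg := 0, middle_reg := 0)"
  have marks_Suc: "A \<inter> {..<Suc j} = (if j \<in> A then insert j (A \<inter> {..<j}) else A \<inter> {..<j})" for j
    by (auto simp: less_Suc_eq)
  have all_marks: "A \<inter> {..<n} = A" using stored_leaf(1)[OF state] by auto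
  show ?thesis
    unfolding Sign_def
  proof (simp, rule vc_consequence[OF vc_For_accumulate[where c=sign_reg and
        F="\<lambda>j. card (A \<inter> {..<j}) mod 2" and \<tau>=10]])
    fix j r'
    assume in_loop: "j < ?r n_reg" "r' middle_reg = j" "r' sign_reg = card (A \<inter> {..<j}) mod 2"
      and same: "unchanged ({middle_reg, Suc middle_reg} \<union> writes ?body) ?r r'"
    have "r' head_reg = r head_reg" using same by (simp add: unchanged_def)
    then show "vc L ?body (\<lambda>u (r'', m'). u \<le> 10 \<and> m' = m \<and>
        r'' sign_reg = card (A \<inter> {..<Suc j}) mod 2) (r', m)"
      using in_loop regs room stored_leaf(2)[OF state, of j] by (simp add: marks_Suc mod_Suc)
  qed (use regs all_marks in simp_all)
qed

definition adds :: "int \<Rightarrow> nat \<Rightarrow> (nat \<Rightarrow> nat) \<Rightarrow> (nat \<Rightarrow> nat) \<Rightarrow> bool" where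
  "adds x c r r' \<longleftrightarrow>
     int (r' plus_reg) - int (r' minus_reg) = int (r plus_reg) - int (r minus_reg) + x \<and>
     r' plus_reg + r' minus_reg \<le> r plus_reg + r minus_reg + c"

lemma adds_upd [simp]:
  "i \<notin> {plus_reg, minus_reg} \<Longrightarrow> adds x c (r(i := y)) r' \<longleftrightarrow> adds x c r r'"
  "i \<notin> {plus_reg, minus_reg} \<Longrightarrow> adds x c r (r'(i := y)) \<longleftrightarrow> adds x c r r'"
  by (auto simp: adds_def)

lemma card_avoiders_le: "card (avoiders A) \<le> n"
proof -
  have "avoiders A \<subseteq> {..<n}" by (auto simp: avoiders_def)
  then show ?thesis using card_mono[of "{..<n}"] by fastforce
qed

lemma leaf_bounds:
  assumes "c \<le> n" "k \<le> n" "(n + 1) ^ (k + 1) < 2 ^ L"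
  shows "(c + 1) ^ (k + 1) < 2 ^ L" "c ^ k \<le> n ^ k" "k * (10 * (c + 1) + 10) \<le> n * (10 * (n + 1) + 10)"
proof -
  have "(c + 1) ^ (k + 1) \<le> (n + 1) ^ (k + 1)" using assms(1) by (intro power_mono) auto
  then show "(c + 1) ^ (k + 1) < 2 ^ L" using assms(3) by (rule order.strict_trans1)
  show "c ^ k \<le> n ^ k" using assms(1) by (rule power_mono) simp
  show "k * (10 * (c + 1) + 10) \<le> n * (10 * (n + 1) + 10)" using assms(1,2) by (intro mult_le_mono) auto
qed

lemma vc_Leaf:
  assumes graph: "holds_graph r m" and state: "stored m (r head_reg) (n, k, b, D, A)"
    and picks: "r picks_reg = k" "k \<le> n" and room: "r head_reg + n < 2 ^ L"
    and power: "(n + 1) ^ (k + 1) < 2 ^ L" and total: "r plus_reg + r minus_reg + n ^ k < 2 ^ L"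
  shows "vc L Leaf (\<lambda>u (r', m'). u \<le> 100 * (n + 1) ^ 2 \<and> m' = m \<and>
    adds (signed_count 0 (n, k, b, D, A)) (n ^ k) r r') (r, m)"
    (is "vc L _ ?post (r, m)")
  unfolding Leaf_def
proof (rule vc_seqs[OF vc_Count_Avoiders[OF graph state room]])
  define c where "c = card (avoiders A)"
  note bounds = leaf_bounds[OF card_avoiders_le[of A] picks(2) power, folded c_def]
  fix u1 r1 m1
  assume count: "u1 \<le> 50 * (n + 1) ^ 2 \<and> m1 = m \<and> r1 count_reg = card (avoiders A)"
    and count_same: "unchanged (writes Count_Avoiders) r r1"
  have counted_registers: "r1 n_reg = n" "r1 head_reg = r head_reg" "r1 picks_reg = k"
    "r1 plus_reg = r plus_reg" "r1 minus_reg = r minus_reg"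
    using graph picks count_same by (simp_all add: holds_graph_def unchanged_def)
  show "vc L (seqs [Sign, Power, If sign_reg (Add minus_reg minus_reg power_reg)
      (Add plus_reg plus_reg power_reg)]) (\<lambda>u. ?post (u1 + u)) (r1, m1)"
  proof (rule vc_seqs[OF vc_Sign])
    fix u2 r2 m2
    assume sign: "u2 \<le> 20 * (n + 1) \<and> m2 = m1 \<and> r2 sign_reg = card A mod 2"
      and sign_same: "unchanged (writes Sign) r1 r2"
    show "vc L (seqs [Power, If sign_reg (Add minus_reg minus_reg power_reg)
        (Add plus_reg plus_reg power_reg)]) (\<lambda>u. ?post (u1 + (u2 + u))) (r2, m2)"
    proof (rule vc_seqs[OF vc_Power[where c=c and k=k]])
      fix u3 r3 m3
      assume power: "u3 \<le> k * (10 * (c + 1) + 10) + 5 \<and> m3 = m2 \<and> r3 power_reg = c ^ k"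
        and power_same: "unchanged (writes Power) r2 r3"
      have power_registers: "r3 plus_reg = r plus_reg" "r3 minus_reg = r minus_reg" "r3 sign_reg = card A mod 2"
        using counted_registers sign sign_same power_same by (simp_all add: unchanged_def)
      have time: "u1 + (u2 + (u3 + 3)) \<le> 100 * (n + 1) ^ 2"
        using count sign power bounds(3) by (simp add: power2_eq_square algebra_simps)
      have "(-1) ^ card A = (if card A mod 2 = 0 then 1 else - 1 :: int)"
        by (auto simp: even_iff_mod_2_eq_zero)
      then show "vc L (seqs [If sign_reg (Add minus_reg minus_reg power_reg)
          (Add plus_reg plus_reg power_reg)]) (\<lambda>u. ?post (u1 + (u2 + (u3 + u)))) (r3, m3)"
        using power_registers count sign power time total bounds(2) by (simp add: c_def adds_def)
    qed (use counted_registers count sign_same bounds picks const_less(4) in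
        \<open>auto simp: c_def unchanged_def simp del: const_less(4)\<close>)
  qed (use counted_registers room state count in auto)
qed

end

subsection \<open>Expanding a state\<close>

lemma length_filter_upt_le:
  fixes i j N :: nat
  assumes "Suc j \<le> N"
  shows "length (filter P [i..<Suc j]) \<le> length (filter P [i..<N])"
proof (cases "i \<le> Suc j")
  case True
  then have "[i..<N] = [i..<Suc j] @ [Suc j..<N]"
    using assms by (metis le_add_diff_inverse upt_add_eq_append)
  then show ?thesis by simp
qed simp

context machine
begin

declare children.simps [simp del] mark_children.simps [simp del] pick_children.simps [simp del]

lemma vc_Find_First_Candidate:
  assumes graph: "holds_graph r m" and regs: "r vertex_reg = v" "v < n" "r child_vertex_reg = Suc v"
  shows "vc L Find_First_Candidate (\<lambda>u (r', m'). u \<le> 30 * (n + 1) \<and> m' = m \<and>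
    r' outer_reg = first_candidate v) (r, m)"
  unfolding Find_First_Candidate_def
proof (rule vc_seqs[OF vc_Count_Adjacent[OF graph]])
  fix u r1 m1
  assume count: "u \<le> 20 * (n + 1) \<and> m1 = m \<and> r1 count_reg = degree_from a n (r child_vertex_reg) (r vertex_reg)"
    and same: "unchanged (writes (Count_Adjacent vertex_reg child_vertex_reg)) r r1"
  have "r1 count_reg = card (later v)" "r1 vertex_reg = v" "r1 child_vertex_reg = Suc v"
    using count same regs by (simp_all add: card_later_eq unchanged_def)
  then show "vc L (seqs [Move outer_reg vertex_reg,
      If count_reg (seqs [Sub_Const cell_reg count_reg 1,
        If cell_reg Skip (Move outer_reg child_vertex_reg)]) Skip])
    (\<lambda>u' (r', m'). u + u' \<le> 30 * (n + 1) \<and> m' = m \<and> r' outer_reg = first_candidate v) (r1, m1)"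
    using count by (auto simp: first_candidate_def simp del: card_0_eq)
qed (use regs in auto)

lemma vc_Try_Pick:
  assumes queue: "queue r m (q # qs)" and components: "q = (v, k, b, D, A)" "v < n"
    and regs: "r vertex_reg = v" "r child_vertex_reg = Suc v" "r child_picks_reg = k - 1"
      "r child_budget_reg = b - d" "r outer_reg = w" "w < n"
    and fits: "a v w \<Longrightarrow> fits r (length qs + 2)"
  shows "vc L Try_Pick (\<lambda>u (r', m'). u \<le> 50 * (n + 1) + 10 \<and>
    queue r' m' (q # qs @ (if a v w then [pick q w] else []))) (r, m)"
proof (cases "a v w")
  case True
  let ?r = "r(tmp_reg := order + w, addr_reg := m (rows + v) + m (order + w),
    cell_reg := m (order + w), edge_reg := 1)"
  have "vc L Push_Pick (\<lambda>u (r', m'). u \<le> 50 * (n + 1) \<and> queue r' m' (q # qs @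
      [(Suc v, ?r child_picks_reg, ?r child_budget_reg, D \<union> {x. a w x}, A)])) (?r, m)"
  proof (rule vc_Push_Pick[OF _ components, where r="?r"])
    show "fits ?r (length qs + 2)" using fits[OF True] by (rule fits_le) simp_all
  qed (use queue regs in simp_all)
  then have "vc L Push_Pick (\<lambda>u (r', m'). u \<le> 50 * (n + 1) \<and> queue r' m' (q # qs @ [pick q w])) (?r, m)"
    using components regs by (simp add: pick_def)
  then show ?thesis
    using True queue_ConsD(1)[OF queue] components regs by (auto simp: Try_Pick_def elim!: vc_mono)
next
  case False
  then show ?thesis using queue_ConsD(1)[OF queue] queue components regs by (simp add: Try_Pick_def)
qed

lemma vc_Push_Picks_loop:
  assumes queue: "queue r m (q # qs)" and components: "q = (v, k, b, D, A)" "v < n"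
    and regs: "r vertex_reg = v" "r child_vertex_reg = Suc v" "r child_picks_reg = k - 1"
      "r child_budget_reg = b - d" "r outer_reg = first_candidate v"
    and fits: "fits r (length qs + length (candidates v) + 1)"
  shows "vc L (For outer_reg n_reg Try_Pick) (\<lambda>u (r', m'). u \<le> 100 * (n + 1) ^ 2 \<and>
    queue r' m' (q # qs @ map (pick q) (candidates v))) (r, m)"
proof -
  define cs where "cs j = map (pick q) (filter (a v) [first_candidate v..<j])" for j
  have cs_Suc: "cs (Suc j) = cs j @ (if a v j then [pick q j] else [])" if "first_candidate v \<le> j" for j
    using that by (simp add: cs_def)
  have size: "r n_reg = n" using queue by (rule queue_ConsD)
  have "first_candidate v \<le> n" using components(2) by (simp add: first_candidate_def)
  show ?thesis
  proof (rule vc_consequence[OF vc_For[where \<tau>="50 * (n + 1) + 10" and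
        I="\<lambda>j r' m'. queue r' m' (q # qs @ cs j)"]])
    fix j r' m'
    assume in_loop: "r outer_reg \<le> j" "j < r n_reg" "r' outer_reg = j"
      and invariant: "queue r' m' (q # qs @ cs j)"
      and same: "unchanged ({outer_reg, Suc outer_reg} \<union> writes Try_Pick) r r'"
    have "fits r' (length (qs @ cs j) + 2)" if "a v j"
    proof (rule fits_le[OF fits])
      show "length (qs @ cs j) + 2 \<le> length qs + length (candidates v) + 1"
        using length_filter_upt_le[of j n "a v" "first_candidate v"] cs_Suc[of j] that in_loop size regs(5)
        by (simp add: cs_def candidates_def)
    qed (use same in \<open>simp add: unchanged_def\<close>)
    then have "vc L Try_Pick (\<lambda>u (r'', m''). u \<le> 50 * (n + 1) + 10 \<and>
        queue r'' m'' (q # (qs @ cs j) @ (if a v j then [pick q j] else []))) (r', m')"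
      using invariant components in_loop size same regs by (intro vc_Try_Pick) (auto simp: unchanged_def)
    then show "vc L Try_Pick (\<lambda>u (r'', m''). u \<le> 50 * (n + 1) + 10 \<and>
        queue r'' m'' (q # qs @ cs (Suc j))) (r', m')"
      using cs_Suc[of j] in_loop(1) regs(5) by (simp only: append_assoc)
  next
    fix u r' m'
    assume "u \<le> (r n_reg - r outer_reg) * (50 * (n + 1) + 10 + 5) + 2 \<and> queue r' m' (q # qs @ cs (r n_reg))"
    moreover have "(n - r outer_reg) * (50 * (n + 1) + 15) \<le> n * (50 * (n + 1) + 15)"
      by (rule mult_le_mono1) simp
    ultimately show "case (r', m') of (r', m') \<Rightarrow> u \<le> 100 * (n + 1) ^ 2 \<and>
        queue r' m' (q # qs @ map (pick q) (candidates v))"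
      using size by (simp add: cs_def candidates_def power2_eq_square algebra_simps)
  qed (use queue regs size \<open>first_candidate v \<le> n\<close> in \<open>simp_all add: cs_def\<close>)
qed

lemma vc_Push_Picks:
  assumes queue: "queue r m (q # qs)" and components: "q = (v, k, b, D, A)" "v < n"
    and regs: "r vertex_reg = v" "r picks_reg = k" "r budget_reg = b" "r child_vertex_reg = Suc v"
    and fits: "fits r (length qs + length (candidates v) + 1)"
  shows "vc L Push_Picks (\<lambda>u (r', m'). u \<le> 150 * (n + 1) ^ 2 \<and>
    queue r' m' (q # qs @ map (pick q) (candidates v))) (r, m)"
proof -
  let ?r = "r(tmp_reg := 1, child_picks_reg := k - 1, child_budget_reg := b - d)"
  have "vc L (seqs [Find_First_Candidate, For outer_reg n_reg Try_Pick]) (\<lambda>u (r', m').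
      3 + u \<le> 150 * (n + 1) ^ 2 \<and> queue r' m' (q # qs @ map (pick q) (candidates v))) (?r, m)"
  proof (rule vc_seqs[OF vc_Find_First_Candidate[where v=v]])
    fix u r1 m1
    assume first: "u \<le> 30 * (n + 1) \<and> m1 = m \<and> r1 outer_reg = first_candidate v"
      and same: "unchanged (writes Find_First_Candidate) ?r r1"
    have "vc L (For outer_reg n_reg Try_Pick) (\<lambda>u' (r', m'). u' \<le> 100 * (n + 1) ^ 2 \<and>
        queue r' m' (q # qs @ map (pick q) (candidates v))) (r1, m1)"
    proof (rule vc_Push_Picks_loop[OF _ components])
      have "queue ?r m1 (q # qs)" using queue first by simp
      then show "queue r1 m1 (q # qs)" using same by (rule queue_unchanged) simp
      show "fits r1 (length qs + length (candidates v) + 1)"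
        using fits by (rule fits_le) (use same in \<open>simp_all add: unchanged_def\<close>)
    qed (use same first regs in \<open>simp_all add: unchanged_def\<close>)
    then show "vc L (seqs [For outer_reg n_reg Try_Pick]) (\<lambda>u' (r', m').
        3 + (u + u') \<le> 150 * (n + 1) ^ 2 \<and> queue r' m' (q # qs @ map (pick q) (candidates v))) (r1, m1)"
      unfolding vc_seqs_simps
      by (rule vc_mono) (use first in \<open>auto simp: power2_eq_square algebra_simps\<close>)
  qed (use queue_ConsD(1)[OF queue] components regs in simp_all)
  then show ?thesis using regs queue_ConsD(3)[OF queue] by (auto simp: Push_Picks_def elim!: vc_mono)
qed

lemma vc_Maybe_Push_Picks:
  assumes queue: "queue r m (q # qs)" and components: "q = (v, k, b, D, A)" "v < n"
    and regs: "r vertex_reg = v" "r picks_reg = k" "r budget_reg = b" "r child_vertex_reg = Suc v"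
    and fits: "fits r (length qs + length (pick_children q) + 1)"
  shows "vc L Maybe_Push_Picks (\<lambda>u (r', m'). u \<le> 160 * (n + 1) ^ 2 \<and>
    queue r' m' (q # qs @ pick_children q)) (r, m)"
proof -
  have degree: "r degree_reg = d" using queue by (rule queue_ConsD)
  have square: "n + 1 \<le> (n + 1) ^ 2" by (simp add: power2_eq_square)
  show ?thesis
  proof (cases "0 < k \<and> d \<le> b")
    case True
    then have children: "pick_children q = map (pick q) (candidates v)"
      by (simp add: pick_children.simps components)
    have "fits (r(cell_reg := 0)) (length qs + length (candidates v) + 1)"
      using fits by (rule fits_le) (simp_all add: children)
    then have "vc L Push_Picks (\<lambda>u (r', m'). u \<le> 150 * (n + 1) ^ 2 \<and>
        queue r' m' (q # qs @ pick_children q)) (r(cell_reg := 0), m)"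
      unfolding children using queue components regs by (intro vc_Push_Picks) simp_all
    then show ?thesis
      using True regs degree square by (auto simp: Maybe_Push_Picks_def elim!: vc_mono)
  next
    case False
    then have "pick_children q = []" by (auto simp: pick_children.simps components)
    then show ?thesis
      using False queue regs degree square by (auto simp: Maybe_Push_Picks_def)
  qed
qed

lemma vc_Push_Marks:
  assumes queue: "queue r m (q # qs)" and components: "q = (v, k, b, D, A)" "v < n"
    and regs: "r vertex_reg = v" "r picks_reg = k" "r budget_reg = b" "r child_vertex_reg = Suc v"
    and fits: "fits r (length qs + length (mark_children q) + 1)"
  shows "vc L Push_Marks (\<lambda>u (r', m'). u \<le> 70 * (n + 1) \<and> queue r' m' (q # qs @ mark_children q)) (r, m)"
proof (cases "0 < b")
  case True
  let ?unmarked = "(Suc v, k, b - 1, D, A)" and ?marked = "(Suc v, k, b - 1, D, insert v A)"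
  let ?r = "r(tmp_reg := 0, child_picks_reg := k, tmp_reg := 1, child_budget_reg := b - 1)"
  have children: "mark_children q = [?unmarked, ?marked]"
    using True by (simp add: mark_children.simps components)
  have "vc L (seqs [Push, Push_Marked]) (\<lambda>u (r', m'). u \<le> 60 * (n + 1) + 1 \<and>
      queue r' m' (q # qs @ mark_children q)) (?r, m)"
  proof (rule vc_seqs[OF vc_Push[OF _ components]])
    show "fits ?r (length qs + 2)" using fits by (rule fits_le) (simp_all add: children)
    fix u r1 m1
    assume push: "u \<le> 30 * (n + 1) \<and>
        queue r1 m1 (q # qs @ [(Suc v, ?r child_picks_reg, ?r child_budget_reg, D, A)])"
      and same: "unchanged (writes Push) ?r r1"
    have "vc L Push_Marked (\<lambda>u (r', m'). u \<le> 30 * (n + 1) \<and> queue r' m' (q # (qs @ [?unmarked]) @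
        [(Suc v, r1 child_picks_reg, r1 child_budget_reg, D, insert v A)])) (r1, m1)"
    proof (rule vc_Push_Marked[OF _ components])
      show "fits r1 (length (qs @ [?unmarked]) + 2)"
        using fits by (rule fits_le) (use same in \<open>simp_all add: children unchanged_def\<close>)
    qed (use push same regs in \<open>simp_all add: unchanged_def\<close>)
    then show "vc L (seqs [Push_Marked]) (\<lambda>u' (r', m'). u + u' \<le> 60 * (n + 1) + 1 \<and>
        queue r' m' (q # qs @ mark_children q)) (r1, m1)"
      unfolding vc_seqs_simps children
      by (rule vc_mono) (use push same in \<open>auto simp: unchanged_def\<close>)
  qed (use queue regs in simp_all)
  then show ?thesis using True regs by (auto simp: Push_Marks_def elim!: vc_mono)
next
  case False
  then show ?thesis using queue regs by (simp add: Push_Marks_def mark_children.simps components)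
qed

lemma vc_Push_Children:
  assumes queue: "queue r m (q # qs)" and components: "q = (v, k, b, D, A)" "v < n" "v \<notin> D"
    and regs: "r vertex_reg = v" "r picks_reg = k" "r budget_reg = b" "r child_vertex_reg = Suc v"
    and fits: "fits r (length qs + length (children q) + 1)"
  shows "vc L (seqs [Push_Marks, Maybe_Push_Picks]) (\<lambda>u (r', m'). u \<le> 240 * (n + 1) ^ 2 \<and>
    queue r' m' (q # qs @ children q)) (r, m)"
proof -
  have children: "children q = mark_children q @ pick_children q" using components by (simp add: children.simps)
  show ?thesis
  proof (rule vc_seqs[OF vc_Push_Marks[OF queue components(1,2) regs]])
    show "fits r (length qs + length (mark_children q) + 1)"
      using fits by (rule fits_le) (simp_all add: children)
    fix u r1 m1
    assume marks: "u \<le> 70 * (n + 1) \<and> queue r1 m1 (q # qs @ mark_children q)"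
      and same: "unchanged (writes Push_Marks) r r1"
    have "vc L Maybe_Push_Picks (\<lambda>u (r', m'). u \<le> 160 * (n + 1) ^ 2 \<and>
        queue r' m' (q # (qs @ mark_children q) @ pick_children q)) (r1, m1)"
    proof (rule vc_Maybe_Push_Picks[OF _ components(1,2)])
      show "fits r1 (length (qs @ mark_children q) + length (pick_children q) + 1)"
        using fits by (rule fits_le) (use same in \<open>simp_all add: children unchanged_def\<close>)
    qed (use marks same regs in \<open>simp_all add: unchanged_def\<close>)
    then show "vc L (seqs [Maybe_Push_Picks]) (\<lambda>u' (r', m'). u + u' \<le> 240 * (n + 1) ^ 2 \<and>
        queue r' m' (q # qs @ children q)) (r1, m1)"
      unfolding vc_seqs_simps children
      by (rule vc_mono) (use marks in \<open>auto simp: power2_eq_square algebra_simps\<close>)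
  qed
qed

lemma vc_Expand:
  assumes queue: "queue r m (q # qs)" and components: "q = (v, k, b, D, A)" "v < n"
    and regs: "r vertex_reg = v" "r picks_reg = k" "r budget_reg = b"
    and fits: "fits r (length qs + length (children q) + 1)"
  shows "vc L Expand (\<lambda>u (r', m'). u \<le> 250 * (n + 1) ^ 2 \<and> queue r' m' (q # qs @ children q)) (r, m)"
proof -
  have "fits r 1" using fits by (rule fits_le) simp_all
  then have head: "r head_reg + v < 2 ^ L" using components(2) by (simp add: fits_def)
  have dominated: "m (r head_reg + v) = of_bool (v \<in> D)"
    using stored_entries(5)[of m _ v k b D A] queue_ConsD(7)[OF queue] components by simp
  have square: "n + 1 \<le> (n + 1) ^ 2" by (simp add: power2_eq_square)
  have fits_child: "fits r' l" if "l \<le> length qs + length (children q) + 1" "r' head_reg = r head_reg" for r' l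
    using fits that by (rule fits_le)
  show ?thesis
  proof (cases "v \<in> D")
    case True
    let ?r = "r(tmp_reg := 1, child_vertex_reg := v + 1, tmp_reg := r head_reg + v, cell_reg := 1,
      tmp_reg := 0, child_picks_reg := k, tmp_reg := 0, child_budget_reg := b)"
    have children: "children q = [(Suc v, k, b, D, A)]" using True by (simp add: children.simps components)
    have "vc L Push (\<lambda>u (r', m'). u \<le> 30 * (n + 1) \<and> queue r' m' (q # qs @
        [(Suc v, ?r child_picks_reg, ?r child_budget_reg, D, A)])) (?r, m)"
      using queue by (intro vc_Push[OF _ components, where r="?r"]) (simp_all add: children fits_child)
    then show ?thesis
      using True head dominated regs square const_less(4) components(2)
      by (auto simp: Expand_def children elim!: vc_mono simp del: const_less(4))
  next
    case False
    let ?r = "r(tmp_reg := 1, child_vertex_reg := v + 1, tmp_reg := r head_reg + v, cell_reg := 0)"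
    have "vc L (seqs [Push_Marks, Maybe_Push_Picks]) (\<lambda>u (r', m'). u \<le> 240 * (n + 1) ^ 2 \<and>
        queue r' m' (q # qs @ children q)) (?r, m)"
      using queue regs by (intro vc_Push_Children[OF _ components False]) (simp_all add: fits_child)
    then show ?thesis
      using False head dominated regs square const_less(4) components(2)
      by (auto simp: Expand_def elim!: vc_mono simp del: const_less(4))
  qed
qed

subsection \<open>Exploring all states\<close>

lemma vc_Load_State:
  assumes "stored m (r head_reg) (v, k, b, D, A)" "r n_reg = n" "r head_reg + (n + 3) < 2 ^ L"
  shows "vc L Load_State (\<lambda>u (r', m'). u \<le> 20 \<and> m' = m \<and> r' vertex_reg = v \<and> r' picks_reg = k \<and>
    r' budget_reg = b) (r, m)"
proof -
  have "m (r head_reg + n) = v" "m (r head_reg + n + 1) = k" "m (r head_reg + n + 1 + 1) = b"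
    using stored_entries(2-4)[OF assms(1)] by (simp_all add: add.assoc)
  then show ?thesis using assms(2,3) by (simp add: Load_State_def)
qed

lemma vc_Leaf_queue:
  assumes queue: "queue r m (q # qs)" and components: "q = (n, k, b, D, A)" "k \<le> n"
    and picks: "r picks_reg = k" and fits: "fits r 1"
    and power: "(n + 1) ^ (k + 1) < 2 ^ L" and total: "r plus_reg + r minus_reg + n ^ k < 2 ^ L"
  shows "vc L Leaf (\<lambda>u (r', m'). u \<le> 100 * (n + 1) ^ 2 \<and> queue r' m' (q # qs) \<and>
    adds (leaf_value q) (n ^ k) r r') (r, m)"
proof -
  have "leaf_value q = signed_count 0 (n, k, b, D, A)" by (simp add: leaf_value_def components)
  moreover have "holds_graph r m" "stored m (r head_reg) (n, k, b, D, A)"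
    using queue_ConsD(1,7)[OF queue] components by simp_all
  ultimately have "vc L Leaf (\<lambda>u (r', m'). u \<le> 100 * (n + 1) ^ 2 \<and> m' = m \<and>
      adds (leaf_value q) (n ^ k) r r') (r, m)"
    using vc_Leaf[of r m k b D A] picks components(2) fits power total by (simp add: fits_def)
  then show ?thesis
  proof (rule vc_consequence)
    fix u r' m'
    assume leaf: "u \<le> 100 * (n + 1) ^ 2 \<and> m' = m \<and> adds (leaf_value q) (n ^ k) r r'"
      and same: "unchanged (writes Leaf) r r'"
    have "queue r' m (q # qs)" using queue same by (rule queue_unchanged) simp
    then show "case (r', m') of (r', m') \<Rightarrow> u \<le> 100 * (n + 1) ^ 2 \<and> queue r' m' (q # qs) \<and>
        adds (leaf_value q) (n ^ k) r r'" using leaf by simp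
  qed
qed

lemma vc_Visit:
  assumes queue: "queue r m (q # qs)" and components: "q = (v, k, b, D, A)" "k \<le> n"
    and regs: "r vertex_reg = v" "r picks_reg = k" "r budget_reg = b"
    and fits: "fits r (length qs + length (successors q) + 1)"
    and power: "(n + 1) ^ (k + 1) < 2 ^ L" and total: "r plus_reg + r minus_reg + n ^ k < 2 ^ L"
  shows "vc L Visit (\<lambda>u (r', m'). u \<le> 260 * (n + 1) ^ 2 \<and> queue r' m' (q # qs @ successors q) \<and>
    adds (leaf_value q) (n ^ k) r r') (r, m)"
proof -
  let ?r = "r(cell_reg := n - v)"
  have size: "r n_reg = n" using queue by (rule queue_ConsD)
  have "v \<le> n" using stored_entries(1)[of m _ v k b D A] queue_ConsD(7)[OF queue] components(1) by simp
  have square: "n + 1 \<le> (n + 1) ^ 2" by (simp add: power2_eq_square)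
  have fits_r: "fits ?r l" if "l \<le> length qs + length (successors q) + 1" for l
    using fits that by (rule fits_le) simp
  show ?thesis
  proof (cases "v < n")
    case True
    then have inner: "successors q = children q" "leaf_value q = 0"
      by (simp_all add: successors_def leaf_value_def components)
    have "vc L Expand (\<lambda>u (r', m'). u \<le> 250 * (n + 1) ^ 2 \<and> queue r' m' (q # qs @ successors q)) (?r, m)"
      unfolding inner(1) using queue regs fits_r
      by (intro vc_Expand[OF _ components(1) True, where r="?r"]) (simp_all add: inner(1))
    then have "vc L Expand (\<lambda>u (r', m'). 3 + u \<le> 260 * (n + 1) ^ 2 \<and>
        queue r' m' (q # qs @ successors q) \<and> adds (leaf_value q) (n ^ k) r r') (?r, m)"
      by (rule vc_consequence) (use square inner(2) in \<open>auto simp: unchanged_def adds_def\<close>)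
    then show ?thesis using True size regs by (auto simp: Visit_def elim!: vc_mono)
  next
    case False
    with \<open>v \<le> n\<close> have "v = n" by simp
    have "vc L Leaf (\<lambda>u (r', m'). u \<le> 100 * (n + 1) ^ 2 \<and> queue r' m' (q # qs) \<and>
        adds (leaf_value q) (n ^ k) ?r r') (?r, m)"
      by (rule vc_Leaf_queue[where r="?r"])
        (use queue components \<open>v = n\<close> regs fits_r[of 1] power total in simp_all)
    moreover have "successors q = []" using components \<open>v = n\<close> by (simp add: successors_def)
    ultimately show ?thesis using False size regs square by (auto simp: Visit_def elim!: vc_mono)
  qed
qed

lemma queue_tl:
  assumes "queue r m (q # qs)"
  shows "queue (r(head_reg := r head_reg + (n + 3))) m qs"
proof -
  have "\<forall>i<length (q # qs). stored m (r head_reg + i * (n + 3)) ((q # qs) ! i)"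
    using assms unfolding queue_def by blast
  then have "stored m (r head_reg + (n + 3) + i * (n + 3)) (qs ! i)" if "i < length qs" for i
    using that by (auto dest!: spec[of _ "Suc i"] simp: algebra_simps)
  then show ?thesis using assms by (auto simp: queue_def algebra_simps)
qed

lemma vc_Step:
  assumes queue: "queue r m (q # qs)" and components: "q = (v, k, b, D, A)" "k \<le> n"
    and fits: "fits r (length qs + length (successors q) + 1)"
    and power: "(n + 1) ^ (k + 1) < 2 ^ L" and total: "r plus_reg + r minus_reg + n ^ k < 2 ^ L"
  shows "vc L Step (\<lambda>u (r', m'). u \<le> 300 * (n + 1) ^ 2 \<and> r' head_reg = r head_reg + (n + 3) \<and>
    r' queue_reg = length (qs @ successors q) * (n + 3) \<and> queue r' m' (qs @ successors q) \<and>
    adds (leaf_value q) (n ^ k) r r') (r, m)" (is "vc L _ ?post (r, m)")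
  unfolding Step_def
proof (rule vc_seqs[OF vc_Load_State[where v=v and k=k and b=b and D=D and A=A]])
  have "fits r 1" using fits by (rule fits_le) simp_all
  then show room: "r head_reg + (n + 3) < 2 ^ L" by (simp add: fits_def)
  fix u :: nat and r1 m1
  assume load: "u \<le> 20 \<and> m1 = m \<and> r1 vertex_reg = v \<and> r1 picks_reg = k \<and> r1 budget_reg = b"
    and same: "unchanged (writes Load_State) r r1"
  have registers: "r1 head_reg = r head_reg" "r1 plus_reg = r plus_reg" "r1 minus_reg = r minus_reg"
    using same by (simp_all add: unchanged_def)
  have loaded_queue: "queue r1 m1 (q # qs)" using load queue_unchanged[OF queue same] by simp
  have "fits r1 (length qs + length (successors q) + 1)" using fits by (rule fits_le) (simp_all add: registers)
  then have "vc L Visit (\<lambda>u (r', m'). u \<le> 260 * (n + 1) ^ 2 \<and> queue r' m' (q # qs @ successors q) \<and>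
      adds (leaf_value q) (n ^ k) r1 r') (r1, m1)"
    using load registers total by (intro vc_Visit[OF loaded_queue components _ _ _ _ power]) simp_all
  then show "vc L (seqs [Visit, Add head_reg head_reg block_reg, Sub queue_reg tail_reg head_reg])
      (\<lambda>u'. ?post (u + u')) (r1, m1)"
  proof (rule vc_seqs)
    fix u' r2 m2
    assume visit: "u' \<le> 260 * (n + 1) ^ 2 \<and> queue r2 m2 (q # qs @ successors q) \<and>
        adds (leaf_value q) (n ^ k) r1 r2"
      and "unchanged (writes Visit) r1 r2"
    then have head: "r2 head_reg = r head_reg" using registers by (simp add: unchanged_def)
    have visited_queue: "queue r2 m2 (q # (qs @ successors q))" using visit by simp
    have "n + 1 \<le> (n + 1) ^ 2" by (simp add: power2_eq_square)
    moreover have "adds (leaf_value q) (n ^ k) r r2" using visit registers by (simp add: adds_def)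
    ultimately show "vc L (seqs [Add head_reg head_reg block_reg, Sub queue_reg tail_reg head_reg])
        (\<lambda>u''. ?post (u + (u' + u''))) (r2, m2)"
      using load visit head room queue_tl[OF visited_queue] queue_ConsD(4,8)[OF visited_queue]
      by (simp add: add_mult_distrib)
  qed
qed (use queue_ConsD(2,7)[OF queue] components in simp_all)

definition exploring :: "nat \<Rightarrow> int \<Rightarrow> state list \<Rightarrow> (nat \<Rightarrow> nat) \<Rightarrow> (nat \<Rightarrow> nat) \<Rightarrow> bool" where
  "exploring K target qs r m \<longleftrightarrow> queue r m qs \<and> r queue_reg = length qs * (n + 3) \<and>
     (\<forall>q\<in>set qs. admissible K q) \<and>
     r head_reg + (n + 3) * (\<Sum>q\<leftarrow>qs. weight q) < 2 ^ L \<and>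
     r plus_reg + r minus_reg + n ^ K * (\<Sum>q\<leftarrow>qs. weight q) < 2 ^ L \<and>
     int (r plus_reg) - int (r minus_reg) + (\<Sum>q\<leftarrow>qs. state_value q) = target"

lemma exploring_fits:
  assumes "exploring K target (q # qs) r m"
  shows "fits r (length qs + length (successors q) + 1)"
proof -
  have admissible: "admissible K q" "\<forall>c\<in>set qs. admissible K c"
    and room: "r head_reg + (n + 3) * (\<Sum>c\<leftarrow>q # qs. weight c) < 2 ^ L"
    using assms by (auto simp: exploring_def)
  have "\<forall>c\<in>set (qs @ successors q). admissible K c"
    using admissible(2) admissible_successors[OF admissible(1)] by auto
  then have "length (qs @ successors q) \<le> (\<Sum>c\<leftarrow>qs @ successors q. weight c)"
    by (rule length_le_sum_weight)
  also have "\<dots> < (\<Sum>c\<leftarrow>q # qs. weight c)"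
    using sum_weight_successors_less[OF admissible(1)] by simp
  finally have "length qs + length (successors q) + 1 \<le> (\<Sum>c\<leftarrow>q # qs. weight c)" by simp
  moreover have "fits r (\<Sum>c\<leftarrow>q # qs. weight c)" using room by (simp only: fits_def mult.commute)
  ultimately show ?thesis by (auto intro: fits_le)
qed

lemma vc_exploring_Step:
  assumes exploring: "exploring K target qs r m" and "r queue_reg \<noteq> 0"
    and room_power: "K \<le> n" "(n + 1) ^ (K + 1) < 2 ^ L"
  shows "vc L Step (\<lambda>u (r', m'). u \<le> 300 * (n + 1) ^ 2 \<and>
    (\<exists>qs'. (\<Sum>q\<leftarrow>qs'. weight q) < (\<Sum>q\<leftarrow>qs. weight q) \<and> exploring K target qs' r' m')) (r, m)"
proof -
  obtain q rest where qs_eq: "qs = q # rest"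
    using assms(1,2) by (cases qs) (auto simp: exploring_def)
  obtain v k b D A where q_eq: "q = (v, k, b, D, A)" by (cases q)
  let ?W = "\<Sum>q\<leftarrow>qs. weight q" and ?W' = "\<Sum>q\<leftarrow>rest @ successors q. weight q"
  have queue: "queue r m (q # rest)" and admissible: "admissible K q" "\<forall>q\<in>set rest. admissible K q"
    and room: "r head_reg + (n + 3) * ?W < 2 ^ L" "r plus_reg + r minus_reg + n ^ K * ?W < 2 ^ L"
    and target: "int (r plus_reg) - int (r minus_reg) + (\<Sum>q\<leftarrow>qs. state_value q) = target"
    using exploring by (auto simp: exploring_def qs_eq)
  have admissible_next: "\<forall>q\<in>set (rest @ successors q). admissible K q"
    using admissible(2) admissible_successors[OF admissible(1)] by auto
  have less: "?W' < ?W" using sum_weight_successors_less[OF admissible(1)] by (simp add: qs_eq)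
  have scale: "c + c * ?W' \<le> c * ?W" for c :: nat
    using mult_le_mono2[of "Suc ?W'" ?W c] less by simp
  have picks_le: "k \<le> K" using admissible(1) by (simp add: admissible_def q_eq)
  then have "0 < n \<or> k = K" using room_power(1) by auto
  then have power_le: "n ^ k \<le> n ^ K" using picks_le by (auto intro: power_increasing)
  have "(n + 1) ^ (k + 1) \<le> (n + 1) ^ (K + 1)" using picks_le by (intro power_increasing) auto
  then have "(n + 1) ^ (k + 1) < 2 ^ L" using room_power(2) by (rule order.strict_trans1)
  moreover have "r plus_reg + r minus_reg + n ^ k < 2 ^ L"
    using room(2) scale[of "n ^ K"] power_le by linarith
  ultimately have "vc L Step (\<lambda>u (r', m'). u \<le> 300 * (n + 1) ^ 2 \<and> r' head_reg = r head_reg + (n + 3) \<and>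
      r' queue_reg = length (rest @ successors q) * (n + 3) \<and> queue r' m' (rest @ successors q) \<and>
      adds (leaf_value q) (n ^ k) r r') (r, m)"
    using picks_le room_power(1) exploring_fits[of K target q rest r m] exploring
    by (intro vc_Step[OF queue q_eq]) (simp_all add: qs_eq)
  then show ?thesis
  proof (rule vc_consequence, unfold prod.case)
    fix u r' m'
    assume step: "u \<le> 300 * (n + 1) ^ 2 \<and> r' head_reg = r head_reg + (n + 3) \<and>
      r' queue_reg = length (rest @ successors q) * (n + 3) \<and> queue r' m' (rest @ successors q) \<and>
      adds (leaf_value q) (n ^ k) r r'"
    have "exploring K target (rest @ successors q) r' m'"
      using step admissible_next room scale[of "n + 3"] scale[of "n ^ K"] power_le target state_value_eq[of q]
      by (simp add: exploring_def adds_def qs_eq)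
    then show "u \<le> 300 * (n + 1) ^ 2 \<and> (\<exists>qs'. (\<Sum>q\<leftarrow>qs'. weight q) < ?W \<and> exploring K target qs' r' m')"
      using step less by blast
  qed
qed

lemma vc_While_Step:
  assumes "exploring K target qs r m" "K \<le> n" "(n + 1) ^ (K + 1) < 2 ^ L"
  shows "vc L (While queue_reg Step) (\<lambda>u (r', m').
    u \<le> (\<Sum>q\<leftarrow>qs. weight q) * (300 * (n + 1) ^ 2 + 1) + 1 \<and>
    int (r' plus_reg) - int (r' minus_reg) = target) (r, m)"
proof -
  have "vc L (While queue_reg Step) (\<lambda>u (r', m'). u \<le> (\<Sum>q\<leftarrow>qs. weight q) * (300 * (n + 1) ^ 2 + 1) + 1 \<and>
      r' queue_reg = 0 \<and> (\<exists>qs'. exploring K target qs' r' m')) (r, m)"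
    using assms by (intro vc_While vc_exploring_Step)
  then show ?thesis by (rule vc_mono) (auto simp: exploring_def)
qed

end

subsection \<open>Degeneracy orders\<close>

lemma vertex_degree_induced:
  assumes edges: "\<forall>e\<in>E. card e = 2" and vertex: "v \<in> R"
  shows "vertex_degree {e \<in> E. e \<subseteq> R} v = card {u \<in> R. {v, u} \<in> E}"
proof -
  have "{e \<in> {e \<in> E. e \<subseteq> R}. v \<in> e} = (\<lambda>u. {v, u}) ` {u \<in> R. {v, u} \<in> E}"
  proof (intro equalityI subsetI)
    fix e assume incident: "e \<in> {e \<in> {e \<in> E. e \<subseteq> R}. v \<in> e}"
    then have "card e = 2" using edges by auto
    then obtain x y where "e = {x, y}" by (auto simp: card_2_iff)
    then obtain u where "e = {v, u}" using incident by auto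
    then show "e \<in> (\<lambda>u. {v, u}) ` {u \<in> R. {v, u} \<in> E}" using incident by auto
  qed (use vertex in auto)
  moreover have "inj_on (\<lambda>u. {v, u}) {u \<in> R. {v, u} \<in> E}" by (auto simp: inj_on_def doubleton_eq_iff)
  ultimately show ?thesis by (simp add: vertex_degree_def card_image)
qed

lemma ex_degree_le_degeneracy:
  assumes graph: "simple_graph V E" and subset: "R \<subseteq> V" "R \<noteq> {}"
  shows "\<exists>v\<in>R. card {u \<in> R. {v, u} \<in> E} \<le> degeneracy V E"
proof -
  let ?P = "\<lambda>d. \<forall>V' E'. subgraph V' E' V E \<and> V' \<noteq> {} \<longrightarrow> (\<exists>v\<in>V'. vertex_degree E' v \<le> d)"
  have finite_E: "finite E"
    using graph by (intro finite_subset[of E "Pow V"]) (auto simp: simple_graph_def)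
  have "?P (card E)"
  proof (intro allI impI)
    fix V' E' assume subgraph: "subgraph V' E' V E \<and> V' \<noteq> {}"
    then have "vertex_degree E' v \<le> card E" for v
      unfolding vertex_degree_def using finite_E by (intro card_mono) (auto simp: subgraph_def)
    then show "\<exists>v\<in>V'. vertex_degree E' v \<le> card E" using subgraph by auto
  qed
  then have "?P (degeneracy V E)" unfolding degeneracy_def by (rule LeastI)
  moreover have "subgraph R {e \<in> E. e \<subseteq> R} V E"
    using graph subset by (auto simp: subgraph_def simple_graph_def intro: finite_subset)
  ultimately obtain v where "v \<in> R" "vertex_degree {e \<in> E. e \<subseteq> R} v \<le> degeneracy V E"
    using subset by blast
  then show ?thesis using vertex_degree_induced[of E v R] graph by (auto simp: simple_graph_def)
qed

lemma degree_from_le: "degree_from a n p v \<le> n"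
proof -
  have "card {u \<in> {p..<n}. a v u} \<le> card {p..<n}" by (rule card_mono) auto
  then show ?thesis by (simp add: degree_from_def)
qed

lemma degree_from_self:
  assumes "a p p" "p < n"
  shows "degree_from a n p p = Suc (degree_from a n (Suc p) p)"
proof -
  have "{u \<in> {p..<n}. a p u} = insert p {u \<in> {Suc p..<n}. a p u}"
    using assms by (auto simp: Suc_le_eq le_less)
  then show ?thesis by (simp add: degree_from_def)
qed

lemma degree_from_transpose:
  assumes "q \<le> p" "p < n" "q \<le> s" "s < n"
  shows "degree_from (\<lambda>x y. a (transpose p s x) (transpose p s y)) n q x = degree_from a n q (transpose p s x)"
proof -
  have image: "transpose p s ` {q..<n} = {q..<n}" using assms by (intro transpose_image_eq) auto
  have "{u \<in> transpose p s ` {q..<n}. a (transpose p s x) u}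
      = transpose p s ` {y \<in> {q..<n}. a (transpose p s x) (transpose p s y)}" by blast
  then show ?thesis unfolding image by (simp add: degree_from_def card_image)
qed

definition closed_adj :: "'a set set \<Rightarrow> 'a \<Rightarrow> 'a \<Rightarrow> bool" where
  "closed_adj E u v \<longleftrightarrow> u = v \<or> {u, v} \<in> E"

lemma closed_adj_refl: "closed_adj E v v"
  by (simp add: closed_adj_def)

lemma closed_adj_sym: "closed_adj E u v \<Longrightarrow> closed_adj E v u"
  by (auto simp: closed_adj_def insert_commute)

lemma Dominating_Set_iff_dominates:
  "Dominating_Set V E k \<longleftrightarrow> (\<exists>S\<subseteq>V. card S \<le> k \<and> dominates (closed_adj E) S V)"
proof -
  have "(v \<in> S \<or> (\<exists>u\<in>S. {u, v} \<in> E)) \<longleftrightarrow> (\<exists>u\<in>S. closed_adj E u v)" for v S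
    by (auto simp: closed_adj_def)
  then show ?thesis
    by (auto simp: Dominating_Set_def dominating_set_def dominates_def)
qed

definition order_adj :: "'a set set \<Rightarrow> (nat \<Rightarrow> 'a) \<Rightarrow> nat \<Rightarrow> nat \<Rightarrow> bool" where
  "order_adj E \<pi> p q \<longleftrightarrow> closed_adj E (\<pi> p) (\<pi> q)"

lemma order_adj_transpose:
  "order_adj E (\<pi> \<circ> transpose p s) = (\<lambda>x y. order_adj E \<pi> (transpose p s x) (transpose p s y))"
  by (simp add: order_adj_def fun_eq_iff)

lemma Dominating_Set_iff_order:
  assumes "bij_betw \<pi> A V"
  shows "Dominating_Set V E k \<longleftrightarrow> (\<exists>T\<subseteq>A. card T \<le> k \<and> dominates (order_adj E \<pi>) T A)"
proof -
  have V_eq: "V = \<pi> ` A" and injective: "inj_on \<pi> A" using assms by (auto simp: bij_betw_def)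
  have "dominates (closed_adj E) (\<pi> ` T) V \<longleftrightarrow> dominates (order_adj E \<pi>) T A" for T
    by (simp add: V_eq dominates_def order_adj_def)
  moreover have "card (\<pi> ` T) = card T" if "T \<subseteq> A" for T
    using injective that by (intro card_image) (rule inj_on_subset)
  ultimately show ?thesis
    unfolding Dominating_Set_iff_dominates V_eq using V_eq by (simp add: subset_image_iff) metis
qed

lemma degree_from_order_adj:
  assumes "inj_on \<pi> {p..<n}"
  shows "degree_from (order_adj E \<pi>) n p q = card {u \<in> \<pi> ` {p..<n}. closed_adj E (\<pi> q) u}"
proof -
  have "{u \<in> \<pi> ` {p..<n}. closed_adj E (\<pi> q) u} = \<pi> ` {x \<in> {p..<n}. order_adj E \<pi> q x}"
    by (auto simp: order_adj_def)
  moreover have "inj_on \<pi> {x \<in> {p..<n}. order_adj E \<pi> q x}" using assms by (rule inj_on_subset) auto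
  ultimately show ?thesis by (simp add: degree_from_def card_image)
qed

lemma ex_degree_from_le_degeneracy:
  assumes graph: "simple_graph {..<n} E" and bijective: "bij_betw \<pi> {..<n} {..<n}" and position: "p < n"
  shows "\<exists>q\<in>{p..<n}. degree_from (order_adj E \<pi>) n p q \<le> degeneracy {..<n} E + 1"
proof -
  let ?R = "\<pi> ` {p..<n}"
  have injective: "inj_on \<pi> {p..<n}" using bijective by (auto simp: bij_betw_def intro: inj_on_subset)
  have "?R \<subseteq> {..<n}" "?R \<noteq> {}" using bijective position by (auto simp: bij_betw_def)
  then obtain v where low_degree: "v \<in> ?R" "card {u \<in> ?R. {v, u} \<in> E} \<le> degeneracy {..<n} E"
    using ex_degree_le_degeneracy[OF graph] by blast
  then obtain q where preimage: "q \<in> {p..<n}" "v = \<pi> q" by blast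
  have "{u \<in> ?R. closed_adj E v u} \<subseteq> insert v {u \<in> ?R. {v, u} \<in> E}"
    by (auto simp: closed_adj_def)
  then have "card {u \<in> ?R. closed_adj E v u} \<le> card (insert v {u \<in> ?R. {v, u} \<in> E})"
    by (intro card_mono) auto
  also have "\<dots> \<le> degeneracy {..<n} E + 1" using low_degree(2) by (simp add: card_insert_if)
  finally show ?thesis using preimage by (auto simp: degree_from_order_adj[OF injective])
qed

definition degeneracy_order :: "nat \<Rightarrow> nat set set \<Rightarrow> nat \<Rightarrow> nat \<Rightarrow> (nat \<Rightarrow> nat) \<Rightarrow> bool" where
  "degeneracy_order n E j d \<pi> \<longleftrightarrow> bij_betw \<pi> {..<n} {..<n} \<and> d \<le> degeneracy {..<n} E \<and> d \<le> n \<and>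
     (\<forall>q<j. degree_from (order_adj E \<pi>) n (Suc q) q \<le> d)"

lemma degeneracy_order_Suc:
  assumes graph: "simple_graph {..<n} E" and order: "degeneracy_order n E p d \<pi>" and selected: "p \<le> s" "s < n"
    and minimal: "\<forall>q\<in>{p..<n}. degree_from (order_adj E \<pi>) n p s \<le> degree_from (order_adj E \<pi>) n p q"
  shows "degeneracy_order n E (Suc p) (max d (degree_from (order_adj E \<pi>) n p s - 1)) (\<pi> \<circ> transpose p s)"
proof -
  let ?a = "order_adj E \<pi>" and ?a' = "order_adj E (\<pi> \<circ> transpose p s)"
  have bijective: "bij_betw \<pi> {..<n} {..<n}" using order by (simp add: degeneracy_order_def)
  have "degree_from ?a' n p p = degree_from ?a n p s"
    using selected by (simp add: order_adj_transpose degree_from_transpose)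
  then have new_degree: "degree_from ?a' n (Suc p) p = degree_from ?a n p s - 1"
    using degree_from_self[of ?a' p n] selected by (simp add: order_adj_def closed_adj_refl)
  have old_degrees: "degree_from ?a' n (Suc q) q = degree_from ?a n (Suc q) q" if "q < p" for q
    using selected that by (simp add: order_adj_transpose degree_from_transpose)
  obtain q where "q \<in> {p..<n}" "degree_from ?a n p q \<le> degeneracy {..<n} E + 1"
    using ex_degree_from_le_degeneracy[OF graph bijective, of p] selected by auto
  then have "degree_from ?a n p s - 1 \<le> degeneracy {..<n} E" using minimal by fastforce
  moreover have "degree_from ?a n p s - 1 \<le> n" using degree_from_le[of ?a n p s] by simp
  moreover have "bij_betw (\<pi> \<circ> transpose p s) {..<n} {..<n}"
    using bijective selected by (intro bij_betw_trans[OF _ bijective]) simp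
  ultimately show ?thesis
    using order new_degree old_degrees by (auto simp: degeneracy_order_def less_Suc_eq le_max_iff_disj)
qed

subsection \<open>Computing a degeneracy order\<close>

context memory_layout
begin

lemma vc_Try_Min:
  assumes graph: "holds_graph r m" and regs: "r outer_reg = p" "r middle_reg = j" "p \<le> n" "j < n"
  shows "vc L Try_Min (\<lambda>u (r', m'). u \<le> 20 * (n + 1) + 10 \<and> m' = m \<and>
    (if degree_from a n p j < r min_reg then r' min_reg = degree_from a n p j \<and> r' argmin_reg = j
     else r' min_reg = r min_reg \<and> r' argmin_reg = r argmin_reg)) (r, m)" (is "vc L _ ?post (r, m)")
  unfolding Try_Min_def
proof (rule vc_seqs[OF vc_Count_Adjacent[OF graph]])
  fix u r1 m1
  assume "u \<le> 20 * (n + 1) \<and> m1 = m \<and> r1 count_reg = degree_from a n (r outer_reg) (r middle_reg)"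
    and "unchanged (writes (Count_Adjacent middle_reg outer_reg)) r r1"
  moreover from this have "r1 middle_reg = j" "r1 min_reg = r min_reg" "r1 argmin_reg = r argmin_reg"
    using regs by (simp_all add: unchanged_def)
  ultimately show "vc L (seqs [Sub cell_reg min_reg count_reg,
      If cell_reg (seqs [Move min_reg count_reg, Move argmin_reg middle_reg]) Skip])
    (\<lambda>u'. ?post (u + u')) (r1, m1)"
    using regs by auto
qed (use regs in auto)

lemma vc_Select_Min:
  assumes graph: "holds_graph r m" and position: "r outer_reg = p" "p < n"
  shows "vc L Select_Min (\<lambda>u (r', m'). u \<le> 50 * (n + 1) ^ 2 \<and> m' = m \<and>
    r' argmin_reg \<in> {p..<n} \<and> r' min_reg = degree_from a n p (r' argmin_reg) \<and>
    (\<forall>q\<in>{p..<n}. r' min_reg \<le> degree_from a n p q)) (r, m)"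
proof -
  let ?deg = "degree_from a n p" and ?r = "r(min_reg := n + 1, tmp_reg := 0, middle_reg := p)"
  define I where "I j r' \<longleftrightarrow> (j = p \<and> r' min_reg = n + 1 \<or>
      r' argmin_reg \<in> {p..<j} \<and> r' min_reg = ?deg (r' argmin_reg)) \<and>
    (\<forall>q\<in>{p..<j}. r' min_reg \<le> ?deg q)" for j and r' :: "nat \<Rightarrow> nat"
  have size: "r n_reg = n" using graph by (simp add: holds_graph_def)
  have I_Suc: "I (Suc j) r''" if "I j r'" "p \<le> j"
    "if ?deg j < r' min_reg then r'' min_reg = ?deg j \<and> r'' argmin_reg = j
     else r'' min_reg = r' min_reg \<and> r'' argmin_reg = r' argmin_reg" for j r' r''
  proof -
    have "r'' min_reg \<le> r' min_reg" "r'' min_reg \<le> ?deg j" using that(3) by (auto split: if_splits)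
    moreover have "\<forall>q\<in>{p..<j}. r' min_reg \<le> ?deg q" using that(1) by (simp add: I_def)
    ultimately have "\<forall>q\<in>{p..<Suc j}. r'' min_reg \<le> ?deg q"
      by (auto simp: less_Suc_eq intro: order.trans)
    moreover have "?deg j < r' min_reg" if "j = p"
      using \<open>I j r'\<close> that degree_from_le[of a n p j] by (auto simp: I_def)
    ultimately show ?thesis using that by (auto simp: I_def split: if_splits)
  qed
  show ?thesis
    unfolding Select_Min_def
  proof (use size position in simp, rule vc_consequence[OF vc_For[where r="?r" and
        I="\<lambda>j r' m'. I j r' \<and> m' = m" and \<tau>="20 * (n + 1) + 10"]])
    fix j r' m'
    assume in_loop: "?r middle_reg \<le> j" "j < ?r n_reg" "r' middle_reg = j" and invariant: "I j r' \<and> m' = m"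
      and same: "unchanged ({middle_reg, Suc middle_reg} \<union> writes Try_Min) ?r r'"
    have "vc L Try_Min (\<lambda>u (r'', m''). u \<le> 20 * (n + 1) + 10 \<and> m'' = m' \<and>
        (if ?deg j < r' min_reg then r'' min_reg = ?deg j \<and> r'' argmin_reg = j
         else r'' min_reg = r' min_reg \<and> r'' argmin_reg = r' argmin_reg)) (r', m')"
      using graph in_loop invariant same size position
      by (intro vc_Try_Min) (simp_all add: holds_graph_def unchanged_def)
    then show "vc L Try_Min (\<lambda>u (r'', m''). u \<le> 20 * (n + 1) + 10 \<and> I (Suc j) r'' \<and> m'' = m) (r', m')"
      by (rule vc_mono) (use invariant in_loop(1) I_Suc[of j r'] in auto)
  qed (use size position const_less in \<open>auto simp: I_def power2_eq_square algebra_simps\<close>)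
qed

end

lemma row_major_inj:
  fixes n :: nat
  assumes "j < n" "q < n" "n * i + j = n * p + q"
  shows "i = p \<and> j = q"
proof -
  have "(n * i + j) div n = i" "(n * p + q) div n = p" "(n * i + j) mod n = j" "(n * p + q) mod n = q"
    using assms(1,2) by auto
  then show ?thesis using assms(3) by metis
qed

lemma row_major_less:
  fixes n :: nat
  assumes "i < n" "j < n"
  shows "n * i + j < n * n"
proof -
  have "n * i + j < n * Suc i" using assms by simp
  also have "\<dots> \<le> n * n" using assms by (intro mult_le_mono2) simp
  finally show ?thesis .
qed

locale graph_instance =
  fixes n L rows order heap :: nat and E :: "nat set set"
  assumes graph: "simple_graph {..<n} E" and n_pos: "0 < n"
    and rows: "rows = 2 + n * n" and order: "order = rows + n" and heap: "heap = order + n"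
    and heap_less: "heap < 2 ^ L"
begin

sublocale layout: memory_layout n "order_adj E \<pi>" L rows order heap for \<pi>
proof
  have "n \<le> n * n" by (cases n) auto
  then show "n + 3 \<le> heap" using n_pos unfolding heap order rows by linarith
qed (use heap_less in \<open>auto simp: heap order\<close>)

lemma entry_less: "i < n \<Longrightarrow> j < n \<Longrightarrow> 2 + n * i + j < rows"
  using row_major_less[of i n j] by (simp add: rows)

definition holds_order :: "(nat \<Rightarrow> nat) \<Rightarrow> (nat \<Rightarrow> nat) \<Rightarrow> bool" where
  "holds_order m \<pi> \<longleftrightarrow> (\<forall>p<n. m (rows + p) = 2 + n * \<pi> p \<and> m (order + p) = \<pi> p) \<and>
    (\<forall>i<n. \<forall>j<n. m (2 + n * i + j) = of_bool (closed_adj E i j)) \<and> (\<forall>x\<ge>heap. m x = 0)"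

lemma holds_graph_order:
  assumes "holds_order m \<pi>" "degeneracy_order n E p d \<pi>"
    and "r n_reg = n" "r rows_reg = rows" "r order_reg = order"
  shows "layout.holds_graph \<pi> r m"
proof -
  have "\<pi> p < n" if "p < n" for p
    using assms(2) that by (auto simp: degeneracy_order_def bij_betw_def)
  moreover from this have "2 + n * \<pi> p + \<pi> q < heap" if "p < n" "q < n" for p q
    using entry_less[of "\<pi> p" "\<pi> q"] that by (simp add: heap order)
  ultimately show ?thesis
    using assms(1,3-5) by (simp add: layout.holds_graph_def layout.adjacency_def holds_order_def order_adj_def)
qed

lemma holds_order_swap:
  assumes "holds_order m \<pi>" and positions: "p < n" "s < n"
  shows "holds_order (m(rows + p := m (rows + s), rows + s := m (rows + p),
      order + p := m (order + s), order + s := m (order + p))) (\<pi> \<circ> transpose p s)" (is "holds_order ?m _")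
proof -
  have tables: "m (rows + j) = 2 + n * \<pi> j" "m (order + j) = \<pi> j" if "j < n" for j
    using assms(1) that by (simp_all add: holds_order_def)
  have matrix: "m (2 + n * i + j) = of_bool (closed_adj E i j)" if "i < n" "j < n" for i j
    using assms(1) that by (simp add: holds_order_def)
  have zero: "m x = 0" if "heap \<le> x" for x using assms(1) that by (simp add: holds_order_def)
  have "?m (rows + j) = 2 + n * (\<pi> \<circ> transpose p s) j \<and> ?m (order + j) = (\<pi> \<circ> transpose p s) j" if "j < n" for j
    using tables positions that by (auto simp: order transpose_def)
  moreover have "?m (2 + n * i + j) = of_bool (closed_adj E i j)" if "i < n" "j < n" for i j
    using matrix[OF that] entry_less[OF that] by (simp add: order)
  moreover have "?m x = 0" if "heap \<le> x" for x
    using zero[OF that] positions that by (simp add: order heap)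
  ultimately show ?thesis unfolding holds_order_def by blast
qed

lemma vc_Select:
  assumes regs: "r n_reg = n" "r rows_reg = rows" "r order_reg = order" "r outer_reg = p" "p < n"
    and memory: "holds_order m \<pi>" and ordered: "degeneracy_order n E p (r degree_reg) \<pi>"
  shows "vc L Select (\<lambda>u (r', m'). u \<le> 100 * (n + 1) ^ 2 \<and>
    (\<exists>\<pi>'. holds_order m' \<pi>' \<and> degeneracy_order n E (Suc p) (r' degree_reg) \<pi>')) (r, m)"
    (is "vc L _ ?post (r, m)")
  unfolding Select_def
proof (rule vc_seqs[OF layout.vc_Select_Min[OF holds_graph_order[OF memory ordered]]])
  fix u m1 and r1 :: "nat \<Rightarrow> nat"
  let ?deg = "degree_from (order_adj E \<pi>) n p" and ?s = "r1 argmin_reg"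
  assume minimum: "u \<le> 50 * (n + 1) ^ 2 \<and> m1 = m \<and> ?s \<in> {p..<n} \<and> r1 min_reg = ?deg ?s \<and>
      (\<forall>q\<in>{p..<n}. r1 min_reg \<le> ?deg q)"
    and same: "unchanged (writes Select_Min) r r1"
  have registers: "r1 rows_reg = rows" "r1 order_reg = order" "r1 outer_reg = p" "r1 degree_reg = r degree_reg"
    using same regs by (simp_all add: unchanged_def)
  have in_range: "rows + j < 2 ^ L" "order + j < 2 ^ L" if "j < n" for j
    using heap_less that by (simp_all add: heap order)
  let ?d = "max (r degree_reg) (?deg ?s - 1)"
  let ?m = "m(rows + p := m (rows + ?s), rows + ?s := m (rows + p),
    order + p := m (order + ?s), order + ?s := m (order + p))"
  have "degeneracy_order n E (Suc p) ?d (\<pi> \<circ> transpose p ?s)"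
    using graph ordered minimum by (intro degeneracy_order_Suc) auto
  moreover have "holds_order ?m (\<pi> \<circ> transpose p ?s)"
    using memory regs(5) minimum by (intro holds_order_swap) auto
  moreover from calculation have "?d \<le> n" by (simp add: degeneracy_order_def)
  then have "?d < 2 ^ L" using layout.const_less(4) by (rule order.strict_trans1)
  moreover have "r degree_reg + (?deg ?s - 1 - r degree_reg) = ?d" by simp
  moreover have "n + 1 \<le> (n + 1) ^ 2" by (simp add: power2_eq_square)
  ultimately show "vc L (seqs [Swap rows_reg outer_reg argmin_reg, Swap order_reg outer_reg argmin_reg,
      Sub_Const min_reg min_reg 1, Sub cell_reg min_reg degree_reg, Add degree_reg degree_reg cell_reg])
    (\<lambda>u'. ?post (u + u')) (r1, m1)"
    using minimum registers in_range regs(5) by (auto simp: Swap_def order)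
qed (use regs in simp_all)

lemma vc_Find_Order:
  assumes regs: "r n_reg = n" "r rows_reg = rows" "r order_reg = order" and memory: "holds_order m id"
  shows "vc L Find_Order (\<lambda>u (r', m'). u \<le> 200 * (n + 1) ^ 3 \<and>
    (\<exists>\<pi>. holds_order m' \<pi> \<and> degeneracy_order n E n (r' degree_reg) \<pi>)) (r, m)"
proof -
  let ?r = "r(degree_reg := 0, outer_reg := 0)"
  have init: "degeneracy_order n E 0 0 id" by (simp add: degeneracy_order_def)
  have time: "n * (100 * (n + 1) ^ 2 + 5) + 5 \<le> 200 * (n + 1) ^ 3"
    by (simp add: power2_eq_square power3_eq_cube algebra_simps)
  show ?thesis
    unfolding Find_Order_def
  proof (simp, rule vc_consequence[OF vc_For[where r="?r" and \<tau>="100 * (n + 1) ^ 2" and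
        I="\<lambda>j r' m'. \<exists>\<pi>. holds_order m' \<pi> \<and> degeneracy_order n E j (r' degree_reg) \<pi>"]])
    fix j r' m'
    assume in_loop: "j < ?r n_reg" "r' outer_reg = j"
      and "\<exists>\<pi>. holds_order m' \<pi> \<and> degeneracy_order n E j (r' degree_reg) \<pi>"
      and same: "unchanged ({outer_reg, Suc outer_reg} \<union> writes Select) ?r r'"
    then obtain \<pi> where ordered: "holds_order m' \<pi>" "degeneracy_order n E j (r' degree_reg) \<pi>" by blast
    show "vc L Select (\<lambda>u (r'', m''). u \<le> 100 * (n + 1) ^ 2 \<and>
        (\<exists>\<pi>. holds_order m'' \<pi> \<and> degeneracy_order n E (Suc j) (r'' degree_reg) \<pi>)) (r', m')"
      by (rule vc_Select[OF _ _ _ in_loop(2) _ ordered])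
        (use in_loop(1) same regs in \<open>simp_all add: unchanged_def\<close>)
  qed (use memory regs init time in auto)
qed

definition tables_upto :: "nat \<Rightarrow> (nat \<Rightarrow> nat) \<Rightarrow> bool" where
  "tables_upto p m \<longleftrightarrow> (\<forall>j<p. m (rows + j) = 2 + n * j \<and> m (order + j) = j) \<and>
    (\<forall>i<n. \<forall>j<n. m (2 + n * i + j) = of_bool (i = j \<and> i < p \<or> {i, j} \<in> E)) \<and> (\<forall>x\<ge>heap. m x = 0)"

lemma tables_upto_Suc:
  assumes memory: "tables_upto p m" and position: "p < n"
  shows "tables_upto (Suc p) (m(rows + p := 2 + n * p, order + p := p, 2 + n * p + p := 1))"
    (is "tables_upto _ ?m")
proof -
  have diagonal: "2 + n * p + p < rows" using position position by (rule entry_less)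
  have tables: "m (rows + j) = 2 + n * j" "m (order + j) = j" if "j < p" for j
    using memory that by (simp_all add: tables_upto_def)
  have matrix: "m (2 + n * i + j) = of_bool (i = j \<and> i < p \<or> {i, j} \<in> E)" if "i < n" "j < n" for i j
    using memory that by (simp add: tables_upto_def)
  have zero: "m x = 0" if "heap \<le> x" for x using memory that by (simp add: tables_upto_def)
  have "?m (rows + j) = 2 + n * j \<and> ?m (order + j) = j" if "j < Suc p" for j
    using tables[of j] that position diagonal by (auto simp: less_Suc_eq order)
  moreover have "?m (2 + n * i + j) = of_bool (i = j \<and> i < Suc p \<or> {i, j} \<in> E)" if "i < n" "j < n" for i j
  proof (cases "i = p \<and> j = p")
    case False
    then have "2 + n * i + j \<noteq> 2 + n * p + p" using row_major_inj[OF that(2) position, of i p] by auto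
    then have "?m (2 + n * i + j) = m (2 + n * i + j)"
      using entry_less[OF that] by (auto simp: order)
    also have "\<dots> = of_bool (i = j \<and> i < p \<or> {i, j} \<in> E)" using that by (rule matrix)
    finally show ?thesis using False by (auto simp: less_Suc_eq)
  qed simp
  moreover have "?m x = 0" if "heap \<le> x" for x
    using zero[OF that] that position diagonal by (auto simp: heap order)
  ultimately show ?thesis unfolding tables_upto_def by blast
qed

lemma holds_order_id: "tables_upto n m \<Longrightarrow> holds_order m id"
  by (auto simp: tables_upto_def holds_order_def closed_adj_def)

lemma vc_Build_Tables_loop:
  assumes regs: "r n_reg = n" "r rows_reg = rows" "r order_reg = order" "r addr_reg = 2" "r middle_reg = 0"
    and memory: "tables_upto 0 m"
  shows "vc L (For middle_reg n_reg Set_Row) (\<lambda>u (r', m'). u \<le> 20 * (n + 1) \<and> holds_order m' id) (r, m)"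
proof (rule vc_consequence[OF vc_For[where \<tau>=10 and
      I="\<lambda>p r' m'. r' addr_reg = 2 + n * p \<and> tables_upto p m'"]])
  fix p r' m'
  assume in_loop: "p < r n_reg" "r' middle_reg = p" and invariant: "r' addr_reg = 2 + n * p \<and> tables_upto p m'"
    and same: "unchanged ({middle_reg, Suc middle_reg} \<union> writes Set_Row) r r'"
  have "n * Suc p \<le> n * n" using in_loop(1) regs(1) by (intro mult_le_mono2) simp
  then have "2 + n * p + n < 2 ^ L" "rows + p < 2 ^ L" "order + p < 2 ^ L"
    using heap_less in_loop(1) regs(1) by (simp_all add: heap order rows)
  moreover have "r' n_reg = n" "r' rows_reg = rows" "r' order_reg = order"
    using same regs by (simp_all add: unchanged_def)
  ultimately show "vc L Set_Row (\<lambda>u (r'', m''). u \<le> 10 \<and> r'' addr_reg = 2 + n * Suc p \<and>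
      tables_upto (Suc p) m'') (r', m')"
    using in_loop invariant regs(1) tables_upto_Suc[of p m'] layout.const_less(1) by (auto simp: Set_Row_def)
qed (use regs memory holds_order_id in auto)

lemma vc_Build_Tables:
  assumes size: "r n_reg = n"
    and memory: "\<forall>i<n. \<forall>j<n. m (2 + n * i + j) = of_bool ({i, j} \<in> E)" "\<forall>x\<ge>2 + n * n. m x = 0"
  shows "vc L Build_Tables (\<lambda>u (r', m'). u \<le> 40 * (n + 1) \<and> r' rows_reg = rows \<and> r' order_reg = order \<and>
    holds_order m' id) (r, m)" (is "vc L _ ?post (r, m)")
  unfolding Build_Tables_def
proof (rule vc_seqs[OF vc_Multiply])
  have less: "n * n + 2 < 2 ^ L" "rows + n < 2 ^ L" using heap_less by (simp_all add: heap order rows)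
  then show "r n_reg * r n_reg < 2 ^ L" using size by simp
  fix u r1 m1
  assume product: "u \<le> 10 * (r n_reg + 1) \<and> m1 = m \<and> r1 rows_reg = r n_reg * r n_reg"
    and same: "unchanged (writes (Multiply rows_reg n_reg n_reg)) r r1"
  let ?r = "r1(tmp_reg := 2, rows_reg := rows, order_reg := order, addr_reg := 2, middle_reg := 0)"
  have "tables_upto 0 m" unfolding tables_upto_def using memory by (simp add: heap order rows)
  then have "vc L (For middle_reg n_reg Set_Row) (\<lambda>u (r', m'). u \<le> 20 * (n + 1) \<and> holds_order m' id) (?r, m)"
    using same size by (intro vc_Build_Tables_loop) (simp_all add: unchanged_def)
  then have "vc L (For middle_reg n_reg Set_Row) (\<lambda>u' (r', m'). u + (u' + 10) \<le> 40 * (n + 1) \<and>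
      r' rows_reg = rows \<and> r' order_reg = order \<and> holds_order m' id) (?r, m)"
    by (rule vc_consequence) (use product size in \<open>auto simp: unchanged_def\<close>)
  moreover have "r1 n_reg = n" "r1 rows_reg = n * n" using product same size by (simp_all add: unchanged_def)
  ultimately show "vc L (seqs [Add_Const rows_reg rows_reg 2, Add order_reg rows_reg n_reg, Const addr_reg 2,
      Const middle_reg 0, For middle_reg n_reg Set_Row]) (\<lambda>u'. ?post (u + u')) (r1, m1)"
    using product less by (auto simp: rows order elim!: vc_mono)
qed (use size in auto)

end

subsection \<open>Solving an instance\<close>

lemma exploration_bounds:
  fixes n d K heap L :: nat
  defines "W \<equiv> (n + 1) * 3 ^ (d * K)"
  assumes "heap + (n + 1) ^ (K + 1) * ((n + 3) * W) < 2 ^ L"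
  shows "heap + (n + 3) * W < 2 ^ L" "n ^ K * W < 2 ^ L" "(n + 1) ^ (K + 1) < 2 ^ L"
    "heap + (n + 3) < 2 ^ L" "d * K < 2 ^ L"
proof -
  define C where "C = (n + 1) ^ (K + 1)"
  have "d * K < 3 ^ (d * K)" by (rule order.strict_trans2[OF less_exp]) (simp add: power_mono)
  moreover have "1 * 3 ^ (d * K) \<le> W" unfolding W_def by (intro mult_le_mono1) simp
  ultimately have weight_bounds: "1 \<le> W" "d * K \<le> W" by auto
  have "n ^ K \<le> (n + 1) ^ K" by (rule power_mono) auto
  also have "\<dots> \<le> C" unfolding C_def by (rule power_increasing) auto
  finally have count_bounds: "n ^ K \<le> C" "1 \<le> C" by (auto simp: C_def)
  have block: "W \<le> (n + 3) * W" "n + 3 \<le> (n + 3) * W" using weight_bounds(1) by simp_all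
  moreover have "1 * ((n + 3) * W) \<le> C * ((n + 3) * W)" using count_bounds(2) by (rule mult_le_mono1)
  moreover have "n ^ K * W \<le> C * ((n + 3) * W)" using count_bounds(1) block(1) by (rule mult_le_mono)
  moreover have "C * 1 \<le> C * ((n + 3) * W)" using weight_bounds(1) block(1) by (intro mult_le_mono2) linarith
  ultimately show "heap + (n + 3) * W < 2 ^ L" "n ^ K * W < 2 ^ L" "(n + 1) ^ (K + 1) < 2 ^ L"
    "heap + (n + 3) < 2 ^ L" "d * K < 2 ^ L"
    using assms(2) weight_bounds(2) unfolding C_def[symmetric] by linarith+
qed

lemma exploration_time:
  fixes n d K u u' :: nat
  assumes "u \<le> 10 * (K + 1) + 30" "K \<le> n" "u' \<le> (n + 1) * 3 ^ (d * K) * (300 * (n + 1) ^ 2 + 1) + 1"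
  shows "u + (u' + 2) \<le> 400 * ((n + 1) ^ 3 * 3 ^ (d * K))"
proof -
  define X where "X = (n + 1) ^ 3 * 3 ^ (d * K)"
  have "(n + 1) * (300 * (n + 1) ^ 2 + 1) \<le> 301 * (n + 1) ^ 3"
    by (simp add: power3_eq_cube power2_eq_square algebra_simps)
  then have "(n + 1) * (300 * (n + 1) ^ 2 + 1) * 3 ^ (d * K) \<le> 301 * (n + 1) ^ 3 * 3 ^ (d * K)"
    by (rule mult_le_mono1)
  then have "(n + 1) * 3 ^ (d * K) * (300 * (n + 1) ^ 2 + 1) \<le> 301 * X"
    unfolding X_def by (simp only: ac_simps)
  with assms(3) have "u' \<le> 301 * X + 1" by simp
  moreover have "(n + 1) * 1 \<le> X"
    unfolding X_def by (rule mult_le_mono) (simp_all add: power3_eq_cube)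
  ultimately show ?thesis using assms(1,2) unfolding X_def[symmetric] by simp
qed

context machine
begin

lemma vc_Init_Queue:
  assumes graph: "holds_graph r m" and regs: "r k_reg = K" "r degree_reg = d"
    and heap: "heap = order + n" "heap + (n + 3) < 2 ^ L" and bounds: "K < 2 ^ L" "d * K < 2 ^ L"
    and zero: "\<forall>x\<ge>heap. m x = 0"
  shows "vc L Init_Queue (\<lambda>u (r', m'). u \<le> 10 * (K + 1) + 30 \<and> queue r' m' [(0, K, d * K, {}, {})] \<and>
    r' head_reg = heap \<and> r' queue_reg = n + 3 \<and> r' plus_reg = 0 \<and> r' minus_reg = 0) (r, m)"
    (is "vc L _ ?post (r, m)")
  unfolding Init_Queue_def
proof (rule vc_seqs[OF vc_Multiply])
  fix u r1 m1
  assume product: "u \<le> 10 * (r k_reg + 1) \<and> m1 = m \<and> r1 cell_reg = r degree_reg * r k_reg"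
    and same: "unchanged (writes (Multiply cell_reg degree_reg k_reg)) r r1"
  let ?m = "m(heap + n + 1 := K, heap + n + 1 + 1 := d * K)"
  have registers: "r1 n_reg = n" "r1 rows_reg = rows" "r1 order_reg = order" "r1 k_reg = K" "r1 degree_reg = d"
    "r1 cell_reg = d * K" "holds_graph r1 m"
    using graph product same regs by (simp_all add: holds_graph_def unchanged_def)
  have "stored ?m heap (0, K, d * K, {}, {})" using zero by (simp add: stored.simps)
  moreover have "holds_graph r' ?m" if "holds_graph r' m" for r'
    by (rule holds_graph_cong[OF that, of "{}"]) simp_all
  ultimately show "vc L (seqs [Add_Const block_reg n_reg 3, Add head_reg order_reg n_reg,
      Add addr_reg head_reg n_reg, Add_Const addr_reg addr_reg 1, Store addr_reg k_reg,
      Add_Const addr_reg addr_reg 1, Store addr_reg cell_reg, Add tail_reg head_reg block_reg,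
      Move queue_reg block_reg, Const plus_reg 0, Const minus_reg 0]) (\<lambda>u'. ?post (u + u')) (r1, m1)"
    using product regs registers heap(2) heap(1)[symmetric] by (simp add: queue_def)
qed (use regs bounds in auto)

lemma vc_Explore:
  assumes graph: "holds_graph r m" and regs: "r k_reg = K" "r degree_reg = d" and picks: "0 < n" "K \<le> n"
    and heap: "heap = order + n" and zero: "\<forall>x\<ge>heap. m x = 0"
    and room: "heap + (n + 1) ^ (K + 1) * ((n + 3) * ((n + 1) * 3 ^ (d * K))) < 2 ^ L"
  shows "vc L (seqs [Init_Queue, While queue_reg Step, Sub answer_reg plus_reg minus_reg])
    (\<lambda>u (r', m'). u \<le> 400 * ((n + 1) ^ 3 * 3 ^ (d * K)) \<and>
      (r' answer_reg \<noteq> 0 \<longleftrightarrow> (\<exists>T\<subseteq>{..<n}. card T \<le> K \<and> dominates a T {..<n}))) (r, m)"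
    (is "vc L _ ?post (r, m)")
proof (rule vc_seqs[OF vc_Init_Queue[OF graph regs heap _ _ _ zero]])
  note bounds = exploration_bounds[OF room]
  show "heap + (n + 3) < 2 ^ L" "K < 2 ^ L" "d * K < 2 ^ L"
    using bounds(1,4,5) picks(2) const_less(4) by (auto intro: order.strict_trans1)
  let ?s = "(0, K, d * K, {}, {}) :: state" and ?W = "(n + 1) * 3 ^ (d * K) :: nat"
  have weight: "weight ?s = ?W" by (simp add: weight_def)
  fix u :: nat and r1 m1
  assume init: "u \<le> 10 * (K + 1) + 30 \<and> queue r1 m1 [?s] \<and> r1 head_reg = heap \<and> r1 queue_reg = n + 3 \<and>
    r1 plus_reg = 0 \<and> r1 minus_reg = 0"
  have "exploring K (state_value ?s) [?s] r1 m1"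
    using init bounds(1,2) weight by (auto simp: exploring_def admissible_def)
  then have main: "vc L (While queue_reg Step) (\<lambda>u (r', m'). u \<le> ?W * (300 * (n + 1) ^ 2 + 1) + 1 \<and>
      int (r' plus_reg) - int (r' minus_reg) = state_value ?s) (r1, m1)"
    using vc_While_Step[of K "state_value ?s" "[?s]"] picks(2) bounds(3) weight by simp
  have answer: "0 < state_value ?s \<longleftrightarrow> (\<exists>T\<subseteq>{..<n}. card T \<le> K \<and> dominates a T {..<n})"
    using signed_count_pos_iff[OF picks(1)] by (simp add: state_value_def)
  have time: "u + (u' + 2) \<le> 400 * ((n + 1) ^ 3 * 3 ^ (d * K))"
    if "u' \<le> ?W * (300 * (n + 1) ^ 2 + 1) + 1" for u'
    using exploration_time[of u K n u' d] init picks(2) that by simp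
  show "vc L (seqs [While queue_reg Step, Sub answer_reg plus_reg minus_reg]) (\<lambda>u'. ?post (u + u')) (r1, m1)"
  proof (rule vc_seqs[OF main])
    fix u' r2 m2
    assume explored: "u' \<le> ?W * (300 * (n + 1) ^ 2 + 1) + 1 \<and>
        int (r2 plus_reg) - int (r2 minus_reg) = state_value ?s"
    then have "r2 minus_reg < r2 plus_reg \<longleftrightarrow> 0 < state_value ?s" by linarith
    then show "vc L (seqs [Sub answer_reg plus_reg minus_reg]) (\<lambda>u''. ?post (u + (u' + u''))) (r2, m2)"
      using explored time[of u'] answer by simp
  qed
qed

end

lemma solving_time:
  fixes n e e' u u1 u2 :: nat
  assumes "u1 \<le> 40 * (n + 1)" "u2 \<le> 200 * (n + 1) ^ 3" "u \<le> 400 * ((n + 1) ^ 3 * 3 ^ e)" "e \<le> e'"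
  shows "u1 + (u2 + u) \<le> 700 * ((n + 1) ^ 3 * 3 ^ e')"
proof -
  define X where "X = (n + 1) ^ 3 * 3 ^ e'"
  have "(n + 1) ^ 3 * 3 ^ e \<le> X"
    unfolding X_def using assms(4) by (intro mult_le_mono2 power_increasing) auto
  then have "u \<le> 400 * X" using assms(3) by linarith
  moreover have cube: "(n + 1) ^ 3 * 1 \<le> X" unfolding X_def by (intro mult_le_mono2) simp
  then have "u2 \<le> 200 * X" using assms(2) by simp
  moreover have "n + 1 \<le> (n + 1) ^ 3" by (rule self_le_power) auto
  then have "n + 1 \<le> X" using cube by simp
  then have "40 * (n + 1) \<le> 40 * X" by (rule mult_le_mono2)
  then have "u1 \<le> 40 * X" using assms(1) by (rule order.trans[rotated])
  ultimately show ?thesis unfolding X_def by linarith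
qed

context graph_instance
begin

lemma machine_order:
  assumes "degeneracy_order n E n d \<pi>"
  shows "machine n d (order_adj E \<pi>) L rows order heap"
proof (intro machine.intro ordered_graph.intro layout.memory_layout_axioms)
  show "order_adj E \<pi> v u" if "order_adj E \<pi> u v" for u v
    using that by (simp add: order_adj_def closed_adj_sym)
qed (use assms in \<open>auto simp: order_adj_def closed_adj_refl degeneracy_order_def\<close>)

lemma vc_Solve:
  assumes regs: "r k_reg = K" "r n_reg = n" and picks: "K < n"
    and memory: "\<forall>i<n. \<forall>j<n. m (2 + n * i + j) = of_bool ({i, j} \<in> E)" "\<forall>x\<ge>2 + n * n. m x = 0"
    and room: "heap + (n + 1) ^ (n + 1) * ((n + 3) * ((n + 1) * 3 ^ (n * n))) < 2 ^ L"
  shows "vc L Solve (\<lambda>u (r', m'). u \<le> 700 * ((n + 1) ^ 3 * 3 ^ (degeneracy {..<n} E * K)) \<and>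
    (r' answer_reg \<noteq> 0 \<longleftrightarrow> Dominating_Set {..<n} E K)) (r, m)" (is "vc L _ ?post (r, m)")
  unfolding Solve_def
proof (rule vc_seqs[OF vc_Build_Tables[where r=r and m=m, OF regs(2) memory]])
  fix u1 r1 m1
  assume tables: "u1 \<le> 40 * (n + 1) \<and> r1 rows_reg = rows \<and> r1 order_reg = order \<and> holds_order m1 id"
    and table_same: "unchanged (writes Build_Tables) r r1"
  have table_registers: "r1 n_reg = n" "r1 k_reg = K" using table_same regs by (simp_all add: unchanged_def)
  show "vc L (seqs [Find_Order, Init_Queue, While queue_reg Step, Sub answer_reg plus_reg minus_reg])
      (\<lambda>u. ?post (u1 + u)) (r1, m1)"
  proof (rule vc_seqs[OF vc_Find_Order])
    fix u2 m2 and r2 :: "nat \<Rightarrow> nat"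
    let ?D = "degeneracy {..<n} E" and ?d = "r2 degree_reg"
    assume ordered: "u2 \<le> 200 * (n + 1) ^ 3 \<and> (\<exists>\<pi>. holds_order m2 \<pi> \<and> degeneracy_order n E n ?d \<pi>)"
      and order_same: "unchanged (writes Find_Order) r1 r2"
    then obtain \<pi> where ordering: "holds_order m2 \<pi>" "degeneracy_order n E n ?d \<pi>" by blast
    have degree: "?d \<le> n" "?d * K \<le> ?D * K" and bijective: "bij_betw \<pi> {..<n} {..<n}"
      using ordering(2) by (auto simp: degeneracy_order_def)
    have "(n + 1) ^ (K + 1) * ((n + 3) * ((n + 1) * 3 ^ (?d * K)))
        \<le> (n + 1) ^ (n + 1) * ((n + 3) * ((n + 1) * 3 ^ (n * n)))"
      using degree(1) picks by (intro mult_le_mono power_increasing) auto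
    then have room': "heap + (n + 1) ^ (K + 1) * ((n + 3) * ((n + 1) * 3 ^ (?d * K))) < 2 ^ L"
      using room by linarith
    have order_registers: "r2 n_reg = n" "r2 rows_reg = rows" "r2 order_reg = order" "r2 k_reg = K"
      using order_same table_registers tables by (simp_all add: unchanged_def)
    have "vc L (seqs [Init_Queue, While queue_reg Step, Sub answer_reg plus_reg minus_reg])
      (\<lambda>u (r', m'). u \<le> 400 * ((n + 1) ^ 3 * 3 ^ (?d * K)) \<and> (r' answer_reg \<noteq> 0 \<longleftrightarrow>
        (\<exists>T\<subseteq>{..<n}. card T \<le> K \<and> dominates (order_adj E \<pi>) T {..<n}))) (r2, m2)"
      using ordering(1) picks
      by (intro machine.vc_Explore[OF machine_order[OF ordering(2)]
            holds_graph_order[OF ordering order_registers(1-3)] order_registers(4) refl n_pos _ heap _ room'])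
        (auto simp: holds_order_def)
    then show "vc L (seqs [Init_Queue, While queue_reg Step, Sub answer_reg plus_reg minus_reg])
        (\<lambda>u. ?post (u1 + (u2 + u))) (r2, m2)"
      unfolding Dominating_Set_iff_order[OF bijective]
      by (rule vc_mono) (use solving_time[OF _ _ _ degree(2)] tables ordered in auto)
  qed (use table_registers tables in auto)
qed

end

lemma length_concat_uniform: "(\<And>x. x \<in> set xs \<Longrightarrow> length (f x) = n) \<Longrightarrow> length (concat (map f xs)) = n * length xs"
  by (induction xs) auto

lemma nth_concat_uniform:
  assumes "\<And>x. x \<in> set xs \<Longrightarrow> length (f x) = n" "i < length xs" "j < n"
  shows "concat (map f xs) ! (n * i + j) = f (xs ! i) ! j"
  using assms
proof (induction xs arbitrary: i)
  case (Cons x xs)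
  then show ?case by (cases i) (auto simp: nth_append)
qed simp

definition input_memory :: "nat \<Rightarrow> nat set set \<Rightarrow> nat \<Rightarrow> nat \<Rightarrow> nat" where
  "input_memory n E k = snd (initial (encode_instance n E k))"

lemma length_encode_instance: "length (encode_instance n E k) = 2 + n * n"
  by (simp add: encode_instance_def length_concat_uniform[where n=n])

lemma input_memory_header: "input_memory n E k 0 = k" "input_memory n E k 1 = n"
  by (simp_all add: input_memory_def initial_def length_encode_instance) (simp_all add: encode_instance_def)

lemma input_memory_entry:
  assumes "i < n" "j < n"
  shows "input_memory n E k (2 + n * i + j) = of_bool ({i, j} \<in> E)"
proof -
  have "input_memory n E k (2 + n * i + j) = encode_instance n E k ! (2 + n * i + j)"
    using row_major_less[OF assms] by (simp add: input_memory_def initial_def length_encode_instance)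
  also have "\<dots> = of_bool ({i, j} \<in> E)"
    using assms nth_concat_uniform[where xs="[0..<n]" and n=n and i=i and j=j
        and f="\<lambda>i. map (\<lambda>j. if {i, j} \<in> E then 1 else 0 :: nat) [0..<n]"]
    by (simp add: encode_instance_def)
  finally show ?thesis .
qed

lemma input_memory_outside: "2 + n * n \<le> x \<Longrightarrow> input_memory n E k x = 0"
  by (simp add: input_memory_def initial_def length_encode_instance)

lemma entry_less_power_input_size:
  assumes "x \<in> set xs"
  shows "x < 2 ^ input_size xs"
proof -
  have "x < 2 ^ len x" by (rule floorlog_leD) auto
  moreover have "1 + len x \<le> input_size xs"
    unfolding input_size_def using assms by (intro member_le_sum_list) auto
  then have "(2::nat) ^ len x \<le> 2 ^ input_size xs" by (intro power_increasing) auto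
  ultimately show ?thesis by (rule order.strict_trans2)
qed

lemma length_le_input_size: "length xs \<le> input_size xs"
  unfolding input_size_def by (induction xs) auto

lemma bounded_initial:
  assumes "input_size xs \<le> L"
  shows "bounded L (initial xs)"
proof -
  have "(2::nat) ^ input_size xs \<le> 2 ^ L" using assms by (intro power_increasing) auto
  then have "x < 2 ^ L" if "x \<in> set xs" for x
    using entry_less_power_input_size[OF that] by (rule order.strict_trans2[rotated])
  then show ?thesis by (simp add: bounded_def initial_def)
qed

lemma decides_in_time_mono: "decides_in_time P xs answer t \<Longrightarrow> t \<le> t' \<Longrightarrow> decides_in_time P xs answer t'"
  unfolding decides_in_time_def by (meson order.trans)

lemma vc_decides_in_time:
  assumes "vc L P (\<lambda>u (r, m). u \<le> T \<and> (r answer_reg \<noteq> 0 \<longleftrightarrow> answer)) (initial xs)" "input_size xs \<le> L"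
  shows "decides_in_time P xs answer (real (T * (2 * L + 1)))"
proof -
  obtain t s u where run: "exec P (initial xs) t s" "t \<le> u * (2 * L + 1)"
    and post: "case s of (r, m) \<Rightarrow> u \<le> T \<and> (r answer_reg \<noteq> 0 \<longleftrightarrow> answer)"
    using vc_sound[OF assms(1)] bounded_initial[OF assms(2)] by (rule wpE)
  have "u * (2 * L + 1) \<le> T * (2 * L + 1)" using post by (intro mult_le_mono1) auto
  then have "real t \<le> real (T * (2 * L + 1))" using run(2) by (simp only: of_nat_le_iff)
  then show ?thesis using run(1) post unfolding decides_in_time_def by auto
qed

definition word_size :: "nat \<Rightarrow> nat" where
  "word_size n = 20 * (n + 2) ^ 2"

lemma instance_room:
  "2 + n * n + n + n + (n + 1) ^ (n + 1) * ((n + 3) * ((n + 1) * 3 ^ (n * n))) < 2 ^ word_size n"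
proof -
  let ?e = "word_size n - 1"
  have Suc_le_exp: "x + 1 \<le> 2 ^ x" for x :: nat using less_exp[of x] by linarith
  have "(3::nat) ^ (n * n) \<le> 4 ^ (n * n)" by (rule power_mono) auto
  also have "(4::nat) ^ (n * n) = 2 ^ (2 * (n * n))" by (simp add: power_mult)
  finally have power_three: "(3::nat) ^ (n * n) \<le> 2 ^ (2 * (n * n))" .
  have "(n + 1) ^ (n + 1) \<le> (2 ^ n) ^ (n + 1)" using Suc_le_exp by (rule power_mono) simp
  then have power: "(n + 1) ^ (n + 1) \<le> 2 ^ (n * (n + 1))" by (simp only: power_mult)
  have "(n + 1) ^ (n + 1) * ((n + 3) * ((n + 1) * 3 ^ (n * n)))
      \<le> 2 ^ (n * (n + 1)) * (2 ^ (n + 2) * (2 ^ n * 2 ^ (2 * (n * n))))"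
    using Suc_le_exp[of "n + 2"] Suc_le_exp[of n] power_three power by (intro mult_le_mono) auto
  also have "\<dots> = 2 ^ (n * (n + 1) + (n + 2 + (n + 2 * (n * n))))" by (simp only: power_add)
  also have "\<dots> \<le> 2 ^ ?e"
    by (intro power_increasing) (auto simp: word_size_def power2_eq_square algebra_simps)
  finally have states: "(n + 1) ^ (n + 1) * ((n + 3) * ((n + 1) * 3 ^ (n * n))) \<le> 2 ^ ?e" .
  have "2 + n * n + n + n \<le> ?e" by (simp add: word_size_def power2_eq_square algebra_simps)
  also have "\<dots> < 2 ^ ?e" by (rule less_exp)
  finally have "2 + n * n + n + n < 2 ^ ?e" .
  moreover have "(2::nat) ^ word_size n = 2 * 2 ^ ?e"
    by (subst power_Suc[symmetric]) (simp add: word_size_def power2_eq_square)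
  ultimately show ?thesis using states by linarith
qed

lemma Dominating_Set_if_size_le: "n \<le> k \<Longrightarrow> Dominating_Set {..<n} E k"
  unfolding Dominating_Set_def dominating_set_def by (intro exI[of _ "{..<n}"]) auto

lemma vc_Decide_Dominating_Set:
  assumes graph: "simple_graph {..<n} E" and wide: "word_size n \<le> L"
  shows "vc L Decide_Dominating_Set (\<lambda>u (r, m).
    u \<le> 710 * ((n + 1) ^ 3 * 3 ^ (degeneracy {..<n} E * k)) \<and> (r answer_reg \<noteq> 0 \<longleftrightarrow> Dominating_Set {..<n} E k))
    (initial (encode_instance n E k))"
proof -
  let ?X = "(n + 1) ^ 3 * 3 ^ (degeneracy {..<n} E * k)" and ?m = "input_memory n E k"
  have init: "initial (encode_instance n E k) = (\<lambda>_. 0, ?m)"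
    by (simp add: input_memory_def initial_def)
  have room: "2 + n * n + n + n + (n + 1) ^ (n + 1) * ((n + 3) * ((n + 1) * 3 ^ (n * n))) < 2 ^ L"
    using instance_room[of n] power_increasing[OF wide, of "2::nat"] by linarith
  then have one_less: "1 < (2::nat) ^ L" by linarith
  have "1 * 1 \<le> ?X" by (rule mult_le_mono) auto
  show ?thesis
  proof (cases "k < n")
    case True
    let ?r = "(\<lambda>_. 0)(k_reg := k, n_reg := n, cell_reg := n - k)"
    interpret graph_instance n L "2 + n * n" "2 + n * n + n" "2 + n * n + n + n" E
      using graph True room by unfold_locales linarith+
    have "vc L Solve (\<lambda>u (r', m'). u \<le> 700 * ?X \<and> (r' answer_reg \<noteq> 0 \<longleftrightarrow> Dominating_Set {..<n} E k)) (?r, ?m)"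
      by (rule vc_Solve[OF _ _ True _ _ room])
        (simp, simp, blast intro: input_memory_entry, blast intro: input_memory_outside)
    then show ?thesis
      unfolding Decide_Dominating_Set_def init
      using True one_less \<open>1 * 1 \<le> ?X\<close> by (auto simp: input_memory_header elim!: vc_mono)
  next
    case False
    then show ?thesis
      unfolding Decide_Dominating_Set_def init
      using one_less \<open>1 * 1 \<le> ?X\<close> Dominating_Set_if_size_le[of n k E] by (simp add: input_memory_header)
  qed
qed

lemma Decide_Dominating_Set_decides:
  fixes n k :: nat and E :: "nat set set"
  assumes "simple_graph {..<n} E"
  defines "N \<equiv> input_size (encode_instance n E k)"
  shows "decides_in_time Decide_Dominating_Set (encode_instance n E k) (Dominating_Set {..<n} E k)
    (50000 * real N ^ 5 * 3 ^ (degeneracy {..<n} E * k))"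
proof -
  let ?T = "710 * ((n + 1) ^ 3 * 3 ^ (degeneracy {..<n} E * k))" and ?L = "word_size n + N"
  have "2 + n * n \<le> N"
    using length_le_input_size[of "encode_instance n E k"] by (simp add: N_def length_encode_instance)
  moreover have "n \<le> n * n" by (cases n) auto
  ultimately have size_le: "n + 2 \<le> N" by linarith
  then have "word_size n \<le> 20 * N ^ 2" unfolding word_size_def by (intro mult_le_mono2 power_mono) auto
  moreover have "N \<le> N ^ 2" by (cases N) (auto simp: power2_eq_square)
  ultimately have cost: "2 * ?L + 1 \<le> 43 * N ^ 2" using size_le by simp
  have "?T \<le> 710 * (N ^ 3 * 3 ^ (degeneracy {..<n} E * k))"
    using size_le by (intro mult_le_mono power_mono) auto
  then have "?T * (2 * ?L + 1) \<le> 710 * (N ^ 3 * 3 ^ (degeneracy {..<n} E * k)) * (43 * N ^ 2)"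
    using cost by (rule mult_le_mono)
  also have "\<dots> = 30530 * N ^ 5 * 3 ^ (degeneracy {..<n} E * k)"
    using power_add[of N 3 2] by simp
  finally have "real (?T * (2 * ?L + 1)) \<le> real (50000 * N ^ 5 * 3 ^ (degeneracy {..<n} E * k))"
    by (simp only: of_nat_le_iff)
  moreover have "decides_in_time Decide_Dominating_Set (encode_instance n E k) (Dominating_Set {..<n} E k)
      (real (?T * (2 * ?L + 1)))"
    using vc_Decide_Dominating_Set[OF assms(1)] by (rule vc_decides_in_time) (simp_all add: N_def)
  ultimately show ?thesis by (auto elim: decides_in_time_mono)
qed

theorem theorem10:
  "\<exists>(P :: ram) (g :: nat \<Rightarrow> real). g \<in> o(\<lambda>N. real N) \<and>
     solves_Dominating_Set_in_O_star P (\<lambda>d k. 3 powr (real (d * k) + g (d * k)))"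
proof (intro exI conjI)
  show "(\<lambda>_. 0) \<in> o(\<lambda>N. real N)" by simp
  have "3 powr (real (d * k) + 0) = 3 ^ (d * k)" for d k
    using powr_realpow[of 3 "d * k"] by simp
  then show "solves_Dominating_Set_in_O_star Decide_Dominating_Set (\<lambda>d k. 3 powr (real (d * k) + 0))"
    unfolding solves_Dominating_Set_in_O_star_def
    using Decide_Dominating_Set_decides by (intro exI[of _ "monom 50000 5"]) (auto simp: poly_monom)
qed

end
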